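(* Let $R$ be a measurable function on the unit circle $\mathbb T$ with $|R(t)|\le 1$ a.e. and $\log(1-|R|)\in L^1(\mathbb T)$, and let $\check K_{n,m},\widetilde{\check K}_{n,m}\in L^R$ and $\check a_j(0)$ be as defined in the context. Then, with convergence in the norm of $L^R$: for every fixed $n\in\mathbb Z$, $$\check K_{n,m}\to\begin{bmatrix}1\\R\end{bmatrix}t^n\quad\text{as } m\to\infty ;$$ for every fixed $m\in\mathbb Z$, $$\widetilde{\check K}_{n,m}\to\begin{bmatrix}\overline R\\1\end{bmatrix}\overline t^{\,m+1}\quad\text{as } n\to\infty ;$$ and $$\check a_j(0)\to 1\quad\text{as } j\to\infty .$$
   Context: $L^R$ is the Hilbert space of (classes of) measurable functions $f=\begin{bmatrix}f_1\\ f_2\end{bmatrix}:\mathbb T\to\mathbb C^2$ with finite norm for the inner product $\langle f,g\rangle=\int_{\mathbb T} g(t)^*\begin{bmatrix}1&\overline{R(t)}\\R(t)&1\end{bmatrix}^{-1}f(t)\,dm(t)$, $m$ the normalized Lebesgue measure. $L^2=L^2(\mathbb T)$, $H^2_+$ is the Hardy space of the disk, $H^2_-=L^2\ominus H^2_+$. For $n,m\in\mathbb Z$ let $\check{\mathcal H}_{n,m}$ be the closure in $L^R$ of $\left\{\begin{bmatrix}1&\overline R\\R&1\end{bmatrix}\begin{bmatrix}t^n h_+\\ \overline t^{\,m}h_-\end{bmatrix}: h_+\in H^2_+,\ h_-\in H^2_-\right\}$. The subspaces $\check{\mathcal H}_{n+1,m}$ and $\check{\mathcal H}_{n,m+1}$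 have codimension one in $\check{\mathcal H}_{n,m}$. Let $\check K_{n,m}$ be the unit vector in $\check{\mathcal H}_{n,m}\ominus\check{\mathcal H}_{n+1,m}$ normalized by $\left\langle\begin{bmatrix}1\\R\end{bmatrix}t^n,\check K_{n,m}\right\rangle>0$, and let $\widetilde{\check K}_{n,m}$ be the unit vector in $\check{\mathcal H}_{n,m}\ominus\check{\mathcal H}_{n,m+1}$ normalized by $\left\langle\widetilde{\check K}_{n,m},\begin{bmatrix}\overline R\\1\end{bmatrix}\overline t^{\,m+1}\right\rangle>0$. The number $\check a_{n+m}(0):=\left\langle\begin{bmatrix}1\\R\end{bmatrix}t^n,\check K_{n,m}\right\rangle$ depends only on $n+m$. (It is the value at $0$ of the outer function $\check a_{n+m}(\zeta)=\left\langle(I-\zeta A_0^* )^{-1}\begin{bmatrix}1\\R\end{bmatrix}t^n,\check K_{n,m}\right\rangle$, where $A_0h=tP_{\check{\mathcal H}_{n,m+1}}h$ for $h\in\check{\mathcal H}_{n,m}$ and $P$ denotes orthogonal projection.) *)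

theory Defs
  imports "HOL-Analysis.Analysis"
begin

(* Elements of the L^2-type spaces below are represented by functions on the unit circle
   (values off the circle are irrelevant); functions that agree almost everywhere are at
   distance 0 and are not identified. *)

text \<open>Normalized Lebesgue measure on the unit circle, on the Lebesgue-measurable sets.\<close>

definition circle :: "complex measure" where
  "circle = completion
     (distr (uniform_measure lborel {0..<2 * pi}) (restrict_space borel (sphere 0 1)) cis)"

text \<open>Logarithmic integrability of a nonnegative function. In HOL \<open>ln 0 = 0\<close>, so the convention
  \<open>log 0 = - \<infinity>\<close> has to be built in: the logarithm can only be integrable if the function is
  almost everywhere positive.\<close>

definition log_integrable :: "'a measure \<Rightarrow> ('a \<Rightarrow> real) \<Rightarrow> bool" where
  "log_integrable M g \<longleftrightarrow> (AE x in M. 0 < g x) \<and> integrable M (\<lambda>x. ln (g x))"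

definition L2 :: "(complex \<Rightarrow> complex) set" where
  "L2 = {f \<in> borel_measurable circle. integrable circle (\<lambda>t. (cmod (f t))\<^sup>2)}"

definition fourier_coeff :: "(complex \<Rightarrow> complex) \<Rightarrow> int \<Rightarrow> complex" where
  "fourier_coeff f k = (LINT t|circle. f t * cnj t powi k)"

text \<open>The Hardy space of the disk, as the subspace of \<open>L2\<close> formed by its boundary functions.\<close>

definition H2_plus :: "(complex \<Rightarrow> complex) set" where
  "H2_plus = {f \<in> L2. \<forall>k<0. fourier_coeff f k = 0}"

definition H2_minus :: "(complex \<Rightarrow> complex) set" where
  "H2_minus = {g \<in> L2. \<forall>h\<in>H2_plus. (LINT t|circle. g t * cnj (h t)) = 0}"

definition W :: "(complex \<Rightarrow> complex) \<Rightarrow> complex \<Rightarrow> complex^2^2" where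
  "W R t = vector [vector [1, cnj (R t)], vector [R t, 1]]"

text \<open>The integrand \<open>g(t)\<^sup>* W(t)\<^sup>-\<^sup>1 f(t)\<close> of the inner product, linear in \<open>f\<close>. The matrix is
  invertible wherever \<open>\<bar>R(t)\<bar> < 1\<close>.\<close>

definition LR_form ::
    "(complex \<Rightarrow> complex) \<Rightarrow> (complex \<Rightarrow> complex^2) \<Rightarrow> (complex \<Rightarrow> complex^2) \<Rightarrow> complex \<Rightarrow> complex"
  where "LR_form R f g t = (\<Sum>i\<in>UNIV. cnj (g t $ i) * (matrix_inv (W R t) *v f t) $ i)"

definition LR_inner ::
    "(complex \<Rightarrow> complex) \<Rightarrow> (complex \<Rightarrow> complex^2) \<Rightarrow> (complex \<Rightarrow> complex^2) \<Rightarrow> complex"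
  where "LR_inner R f g = (LINT t|circle. LR_form R f g t)"

definition LR :: "(complex \<Rightarrow> complex) \<Rightarrow> (complex \<Rightarrow> complex^2) set" where
  "LR R = {f \<in> borel_measurable circle. integrable circle (LR_form R f f)}"

definition LR_norm :: "(complex \<Rightarrow> complex) \<Rightarrow> (complex \<Rightarrow> complex^2) \<Rightarrow> real" where
  "LR_norm R f = sqrt (Re (LR_inner R f f))"

definition LR_closure ::
    "(complex \<Rightarrow> complex) \<Rightarrow> (complex \<Rightarrow> complex^2) set \<Rightarrow> (complex \<Rightarrow> complex^2) set"
  where "LR_closure R S = {f \<in> LR R. \<forall>\<epsilon>>0. \<exists>s\<in>S. LR_norm R (\<lambda>t. f t - s t) < \<epsilon>}"

definition H_check :: "(complex \<Rightarrow> complex) \<Rightarrow> int \<Rightarrow> int \<Rightarrow> (complex \<Rightarrow> complex^2) set" where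
  "H_check R n m = LR_closure R
     {(\<lambda>t. W R t *v vector [t powi n * hp t, cnj t powi m * hm t]) | hp hm.
        hp \<in> H2_plus \<and> hm \<in> H2_minus}"

definition e_plus :: "(complex \<Rightarrow> complex) \<Rightarrow> int \<Rightarrow> complex \<Rightarrow> complex^2" where
  "e_plus R n t = vector [t powi n, R t * t powi n]"

definition e_minus :: "(complex \<Rightarrow> complex) \<Rightarrow> int \<Rightarrow> complex \<Rightarrow> complex^2" where
  "e_minus R m t = vector [cnj (R t) * cnj t powi (m + 1), cnj t powi (m + 1)]"

definition is_K_check ::
    "(complex \<Rightarrow> complex) \<Rightarrow> int \<Rightarrow> int \<Rightarrow> (complex \<Rightarrow> complex^2) \<Rightarrow> bool" where
  "is_K_check R n m K \<longleftrightarrow>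
     K \<in> H_check R n m \<and> (\<forall>g\<in>H_check R (n + 1) m. LR_inner R K g = 0) \<and>
     LR_norm R K = 1 \<and> (\<exists>r>0. LR_inner R (e_plus R n) K = complex_of_real r)"

definition is_K_check_tilde ::
    "(complex \<Rightarrow> complex) \<Rightarrow> int \<Rightarrow> int \<Rightarrow> (complex \<Rightarrow> complex^2) \<Rightarrow> bool" where
  "is_K_check_tilde R n m K \<longleftrightarrow>
     K \<in> H_check R n m \<and> (\<forall>g\<in>H_check R n (m + 1). LR_inner R K g = 0) \<and>
     LR_norm R K = 1 \<and> (\<exists>r>0. LR_inner R K (e_minus R m) = complex_of_real r)"

text \<open>These vectors are unique as elements of the Hilbert space, that is, up to equality almost
  everywhere; the choice operator selects a representative.\<close>

definition K_check :: "(complex \<Rightarrow> complex) \<Rightarrow> int \<Rightarrow> int \<Rightarrow> complex \<Rightarrow> complex^2" where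
  "K_check R n m = (SOME K. is_K_check R n m K)"

definition K_check_tilde :: "(complex \<Rightarrow> complex) \<Rightarrow> int \<Rightarrow> int \<Rightarrow> complex \<Rightarrow> complex^2" where
  "K_check_tilde R n m = (SOME K. is_K_check_tilde R n m K)"

text \<open>The number \<open>a\<^sub>j(0)\<close>: the common value of the inner products over all \<open>n\<close>, \<open>m\<close> with
  \<open>n + m = j\<close>.\<close>

definition a_check_0 :: "(complex \<Rightarrow> complex) \<Rightarrow> int \<Rightarrow> complex" where
  "a_check_0 R j =
     (THE c. \<forall>n m. n + m = j \<longrightarrow> LR_inner R (e_plus R n) (K_check R n m) = c)"

end

theory Submission
  imports Defs "HOL-Library.Function_Algebras" "HOL-Computational_Algebra.Polynomial"
begin

text \<open>The vector \<open>K_check R n m\<close> is the normalized component of the unit vector \<open>e_plus R n\<close> orthogonal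
  to \<open>H_check R (n + 1) m\<close>. If \<open>d\<close> is the distance from \<open>e_plus R n\<close> to that subspace, then
  \<open>a_check_0 = d\<close> and the squared distance from \<open>K_check R n m\<close> to \<open>e_plus R n\<close> is \<open>2 - 2 d\<close>;
  moreover \<open>d\<close> depends only on \<open>n + m\<close>. Everything therefore reduces to \<open>d \<rightarrow> 1\<close>.

  Write the difference of \<open>e_plus R n\<close> and an element of the subspace, after division by
  \<open>t\<^sup>n\<close>, as \<open>W (1 - t u, cnj t\<^sup>N v)\<close> with \<open>N = n + m\<close>. Its squared norm is
  \<open>\<integral> |f|\<^sup>2 + (1 - |R|\<^sup>2) |v|\<^sup>2\<close> where \<open>f = 1 - t u + cnj R cnj t\<^sup>N v\<close>. Let \<open>a\<close> be bounded analytic with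
  \<open>|a| \<le> 1\<close>, \<open>|a| \<le> C (1 - |R|)\<close> and mean close to 1; such \<open>a\<close> exist because \<open>log (1 - |R|)\<close> is
  integrable. Then \<open>\<integral> a f\<close> differs from the mean of \<open>a\<close> by \<open>\<integral> a cnj R cnj t\<^sup>N v\<close>, which tends to 0
  uniformly as \<open>N\<close> grows because \<open>a v\<close> is bounded in \<open>L2\<close> by the norm.

  No boundary value theory is needed for \<open>a\<close>: it is an almost everywhere limit of
  \<open>exp (- q)\<close> for polynomials \<open>q\<close> whose real parts increase to a majorant of the wanted \<open>- log |a|\<close>.\<close>

section \<open>Semi-inner product spaces and innovations\<close>

text \<open>The unit vectors come from a choice operator, so the limits have content only where
  vectors with the defining properties exist. Existence follows from \<open>0 < defect\<close>, and
  the lower bound that gives the limit also supplies this for all large \<open>n + m\<close>, which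
  is enough. The means of the multipliers can approach 1 because the logarithm is truncated:
  demanding \<open>|a| <= exp k * (1 - |R|)\<close> costs only the part of
  \<open>- log (1 - |R|)\<close> above \<open>k\<close>, whose integral tends to 0, and the mean of
  such an \<open>a\<close> can be kept near the exponential of minus that cost. The delicate point
  in building \<open>a\<close> is the imaginary part of the polynomials \<open>q\<close>, the
  harmonic conjugate, which has no L1 bound in terms of the L1 norm of the real part. It is never
  estimated: for \<open>|w| <= 1\<close> the square of \<open>|1 - w|\<close> is at most
  \<open>2 - 2 Re w\<close>, and the mean of \<open>exp (- q)\<close> is known exactly. Since
  functions equal almost everywhere stay distinct, the geometry is done with semidefinite forms on a
  carrier set.\<close>

locale semi_inner = vector_space scale
  for scale :: "complex \<Rightarrow> 'v::ab_group_add \<Rightarrow> 'v" +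
  fixes V :: "'v set" and ip :: "'v \<Rightarrow> 'v \<Rightarrow> complex"
  assumes subspace_V: "subspace V"
    and ip_add_left: "\<lbrakk>f \<in> V; g \<in> V; h \<in> V\<rbrakk> \<Longrightarrow> ip (f + g) h = ip f h + ip g h"
    and ip_scale_left: "\<lbrakk>f \<in> V; g \<in> V\<rbrakk> \<Longrightarrow> ip (scale c f) g = c * ip f g"
    and ip_commute: "\<lbrakk>f \<in> V; g \<in> V\<rbrakk> \<Longrightarrow> ip g f = cnj (ip f g)"
    and ip_ge_0: "f \<in> V \<Longrightarrow> 0 \<le> Re (ip f f)"
begin

definition nrm :: "'v \<Rightarrow> real" where "nrm f = sqrt (Re (ip f f))"

lemma V_closed [simp]:
  "0 \<in> V" "f \<in> V \<Longrightarrow> g \<in> V \<Longrightarrow> f + g \<in> V" "f \<in> V \<Longrightarrow> g \<in> V \<Longrightarrow> f - g \<in> V"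
  "f \<in> V \<Longrightarrow> scale c f \<in> V"
  using subspace_V subspace_0 subspace_add subspace_diff subspace_scale by auto

lemma nrm_ge_0 [simp]: "f \<in> V \<Longrightarrow> 0 \<le> nrm f"
  by (simp add: nrm_def ip_ge_0)

lemma nrm_power2: "f \<in> V \<Longrightarrow> (nrm f)\<^sup>2 = Re (ip f f)"
  by (simp add: nrm_def ip_ge_0)

lemma ip_self: "f \<in> V \<Longrightarrow> ip f f = complex_of_real ((nrm f)\<^sup>2)"
  using ip_commute[of f f] by (simp add: nrm_power2 complex_eq_iff)

lemma ip_diff_left: "\<lbrakk>f \<in> V; g \<in> V; h \<in> V\<rbrakk> \<Longrightarrow> ip (f - g) h = ip f h - ip g h"
  using ip_add_left[of "f - g" g h] by simp

lemma ip_add_right: "\<lbrakk>f \<in> V; g \<in> V; h \<in> V\<rbrakk> \<Longrightarrow> ip h (f + g) = ip h f + ip h g"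
  using ip_commute[of "f + g" h] ip_commute[of f h] ip_commute[of g h] ip_add_left by simp

lemma ip_diff_right: "\<lbrakk>f \<in> V; g \<in> V; h \<in> V\<rbrakk> \<Longrightarrow> ip h (f - g) = ip h f - ip h g"
  using ip_add_right[of "f - g" g h] by simp

lemma ip_scale_right: "\<lbrakk>f \<in> V; g \<in> V\<rbrakk> \<Longrightarrow> ip g (scale c f) = cnj c * ip g f"
  using ip_commute[of "scale c f" g] ip_commute[of f g] ip_scale_left by simp

lemma nrm_scale: "f \<in> V \<Longrightarrow> nrm (scale c f) = cmod c * nrm f"
proof (rule power2_eq_imp_eq)
  assume f: "f \<in> V"
  have "ip (scale c f) (scale c f) = (c * cnj c) * ip f f"
    using f by (simp add: ip_scale_left ip_scale_right)
  also have "\<dots> = complex_of_real ((cmod c)\<^sup>2 * (nrm f)\<^sup>2)"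
    using f by (simp only: ip_self complex_norm_square of_real_mult)
  finally show "(nrm (scale c f))\<^sup>2 = (cmod c * nrm f)\<^sup>2"
    using f by (simp only: nrm_power2[OF V_closed(4)] power_mult_distrib Re_complex_of_real)
qed auto

lemma nrm_add_power2:
  "\<lbrakk>f \<in> V; g \<in> V\<rbrakk> \<Longrightarrow> (nrm (f + g))\<^sup>2 = (nrm f)\<^sup>2 + 2 * Re (ip f g) + (nrm g)\<^sup>2"
  using ip_commute[of f g] by (simp add: nrm_power2 ip_add_left ip_add_right)

lemma nrm_diff_power2:
  "\<lbrakk>f \<in> V; g \<in> V\<rbrakk> \<Longrightarrow> (nrm (f - g))\<^sup>2 = (nrm f)\<^sup>2 - 2 * Re (ip f g) + (nrm g)\<^sup>2"
  using ip_commute[of f g] by (simp add: nrm_power2 ip_diff_left ip_diff_right)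

lemma nrm_diff_commute: "\<lbrakk>f \<in> V; g \<in> V\<rbrakk> \<Longrightarrow> nrm (f - g) = nrm (g - f)"
  using ip_commute[of f g] by (simp add: nrm_def ip_diff_left ip_diff_right)

text \<open>Nonnegativity of the squared norm of \<open>x f - y h\<close> is a quadratic inequality
  in two real parameters. Since vectors of norm zero need not vanish, the case where a norm is zero
  has to be settled by a separate choice of parameters.\<close>

lemma Cauchy_Schwarz:
  assumes f: "f \<in> V" and g: "g \<in> V"
  shows "cmod (ip f g) \<le> nrm f * nrm g"
proof -
  have real_case: "Re (ip f h) \<le> nrm f * nrm h" if h: "h \<in> V" for h
  proof -
    have "0 \<le> x\<^sup>2 * (nrm f)\<^sup>2 - 2 * (x * y) * Re (ip f h) + y\<^sup>2 * (nrm h)\<^sup>2" for x y :: real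
    proof -
      have "(nrm (scale (of_real x) f - scale (of_real y) h))\<^sup>2 =
          (cmod (of_real x) * nrm f)\<^sup>2 - 2 * Re (ip (scale (of_real x) f) (scale (of_real y) h))
          + (cmod (of_real y) * nrm h)\<^sup>2"
        using f h by (simp add: nrm_diff_power2 nrm_scale)
      also have "\<dots> = x\<^sup>2 * (nrm f)\<^sup>2 - 2 * (x * y) * Re (ip f h) + y\<^sup>2 * (nrm h)\<^sup>2"
        using f h by (simp add: ip_scale_left ip_scale_right power_mult_distrib)
      finally show ?thesis by (metis zero_le_power2)
    qed
    note quad = this
    have nn: "0 \<le> nrm f" "0 \<le> nrm h" using f h by auto
    show ?thesis
    proof (cases "nrm f * nrm h = 0")
      case False
      from quad[of "nrm h" "nrm f"]
      have "2 * (nrm f * nrm h) * Re (ip f h) \<le> 2 * (nrm f * nrm h) * (nrm f * nrm h)"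
        by (simp add: power2_eq_square algebra_simps)
      moreover have "0 < 2 * (nrm f * nrm h)" using nn False by (simp add: less_le)
      ultimately show ?thesis by (rule mult_left_le_imp_le)
    next
      case True
      have "Re (ip f h) \<le> 0"
      proof (rule ccontr)
        assume "\<not> Re (ip f h) \<le> 0"
        then have r: "Re (ip f h) > 0" by simp
        from True consider "nrm f = 0" | "nrm h = 0" by auto
        then show False
        proof cases
          case 1
          \<comment> \<open>With \<open>nrm f = 0\<close> only the mixed term and the
            \<open>h\<close> term remain. These parameters make the mixed term outweigh the other,
            so that a positive \<open>Re (ip f h)\<close> would make the form negative.\<close>
          from quad[of "(nrm h)\<^sup>2 + 1" "Re (ip f h)"] 1
          have "0 \<le> - (2 * (nrm h)\<^sup>2 + 2) * (Re (ip f h))\<^sup>2 + (Re (ip f h))\<^sup>2 * (nrm h)\<^sup>2"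
            by (simp add: power2_eq_square algebra_simps)
          then have "((nrm h)\<^sup>2 + 2) * (Re (ip f h))\<^sup>2 \<le> 0" by (simp add: algebra_simps)
          moreover have "((nrm h)\<^sup>2 + 2) * (Re (ip f h))\<^sup>2 > 0"
            using r by (intro mult_pos_pos) (auto intro: add_nonneg_pos)
          ultimately show False by linarith
        next
          case 2
          from quad[of "Re (ip f h)" "(nrm f)\<^sup>2 + 1"] 2
          have "0 \<le> - (2 * (nrm f)\<^sup>2 + 2) * (Re (ip f h))\<^sup>2 + (Re (ip f h))\<^sup>2 * (nrm f)\<^sup>2"
            by (simp add: power2_eq_square algebra_simps)
          then have "((nrm f)\<^sup>2 + 2) * (Re (ip f h))\<^sup>2 \<le> 0" by (simp add: algebra_simps)
          moreover have "((nrm f)\<^sup>2 + 2) * (Re (ip f h))\<^sup>2 > 0"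
            using r by (intro mult_pos_pos) (auto intro: add_nonneg_pos)
          ultimately show False by linarith
        qed
      qed
      moreover have "0 \<le> nrm f * nrm h" using nn by (rule mult_nonneg_nonneg)
      ultimately show ?thesis by linarith
    qed
  qed
  show ?thesis
  proof (cases "ip f g = 0")
    case True then show ?thesis using f g by simp
  next
    case False
    \<comment> \<open>The phase that makes \<open>ip f (scale c g)\<close> equal to the modulus of
      \<open>ip f g\<close>, so that the bound on real parts applies.\<close>
    define c where "c = sgn (ip f g)"
    have c: "cmod c = 1" using False by (simp add: c_def norm_sgn)
    have "cnj c * ip f g = (ip f g * cnj (ip f g)) / of_real (cmod (ip f g))"
      by (simp add: c_def complex_sgn_def scaleR_conv_of_real divide_inverse)
    also have "\<dots> = complex_of_real (cmod (ip f g))"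
      using False by (simp add: complex_norm_square[symmetric] power2_eq_square)
    finally have "cnj c * ip f g = complex_of_real (cmod (ip f g))" .
    then have "Re (ip f (scale c g)) = cmod (ip f g)"
      using f g by (simp add: ip_scale_right)
    then show ?thesis using real_case[of "scale c g"] g c by (simp add: nrm_scale)
  qed
qed

lemma nrm_triangle: "\<lbrakk>f \<in> V; g \<in> V\<rbrakk> \<Longrightarrow> nrm (f + g) \<le> nrm f + nrm g"
proof (rule power2_le_imp_le)
  assume fg: "f \<in> V" "g \<in> V"
  have "Re (ip f g) \<le> nrm f * nrm g"
    using Cauchy_Schwarz[OF fg] complex_Re_le_cmod order_trans by blast
  then show "(nrm (f + g))\<^sup>2 \<le> (nrm f + nrm g)\<^sup>2"
    using fg by (simp add: nrm_add_power2 power2_sum)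
qed auto

text \<open>No closure of \<open>S\<close> is formed: the distance of \<open>e\<close> to \<open>S\<close> and to its closure coincide.\<close>

definition defect :: "'v set \<Rightarrow> 'v \<Rightarrow> real" where
  "defect S e = (INF s\<in>S. nrm (e - s))"

text \<open>The normalized component of \<open>e\<close> orthogonal to \<open>S\<close>. The
  approximation clause places \<open>K\<close> in the closure of the span of \<open>e\<close> and
  \<open>S\<close>, again without forming a closure.\<close>

definition is_innovation :: "'v set \<Rightarrow> 'v \<Rightarrow> 'v \<Rightarrow> bool" where
  "is_innovation S e K \<longleftrightarrow> K \<in> V \<and> (\<forall>\<epsilon>>0. \<exists>c. \<exists>s\<in>S. nrm (K - (scale c e + s)) < \<epsilon>) \<and>
     (\<forall>s\<in>S. ip K s = 0) \<and> nrm K = 1 \<and> (\<exists>r>0. ip e K = complex_of_real r)"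

lemma defect_le:
  assumes "S \<subseteq> V" "e \<in> V" "s \<in> S"
  shows "defect S e \<le> nrm (e - s)"
  unfolding defect_def using assms
  by (intro cINF_lower bdd_belowI2[where m = 0]) auto

text \<open>Orthogonality to \<open>S\<close> gives \<open>ip (e - s) K = ip e K\<close>, hence
  \<open>ip e K <= nrm (e - s)\<close> for every \<open>s\<close>. Conversely, if
  \<open>scale c e + s\<close> is within \<open>\<eta>\<close> of \<open>K\<close>, pairing with
  \<open>K\<close> gives \<open>|c| r >= 1 - \<eta>\<close>, while its norm is at least
  \<open>|c|\<close> times the defect and at most \<open>1 + \<eta>\<close>; combine the two and let
  \<open>\<eta>\<close> tend to 0.\<close>

lemma innovation_ip:
  assumes S: "subspace S" "S \<subseteq> V" and e: "e \<in> V" and K: "is_innovation S e K"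
  shows "ip e K = complex_of_real (defect S e)"
proof -
  have KV: "K \<in> V" and approx: "\<And>\<epsilon>. \<epsilon> > 0 \<Longrightarrow> \<exists>c. \<exists>s\<in>S. nrm (K - (scale c e + s)) < \<epsilon>"
    and orth: "\<And>s. s \<in> S \<Longrightarrow> ip K s = 0" and K1: "nrm K = 1"
    using K by (auto simp: is_innovation_def)
  obtain r where r: "r > 0" "ip e K = complex_of_real r" using K by (auto simp: is_innovation_def)
  have orth': "ip s K = 0" if "s \<in> S" for s
    using orth[OF that] ip_commute[of K s] KV S that by auto
  have "r \<le> nrm (e - s)" if s: "s \<in> S" for s
  proof -
    have "ip (e - s) K = of_real r" using r orth'[OF s] s S e KV by (auto simp: ip_diff_left)
    then show ?thesis using Cauchy_Schwarz[of "e - s" K] s S e KV K1 r by auto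
  qed
  then have le: "r \<le> defect S e"
    unfolding defect_def using S(1) subspace_0 by (intro cINF_greatest) auto
  have bound: "defect S e * (1 - \<eta>) \<le> r * (1 + \<eta>)" if \<eta>: "0 < \<eta>" "\<eta> < 1" for \<eta>
  proof -
    obtain c s where s: "s \<in> S" and cs: "nrm (K - (scale c e + s)) < \<eta>" using approx \<eta> by blast
    have sV: "s \<in> V" using s S by auto
    have "ip (K - (scale c e + s)) K = 1 - c * of_real r"
      using KV e sV r orth'[OF s] K1 by (simp add: ip_diff_left ip_add_left ip_scale_left ip_self)
    then have "cmod (1 - c * of_real r) < \<eta>"
      using Cauchy_Schwarz[of "K - (scale c e + s)" K] KV e sV K1 cs by auto
    moreover have "cmod (1::complex) \<le> cmod (1 - c * of_real r) + cmod (c * of_real r)"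
      by (metis diff_add_cancel norm_triangle_ineq)
    ultimately have cr: "1 - \<eta> \<le> cmod c * r" using r by (simp add: norm_mult)
    then have c0: "cmod c > 0" using \<eta> r by (smt (verit) mult_nonneg_nonneg norm_ge_zero mult_eq_0_iff zero_less_norm_iff norm_zero)
    have "nrm (scale c e + s) \<le> nrm ((scale c e + s) - K) + nrm K"
      using nrm_triangle[of "(scale c e + s) - K" K] e sV KV by simp
    then have n1: "nrm (scale c e + s) \<le> 1 + \<eta>"
      using cs K1 nrm_diff_commute[of K "scale c e + s"] KV e sV by simp
    have t: "scale (- inverse c) s \<in> S" using S(1) s by (rule subspace_scale)
    have "scale c e + s = scale c (e - scale (- inverse c) s)"
      using c0 by (simp add: scale_right_diff_distrib scale_right_distrib)
    then have "cmod c * defect S e \<le> 1 + \<eta>"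
      using n1 nrm_scale[of "e - scale (- inverse c) s" c] e sV defect_le[OF S(2) e t] c0
      by (smt (verit) V_closed mult_left_mono)
    then have "r * (cmod c * defect S e) \<le> r * (1 + \<eta>)" using r by simp
    moreover have "(1 - \<eta>) * defect S e \<le> (cmod c * r) * defect S e"
      using cr le r by (intro mult_right_mono) auto
    ultimately show ?thesis by (simp add: mult_ac)
  qed
  have "((\<lambda>\<eta>. defect S e * (1 - \<eta>)) \<longlongrightarrow> defect S e * (1 - 0)) (at_right 0)"
    "((\<lambda>\<eta>. r * (1 + \<eta>)) \<longlongrightarrow> r * (1 + 0)) (at_right 0)"
    by (intro tendsto_intros)+
  moreover have "eventually (\<lambda>\<eta>. defect S e * (1 - \<eta>) \<le> r * (1 + \<eta>)) (at_right (0::real))"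
    using eventually_at_right_less[of "0::real"] eventually_at_right_real[of 0 "1::real"]
    by (elim eventually_elim2[rotated]) (use bound in auto)
  ultimately have "defect S e \<le> r"
    using tendsto_le[of "at_right (0::real)" "\<lambda>\<eta>. r * (1 + \<eta>)" "r * (1+0)" "\<lambda>\<eta>. defect S e * (1 - \<eta>)" "defect S e * (1 - 0)"] by simp
  with le r show ?thesis by simp
qed

lemma innovation_dist:
  assumes "subspace S" "S \<subseteq> V" "e \<in> V" "nrm e = 1" "is_innovation S e K"
  shows "nrm (K - e) = sqrt (2 - 2 * defect S e)"
proof -
  have KV: "K \<in> V" "nrm K = 1" using assms(5) by (auto simp: is_innovation_def)
  have "Re (ip K e) = defect S e"
    using innovation_ip[OF assms(1-3,5)] ip_commute[of e K] KV assms(3) by simp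
  then have "(nrm (K - e))\<^sup>2 = 2 - 2 * defect S e"
    using nrm_diff_power2[OF KV(1) assms(3)] KV assms by simp
  then show ?thesis using nrm_ge_0[of "K - e"] KV assms(3) by (metis V_closed(3) real_sqrt_unique)
qed

end

locale semi_hilbert = semi_inner +
  assumes complete: "\<lbrakk>\<And>k. F k \<in> V; \<And>\<epsilon>. \<epsilon> > 0 \<Longrightarrow> \<exists>N. \<forall>j\<ge>N. \<forall>k\<ge>N. nrm (F j - F k) < \<epsilon>\<rbrakk>
      \<Longrightarrow> \<exists>f\<in>V. (\<lambda>k. nrm (F k - f)) \<longlonglongrightarrow> 0"
begin

text \<open>Projection theorem: a minimizing sequence in \<open>S\<close> is Cauchy by the
  parallelogram law. Its limit \<open>p\<close> need not belong to \<open>S\<close>, so each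
  property of \<open>g = e - p\<close> is obtained through the approximants \<open>e - s k\<close>;
  the innovation is \<open>g\<close> divided by the distance.\<close>

lemma innovation_exists:
  assumes S: "subspace S" "S \<subseteq> V" and e: "e \<in> V" and pos: "0 < defect S e"
  shows "\<exists>K. is_innovation S e K"
proof -
  define d where "d = defect S e"
  have d0: "d > 0" using pos d_def by simp
  have S0: "S \<noteq> {}" using S(1) subspace_0 by blast
  have "\<exists>s\<in>S. nrm (e - s) < d + inverse (real (Suc k))" for k
  proof -
    have "bdd_below ((\<lambda>s. nrm (e - s)) ` S)"
      using S e by (intro bdd_belowI2[where m = 0]) auto
    then show ?thesis
      using S0 cINF_less_iff[of S "\<lambda>s. nrm (e - s)" "d + inverse (real (Suc k))"]
      by (simp add: d_def defect_def)
  qed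
  then obtain s where s: "\<And>k. s k \<in> S" and sd: "\<And>k. nrm (e - s k) < d + inverse (real (Suc k))"
    by metis
  have sV: "s k \<in> V" for k using s S by auto
  have lo: "d \<le> nrm (e - s k)" for k using defect_le[OF S(2) e s] d_def by simp
  have lim: "(\<lambda>k. nrm (e - s k)) \<longlonglongrightarrow> d"
  proof (rule tendsto_sandwich)
    show "eventually (\<lambda>k. d \<le> nrm (e - s k)) sequentially" using lo by simp
    show "eventually (\<lambda>k. nrm (e - s k) \<le> d + inverse (real (Suc k))) sequentially"
      using sd less_imp_le by (intro always_eventually) blast
    show "(\<lambda>k. d + inverse (real (Suc k))) \<longlonglongrightarrow> d"
      using tendsto_add[OF tendsto_const LIMSEQ_inverse_real_of_nat] by simp
  qed simp
  \<comment> \<open>Parallelogram identity for \<open>e - s j\<close> and \<open>e - s k\<close>: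
    half their sum is the difference of \<open>e\<close> and a midpoint that lies in
    \<open>S\<close>, so it has norm at least \<open>d\<close>.\<close>
  have par: "(nrm (s j - s k))\<^sup>2 \<le> 2 * (nrm (e - s j))\<^sup>2 + 2 * (nrm (e - s k))\<^sup>2 - 4 * d\<^sup>2" for j k
  proof -
    let ?f = "e - s j" and ?g = "e - s k"
    have fg: "?f \<in> V" "?g \<in> V" using e sV by auto
    have m: "scale (1/2) (s j + s k) \<in> S" using s S(1) by (intro subspace_scale subspace_add)
    have "scale 2 (e - scale (1/2) (s j + s k)) = scale (1 + 1) e - (s j + s k)"
      by (simp add: scale_right_diff_distrib)
    also have "\<dots> = ?f + ?g" by (simp only: scale_left_distrib scale_one) (simp add: algebra_simps)
    finally have "nrm (?f + ?g) = 2 * nrm (e - scale (1/2) (s j + s k))"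
      using nrm_scale[of "e - scale (1/2) (s j + s k)" 2] e sV by simp
    then have "2 * d \<le> nrm (?f + ?g)" using defect_le[OF S(2) e m] d_def by simp
    then have "(2 * d)\<^sup>2 \<le> (nrm (?f + ?g))\<^sup>2" using d0 by (intro power_mono) auto
    moreover have "nrm (s j - s k) = nrm (?f - ?g)"
      using nrm_diff_commute[OF sV[of j] sV[of k]] by simp
    ultimately show ?thesis
      using nrm_add_power2[OF fg] nrm_diff_power2[OF fg] by (simp only: power_mult_distrib) simp
  qed
  have cauchy: "\<exists>N. \<forall>j\<ge>N. \<forall>k\<ge>N. nrm (s j - s k) < \<epsilon>" if \<epsilon>: "\<epsilon> > 0" for \<epsilon>
  proof -
    have "(\<lambda>k. (nrm (e - s k))\<^sup>2) \<longlonglongrightarrow> d\<^sup>2" using lim by (intro tendsto_power)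
    moreover have "d\<^sup>2 < d\<^sup>2 + \<epsilon>\<^sup>2 / 4" using \<epsilon> by simp
    ultimately have "eventually (\<lambda>k. (nrm (e - s k))\<^sup>2 < d\<^sup>2 + \<epsilon>\<^sup>2 / 4) sequentially"
      by (rule order_tendstoD(2))
    then obtain N where N: "\<And>k. k \<ge> N \<Longrightarrow> (nrm (e - s k))\<^sup>2 < d\<^sup>2 + \<epsilon>\<^sup>2 / 4"
      by (auto simp: eventually_sequentially)
    have "nrm (s j - s k) < \<epsilon>" if "j \<ge> N" "k \<ge> N" for j k
    proof (rule power2_less_imp_less)
      show "(nrm (s j - s k))\<^sup>2 < \<epsilon>\<^sup>2" using par[of j k] N[OF that(1)] N[OF that(2)] by linarith
    qed (use \<epsilon> in simp)
    then show ?thesis by blast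
  qed
  obtain p where p: "p \<in> V" and plim: "(\<lambda>k. nrm (s k - p)) \<longlonglongrightarrow> 0"
    using complete[of s, OF sV cauchy] by blast
  define g where "g = e - p"
  have gV: "g \<in> V" using e p g_def by simp
  have gs: "nrm (g - (e - s k)) = nrm (s k - p)" for k by (simp add: g_def)
  have glim: "(\<lambda>k. nrm (g - (e - s k))) \<longlonglongrightarrow> 0" using plim gs by simp
  have ng: "nrm g = d"
  proof (rule LIMSEQ_unique[OF _ lim])
    have "\<bar>nrm (e - s k) - nrm g\<bar> \<le> nrm (g - (e - s k))" for k
      using nrm_triangle[of "g - (e - s k)" "e - s k"] nrm_triangle[of "(e - s k) - g" g]
        nrm_diff_commute[of g "e - s k"] gV e sV[of k] by simp
    then have "(\<lambda>k. nrm (e - s k) - nrm g) \<longlonglongrightarrow> 0"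
      using glim by (intro Lim_null_comparison[OF _ glim] always_eventually) auto
    then show "(\<lambda>k. nrm (e - s k)) \<longlonglongrightarrow> nrm g" by (simp add: LIM_zero_iff)
  qed
  have ipg: "ip g x = 0" if x: "x \<in> S" for x
  proof (rule ccontr)
    assume nz: "ip g x \<noteq> 0"
    have xV: "x \<in> V" using x S by auto
    \<comment> \<open>Moving \<open>g\<close> along \<open>x\<close> with this coefficient lowers
      the norm strictly below \<open>d\<close>, although no vector \<open>e - s\<close> is that
      short. The \<open>+ 1\<close> keeps the denominator positive when \<open>x\<close> has norm
      zero.\<close>
    define c where "c = ip g x / of_real ((nrm x)\<^sup>2 + 1)"
    have far: "d \<le> nrm (g - scale c x)"
    proof (rule LIMSEQ_le_const)
      show "(\<lambda>k. nrm (g - (e - s k)) + nrm (g - scale c x)) \<longlonglongrightarrow> nrm (g - scale c x)"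
        using tendsto_add[OF glim tendsto_const] by simp
      have "d \<le> nrm (g - (e - s k)) + nrm (g - scale c x)" for k
      proof -
        have "s k + scale c x \<in> S" using S(1) s x by (intro subspace_add subspace_scale)
        then have "d \<le> nrm (e - (s k + scale c x))" using defect_le[OF S(2) e] d_def by simp
        also have "\<dots> = nrm ((e - s k - g) + (g - scale c x))" by (simp add: algebra_simps)
        also have "\<dots> \<le> nrm (e - s k - g) + nrm (g - scale c x)"
          using gV e sV xV by (intro nrm_triangle) auto
        finally show ?thesis using nrm_diff_commute[of g "e - s k"] gV e sV by simp
      qed
      then show "\<exists>N. \<forall>k\<ge>N. d \<le> nrm (g - (e - s k)) + nrm (g - scale c x)" by blast
    qed
    define q where "q = (nrm x)\<^sup>2 + 1"
    define a where "a = (cmod (ip g x))\<^sup>2"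
    have q: "q \<ge> 1" "(nrm x)\<^sup>2 < q" by (auto simp: q_def)
    have a: "a > 0" using nz by (simp add: a_def)
    have "ip g (scale c x) = of_real (a / q)"
      using gV xV by (simp add: ip_scale_right c_def a_def q_def complex_norm_square mult_ac del: of_real_add of_real_power)
    moreover have "(nrm (scale c x))\<^sup>2 = (a / q) * ((nrm x)\<^sup>2 / q)"
      using xV q by (simp add: nrm_scale c_def norm_divide a_def power_mult_distrib power_divide
          flip: q_def) (simp add: power2_eq_square)
    ultimately have "(nrm (g - scale c x))\<^sup>2 = d\<^sup>2 - 2 * (a / q) + (a / q) * ((nrm x)\<^sup>2 / q)"
      using gV xV ng by (simp add: nrm_diff_power2)
    also have "\<dots> < d\<^sup>2"
    proof -
      have "(a / q) * ((nrm x)\<^sup>2 / q) \<le> (a / q) * 1" using a q by (intro mult_left_mono) auto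
      moreover have "a / q > 0" using a q by simp
      ultimately show ?thesis by linarith
    qed
    finally have "nrm (g - scale c x) < d" using d0 by (rule power2_less_imp_less[OF _ less_imp_le])
    with far show False by simp
  qed
  \<comment> \<open>\<open>e\<close> is \<open>g\<close> plus a limit of vectors of
    \<open>S\<close>, all of which are orthogonal to \<open>g\<close>.\<close>
  have ipe: "ip e g = of_real (d\<^sup>2)"
  proof -
    have eq: "ip e g - of_real (d\<^sup>2) = - ip (g - (e - s k)) g" for k
    proof -
      have "ip (s k) g = 0" using ipg[OF s] ip_commute[of g "s k"] gV sV by simp
      then show ?thesis using gV e sV ng by (simp add: ip_diff_left ip_self)
    qed
    have "cmod (ip e g - of_real (d\<^sup>2)) \<le> nrm (g - (e - s k)) * d" for k
      using eq[of k] Cauchy_Schwarz[of "g - (e - s k)" g] gV e sV ng by simp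
    moreover have "(\<lambda>k. nrm (g - (e - s k)) * d) \<longlonglongrightarrow> 0 * d"
      by (intro tendsto_mult glim tendsto_const)
    ultimately have "cmod (ip e g - of_real (d\<^sup>2)) \<le> 0 * d"
      by (intro LIMSEQ_le_const[of _ "0 * d"]) auto
    then show ?thesis by simp
  qed
  define K where "K = scale (of_real (inverse d)) g"
  have "is_innovation S e K"
    unfolding is_innovation_def
  proof (intro conjI allI impI ballI)
    show "K \<in> V" using gV K_def by simp
    show "nrm K = 1" using gV ng d0 by (simp add: K_def nrm_scale norm_inverse)
    show "ip K x = 0" if "x \<in> S" for x
      using ipg[OF that] gV that S by (auto simp: K_def ip_scale_left)
    show "\<exists>r>0. ip e K = complex_of_real r"
      using ipe gV e d0 by (intro exI[of _ d]) (simp add: K_def ip_scale_right power2_eq_square)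
    show "\<exists>c. \<exists>x\<in>S. nrm (K - (scale c e + x)) < \<epsilon>" if \<epsilon>: "\<epsilon> > 0" for \<epsilon>
    proof -
      have "eventually (\<lambda>k. nrm (g - (e - s k)) < \<epsilon> * d) sequentially"
        using glim \<epsilon> d0 by (intro order_tendstoD(2)[of _ 0]) auto
      then obtain k where k: "nrm (g - (e - s k)) < \<epsilon> * d" by (auto simp: eventually_sequentially)
      let ?c = "complex_of_real (inverse d)"
      have "K - (scale ?c e + scale (- ?c) (s k)) = scale ?c (g - (e - s k))"
        by (simp add: K_def scale_right_diff_distrib)
      then have "nrm (K - (scale ?c e + scale (- ?c) (s k))) = inverse d * nrm (g - (e - s k))"
        using gV e sV d0 by (simp add: nrm_scale norm_inverse)
      also have "\<dots> < \<epsilon>" using k d0 by (simp add: field_simps)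
      finally show ?thesis using S(1) s by (meson subspace_scale)
    qed
  qed
  then show ?thesis by blast
qed

end

section \<open>The measure on the circle\<close>

lemma space_circle [simp]: "space circle = sphere 0 1"
  by (simp add: circle_def space_restrict_space)

lemma measurable_cis_circle [measurable]:
  "cis \<in> uniform_measure lborel {0..<2 * pi} \<rightarrow>\<^sub>M restrict_space borel (sphere 0 1)"
  by (intro measurable_restrict_space2)
    (auto simp: measurable_cong_sets[OF sets_uniform_measure refl] intro!: borel_measurable_continuous_onI continuous_intros)

lemma emeasure_circle: "emeasure circle (sphere 0 1) = 1"
proof -
  have S: "sphere (0::complex) 1 \<in> sets (restrict_space borel (sphere 0 1))"
    using sets.top[of "restrict_space borel (sphere (0::complex) 1)"] by (simp add: space_restrict_space)
  have "emeasure circle (sphere 0 1) =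
      emeasure (distr (uniform_measure lborel {0..<2 * pi}) (restrict_space borel (sphere 0 1)) cis) (sphere 0 1)"
    unfolding circle_def using S by simp
  also have "\<dots> = emeasure (uniform_measure lborel {0..<2 * pi}) UNIV"
  proof -
    have "cis -` sphere 0 1 = UNIV" by auto
    then show ?thesis using S by (simp add: emeasure_distr)
  qed
  also have "\<dots> = 1" by simp
  finally show ?thesis .
qed

interpretation circle: finite_measure circle
  by (rule finite_measureI) (simp add: emeasure_circle)

interpretation circle: complete_measure circle
  unfolding circle_def by (rule completion.complete_measure_axioms)

lemma measure_circle [simp]: "measure circle (sphere 0 1) = 1"
  by (simp add: measure_def emeasure_circle)

lemma borel_measurable_circleI:
  "f \<in> borel_measurable (restrict_space borel (sphere 0 1)) \<Longrightarrow> f \<in> borel_measurable circle"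
  unfolding circle_def by (intro measurable_completion) simp

lemma continuous_on_circle_measurable:
  fixes f :: "complex \<Rightarrow> 'b::topological_space"
  shows "continuous_on (sphere 0 1) f \<Longrightarrow> f \<in> borel_measurable circle"
  by (intro borel_measurable_circleI borel_measurable_continuous_on_restrict)

lemma ident_measurable_circle [measurable]: "(\<lambda>t. t) \<in> borel_measurable circle"
  by (intro continuous_on_circle_measurable continuous_intros)

lemma AE_circle_norm: "AE t in circle. cmod t = 1"
  using AE_space[of circle] by (simp add: dist_norm)

lemma continuous_on_circle_integrable:
  fixes f :: "complex \<Rightarrow> 'b::{banach, second_countable_topology}"
  assumes "continuous_on (sphere 0 1) f"
  shows "integrable circle f"
proof -
  have "bounded (f ` sphere 0 1)"
    using assms by (intro compact_imp_bounded compact_continuous_image) auto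
  then obtain B where "\<forall>y\<in>f ` sphere 0 1. norm y \<le> B"
    unfolding bounded_iff by blast
  then show ?thesis
    using assms by (intro circle.integrable_const_bound[where B = B] AE_I2)
      (auto intro: continuous_on_circle_measurable)
qed

text \<open>Completeness of the measure makes this work. It serves the integrand of the inner
  product, whose explicit formula is established only where \<open>|R| < 1\<close>, that is almost
  everywhere.\<close>

lemma measurable_circle_AE_cong:
  assumes f: "f \<in> borel_measurable circle" and ae: "AE t in circle. f t = g t"
  shows "g \<in> borel_measurable circle"
proof (rule measurableI)
  fix B :: "'a set" assume B: "B \<in> sets borel"
  have A: "f -` B \<inter> space circle \<in> sets circle" using f B by (rule measurable_sets)
  have "AE t in circle. t \<in> f -` B \<inter> space circle \<longleftrightarrow> t \<in> g -` B \<inter> space circle"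
    using ae by eventually_elim auto
  then show "g -` B \<inter> space circle \<in> sets circle"
    using A by (rule circle.in_sets_AE) auto
qed simp

text \<open>The circle measure is built on a half-open interval; the null endpoint is added so that
  the fundamental theorem of calculus applies.\<close>

lemma integral_circle:
  fixes f :: "complex \<Rightarrow> complex"
  assumes "continuous_on UNIV f"
  shows "(LINT t|circle. f t) = (LINT x:{0..2 * pi}|lborel. f (cis x)) / (2 * pi)"
proof -
  have [measurable]: "f \<in> borel_measurable borel"
    using assms by (rule borel_measurable_continuous_onI)
  have [measurable]: "cis \<in> borel_measurable borel"
    by (intro borel_measurable_continuous_onI continuous_intros)
  have "(LINT t|circle. f t) = (LINT x|uniform_measure lborel {0..<2 * pi}. f (cis x))"
    unfolding circle_def
    by (subst integral_completion) (auto intro!: integral_distr measurable_restrict_space1)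
  also have "uniform_measure lborel {0..<2 * pi} =
      density lborel (\<lambda>x. ennreal (indicator {0..<2 * pi} x / (2 * pi)))"
    unfolding uniform_measure_def
    by (intro arg_cong2[where f = density] refl ext)
      (auto simp: indicator_def divide_ennreal simp flip: ennreal_numeral ennreal_mult ennreal_1)
  also have "(LINT x|\<dots>. f (cis x)) = (LINT x|lborel. (indicator {0..<2 * pi} x / (2 * pi)) *\<^sub>R f (cis x))"
    by (intro integral_density) auto
  also have "\<dots> = (LINT x|lborel. (indicator {0..2 * pi} x *\<^sub>R f (cis x)) / (2 * pi))"
    using AE_lborel_singleton[of "2 * pi"]
    by (intro integral_cong_AE) (auto elim!: eventually_mono simp: indicator_def scaleR_conv_of_real)
  also have "\<dots> = (LINT x:{0..2 * pi}|lborel. f (cis x)) / (2 * pi)"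
    by (simp add: set_lebesgue_integral_def)
  finally show ?thesis .
qed

lemma integral_circle_power:
  assumes "k > 0"
  shows "(LINT t|circle. t ^ k) = 0"
proof -
  have "(LINT x:{0..2 * pi}|lborel. cis x ^ k) =
      cis (2 * pi) ^ k / (\<i> * of_nat k) - cis 0 ^ k / (\<i> * of_nat k)"
    unfolding set_lebesgue_integral_def
  proof (rule integral_FTC_atLeastAtMost)
    fix x :: real
    have "((\<lambda>x. exp (\<i> * of_nat k * of_real x) / (\<i> * of_nat k)) has_vector_derivative
        exp (\<i> * of_nat k * of_real x)) (at x within {0..2 * pi})"
      using assms by (auto intro!: derivative_eq_intros has_vector_derivative_real_field)
    moreover have "exp (\<i> * of_nat k * of_real x) = cis x ^ k" for x :: real
      by (simp add: cis_conv_exp exp_of_nat_mult[symmetric] mult_ac)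
    ultimately show "((\<lambda>x. cis x ^ k / (\<i> * of_nat k)) has_vector_derivative cis x ^ k)
        (at x within {0..2 * pi})" by simp
  qed (auto intro!: continuous_intros)
  then show ?thesis
    by (subst integral_circle) (auto intro!: continuous_intros)
qed

section \<open>Almost everywhere convergence from summable integrals\<close>

lemma AE_summable_of_summable_integral:
  fixes f :: "nat \<Rightarrow> 'a \<Rightarrow> real"
  assumes int: "\<And>k. integrable M (f k)" and nn: "\<And>k x. 0 \<le> f k x"
    and sum: "summable (\<lambda>k. integral\<^sup>L M (f k))"
  shows "AE x in M. summable (\<lambda>k. f k x)"
proof -
  have [measurable]: "f k \<in> borel_measurable M" for k using int by auto
  have "(\<integral>\<^sup>+x. (\<Sum>k. ennreal (f k x)) \<partial>M) = (\<Sum>k. \<integral>\<^sup>+x. ennreal (f k x) \<partial>M)"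
    by (rule nn_integral_suminf) simp
  also have "\<dots> = (\<Sum>k. ennreal (integral\<^sup>L M (f k)))"
    using int nn by (simp add: nn_integral_eq_integral)
  also have "\<dots> \<noteq> \<infinity>"
    using sum nn by (simp add: suminf_ennreal2 integral_nonneg)
  finally have "AE x in M. (\<Sum>k. ennreal (f k x)) \<noteq> \<infinity>"
    by (intro nn_integral_noteq_infinite) auto
  then show ?thesis
    by eventually_elim (use nn summable_suminf_not_top in auto)
qed

lemma AE_tendsto_0_of_summable_integral:
  fixes f :: "nat \<Rightarrow> 'a \<Rightarrow> real"
  assumes "\<And>k. integrable M (f k)" "\<And>k x. 0 \<le> f k x" "summable (\<lambda>k. integral\<^sup>L M (f k))"
  shows "AE x in M. (\<lambda>k. f k x) \<longlonglongrightarrow> 0"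
  using AE_summable_of_summable_integral[OF assms] by eventually_elim (rule summable_LIMSEQ_zero)

text \<open>Summable L1 norms of the increments give absolutely summable increments at almost every
  point, and these telescope. Both the completeness of \<open>L2\<close> and the construction of
  multipliers rest on it.\<close>

lemma AE_convergent_of_summable_integral:
  fixes f :: "nat \<Rightarrow> 'a \<Rightarrow> 'b::{banach, second_countable_topology}"
  assumes int: "\<And>k. integrable M (\<lambda>x. f (Suc k) x - f k x)"
    and sum: "summable (\<lambda>k. LINT x|M. norm (f (Suc k) x - f k x))"
  shows "AE x in M. convergent (\<lambda>k. f k x)"
proof -
  have "AE x in M. summable (\<lambda>k. norm (f (Suc k) x - f k x))"
    using sum by (intro AE_summable_of_summable_integral) (auto intro: int)
  then show ?thesis
  proof eventually_elim
    case (elim x)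
    then have "summable (\<lambda>k. f (Suc k) x - f k x)" by (rule summable_norm_cancel)
    then have "convergent (\<lambda>n. \<Sum>k<n. f (Suc k) x - f k x)" by (simp add: summable_iff_convergent)
    then have "convergent (\<lambda>n. f n x - f 0 x)" by (simp add: sum_lessThan_telescope[of "\<lambda>n. f n x"])
    then show ?case
      using convergent_add[OF _ convergent_const[of "f 0 x"], of "\<lambda>n. f n x - f 0 x"] by simp
  qed
qed

section \<open>The Hilbert space L2\<close>

lemma L2_measurable [measurable_dest]: "f \<in> L2 \<Longrightarrow> f \<in> borel_measurable circle"
  by (simp add: L2_def)

lemma L2_square_integrable: "f \<in> L2 \<Longrightarrow> integrable circle (\<lambda>t. (cmod (f t))\<^sup>2)"
  by (simp add: L2_def)

lemma L2_mult_integrable: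
  assumes f: "f \<in> L2" and g: "g \<in> L2"
  shows "integrable circle (\<lambda>t. f t * g t)"
proof (rule Bochner_Integration.integrable_bound)
  show "integrable circle (\<lambda>t. (cmod (f t))\<^sup>2 + (cmod (g t))\<^sup>2)"
    using f g by (intro Bochner_Integration.integrable_add L2_square_integrable)
  show "(\<lambda>t. f t * g t) \<in> borel_measurable circle"
    using f g by measurable
  have "x * y \<le> x\<^sup>2 + y\<^sup>2" if "0 \<le> x" "0 \<le> y" for x y :: real
    using sum_squares_bound[of x y] mult_nonneg_nonneg[OF that] by linarith
  then show "AE t in circle. cmod (f t * g t) \<le> norm ((cmod (f t))\<^sup>2 + (cmod (g t))\<^sup>2)"
    by (intro AE_I2) (simp add: norm_mult)
qed

lemma L2_mult_bounded:
  assumes f: "f \<in> L2" and [measurable]: "b \<in> borel_measurable circle"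
    and b: "AE t in circle. cmod (b t) \<le> B"
  shows "(\<lambda>t. b t * f t) \<in> L2"
proof -
  have [measurable]: "f \<in> borel_measurable circle" using f by measurable
  have "integrable circle (\<lambda>t. (cmod (b t * f t))\<^sup>2)"
  proof (rule Bochner_Integration.integrable_bound)
    show "integrable circle (\<lambda>t. B\<^sup>2 * (cmod (f t))\<^sup>2)"
      using L2_square_integrable[OF f] by simp
    show "AE t in circle. norm ((cmod (b t * f t))\<^sup>2) \<le> norm (B\<^sup>2 * (cmod (f t))\<^sup>2)"
      using b by eventually_elim (auto simp: norm_mult power_mult_distrib intro!: mult_right_mono power_mono)
  qed measurable
  then show ?thesis by (simp add: L2_def)
qed

lemma L2_cmult: "f \<in> L2 \<Longrightarrow> (\<lambda>t. c * f t) \<in> L2"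
  by (rule L2_mult_bounded[where B = "cmod c"]) auto

lemma L2_bounded:
  assumes "f \<in> borel_measurable circle" "AE t in circle. cmod (f t) \<le> B"
  shows "f \<in> L2"
proof -
  have "(\<lambda>t. 1) \<in> L2" by (simp add: L2_def)
  from L2_mult_bounded[OF this assms] show ?thesis by simp
qed

lemma L2_continuous: "continuous_on (sphere 0 1) f \<Longrightarrow> f \<in> L2"
  by (auto simp: L2_def continuous_on_circle_measurable intro!: continuous_on_circle_integrable continuous_intros)

lemma L2_add: 
  assumes "f \<in> L2" "g \<in> L2" shows "(\<lambda>t. f t + g t) \<in> L2"
proof -
  have [measurable]: "f \<in> borel_measurable circle" "g \<in> borel_measurable circle"
    using assms by measurable
  have "integrable circle (\<lambda>t. (cmod (f t + g t))\<^sup>2)"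
  proof (rule Bochner_Integration.integrable_bound)
    show "integrable circle (\<lambda>t. 2 * (cmod (f t))\<^sup>2 + 2 * (cmod (g t))\<^sup>2)"
      using assms L2_square_integrable by simp
    have "(cmod (x + y))\<^sup>2 \<le> 2 * (cmod x)\<^sup>2 + 2 * (cmod y)\<^sup>2" for x y
    proof -
      have "(cmod (x + y))\<^sup>2 \<le> (cmod x + cmod y)\<^sup>2" by (intro power_mono norm_triangle_ineq) auto
      also have "\<dots> \<le> 2 * (cmod x)\<^sup>2 + 2 * (cmod y)\<^sup>2"
        using sum_squares_bound[of "cmod x" "cmod y"] by (simp add: power2_sum)
      finally show ?thesis .
    qed
    then show "AE t in circle. norm ((cmod (f t + g t))\<^sup>2) \<le> norm (2 * (cmod (f t))\<^sup>2 + 2 * (cmod (g t))\<^sup>2)"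
      by (intro AE_I2) simp
  qed measurable
  then show ?thesis by (simp add: L2_def)
qed

lemma L2_cnj: "f \<in> L2 \<Longrightarrow> (\<lambda>t. cnj (f t)) \<in> L2"
  by (auto simp: L2_def borel_measurable_continuous_on[OF continuous_on_cnj[OF continuous_on_id]])

lemma L2_mult_cnj_integrable: "\<lbrakk>f \<in> L2; g \<in> L2\<rbrakk> \<Longrightarrow> integrable circle (\<lambda>t. f t * cnj (g t))"
  by (intro L2_mult_integrable L2_cnj)

lemma L2_integrable: "f \<in> L2 \<Longrightarrow> integrable circle f"
  using L2_mult_integrable[of f "\<lambda>t. 1"] L2_continuous[of "\<lambda>t. 1"] by simp

interpretation L2: semi_inner "\<lambda>c f t. c * f t" L2 "\<lambda>f g. LINT t|circle. f t * cnj (g t)"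
proof -
  interpret vector_space "\<lambda>c f t. c * f t :: complex"
    by unfold_locales (auto simp: fun_eq_iff algebra_simps)
  show "semi_inner (\<lambda>c f t. c * f t) L2 (\<lambda>f g. LINT t|circle. f t * cnj (g t))"
  proof unfold_locales
    show "subspace L2"
      using L2_continuous[of "\<lambda>t. 0"]
      by (auto simp: subspace_def plus_fun_def zero_fun_def intro: L2_add L2_cmult)
  next
    fix f g h assume "f \<in> L2" "g \<in> L2" "h \<in> L2"
    then show "(LINT t|circle. (f + g) t * cnj (h t)) =
        (LINT t|circle. f t * cnj (h t)) + (LINT t|circle. g t * cnj (h t))"
      by (subst Bochner_Integration.integral_add[symmetric]) (auto simp: algebra_simps intro!: L2_mult_cnj_integrable)
  next
    fix f g :: "complex \<Rightarrow> complex"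
    show "(LINT t|circle. g t * cnj (f t)) = cnj (LINT t|circle. f t * cnj (g t))"
      using Bochner_Integration.integral_cnj[of circle "\<lambda>t. f t * cnj (g t)"] by (simp add: mult.commute)
  next
    fix f assume "f \<in> L2"
    have "(LINT t|circle. f t * cnj (f t)) = (LINT t|circle. complex_of_real ((cmod (f t))\<^sup>2))"
      by (simp only: complex_norm_square)
    also have "\<dots> = complex_of_real (LINT t|circle. (cmod (f t))\<^sup>2)"
      by (rule integral_complex_of_real)
    finally show "0 \<le> Re (LINT t|circle. f t * cnj (f t))" by simp
  qed (simp_all add: mult.assoc)
qed

lemma L2_nrm: "L2.nrm f = sqrt (LINT t|circle. (cmod (f t))\<^sup>2)"
proof -
  have "(LINT t|circle. f t * cnj (f t)) = (LINT t|circle. complex_of_real ((cmod (f t))\<^sup>2))"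
    by (simp only: complex_norm_square)
  also have "\<dots> = complex_of_real (LINT t|circle. (cmod (f t))\<^sup>2)"
    by (rule integral_complex_of_real)
  finally show ?thesis by (simp add: L2.nrm_def)
qed

lemma L2_Cauchy_Schwarz:
  assumes "f \<in> L2" "g \<in> L2"
  shows "cmod (LINT t|circle. f t * g t) \<le>
    sqrt (LINT t|circle. (cmod (f t))\<^sup>2) * sqrt (LINT t|circle. (cmod (g t))\<^sup>2)"
  using L2.Cauchy_Schwarz[OF assms(1) L2_cnj[OF assms(2)]] by (simp add: L2_nrm)

lemma L1_le_L2:
  assumes "f \<in> L2"
  shows "(LINT t|circle. cmod (f t)) \<le> sqrt (LINT t|circle. (cmod (f t))\<^sup>2)"
proof -
  have f': "(\<lambda>t. complex_of_real (cmod (f t))) \<in> L2"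
    using assms by (auto simp: L2_def)
  have "(LINT t|circle. complex_of_real (cmod (f t))) = complex_of_real (LINT t|circle. cmod (f t))"
    by (rule integral_complex_of_real)
  then show ?thesis
    using L2_Cauchy_Schwarz[OF f' L2_continuous[of "\<lambda>t. 1"]] by simp
qed

text \<open>Fatou's lemma applied to squared moduli: it supplies membership of the pointwise limit
  in \<open>L2\<close> together with the bound.\<close>

lemma L2_Fatou:
  assumes f: "\<And>k. f k \<in> L2" and g [measurable]: "g \<in> borel_measurable circle"
    and lim: "AE t in circle. (\<lambda>k. f k t) \<longlonglongrightarrow> g t"
    and bd: "eventually (\<lambda>k. (LINT t|circle. (cmod (f k t))\<^sup>2) \<le> B) sequentially"
  shows "g \<in> L2" "(LINT t|circle. (cmod (g t))\<^sup>2) \<le> B"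
proof -
  have [measurable]: "f k \<in> borel_measurable circle" for k using f by measurable
  have B: "0 \<le> B"
  proof -
    obtain k where "(LINT t|circle. (cmod (f k t))\<^sup>2) \<le> B"
      using bd by (auto simp: eventually_sequentially)
    moreover have "0 \<le> (LINT t|circle. (cmod (f k t))\<^sup>2)" by (rule Bochner_Integration.integral_nonneg) simp
    ultimately show ?thesis by linarith
  qed
  have "(\<integral>\<^sup>+t. ennreal ((cmod (g t))\<^sup>2) \<partial>circle) = (\<integral>\<^sup>+t. liminf (\<lambda>k. ennreal ((cmod (f k t))\<^sup>2)) \<partial>circle)"
  proof (rule nn_integral_cong_AE)
    show "AE t in circle. ennreal ((cmod (g t))\<^sup>2) = liminf (\<lambda>k. ennreal ((cmod (f k t))\<^sup>2))"
      using lim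
    proof eventually_elim
      case (elim t)
      then have "(\<lambda>k. ennreal ((cmod (f k t))\<^sup>2)) \<longlonglongrightarrow> ennreal ((cmod (g t))\<^sup>2)"
        by (intro tendsto_ennrealI tendsto_power tendsto_norm)
      then show ?case by (rule lim_imp_Liminf[OF sequentially_bot, symmetric])
    qed
  qed
  also have "\<dots> \<le> liminf (\<lambda>k. \<integral>\<^sup>+t. ennreal ((cmod (f k t))\<^sup>2) \<partial>circle)"
    by (rule nn_integral_liminf) measurable
  also have "\<dots> = liminf (\<lambda>k. ennreal (LINT t|circle. (cmod (f k t))\<^sup>2))"
    using f by (simp add: nn_integral_eq_integral L2_square_integrable)
  also have "\<dots> \<le> ennreal B"
    using bd by (intro Liminf_le) (auto elim!: eventually_mono intro: ennreal_leI)
  finally have le: "(\<integral>\<^sup>+t. ennreal ((cmod (g t))\<^sup>2) \<partial>circle) \<le> ennreal B" .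
  then have "integrable circle (\<lambda>t. (cmod (g t))\<^sup>2)"
    by (intro integrableI_bounded) (auto intro: le_less_trans)
  then show "g \<in> L2" by (simp add: L2_def)
  then show "(LINT t|circle. (cmod (g t))\<^sup>2) \<le> B"
    using le B by (simp add: nn_integral_eq_integral L2_square_integrable)
qed

text \<open>Riesz-Fischer: a rapidly Cauchy subsequence has summable increments in L1, so it
  converges almost everywhere, and \<open>L2_Fatou\<close> turns the Cauchy estimates into estimates
  of the distance to the pointwise limit.\<close>

interpretation L2: semi_hilbert "\<lambda>c f t. c * f t" L2 "\<lambda>f g. LINT t|circle. f t * cnj (g t)"
proof unfold_locales
  fix F :: "nat \<Rightarrow> complex \<Rightarrow> complex"
  assume F: "\<And>k. F k \<in> L2"
    and cauchy: "\<And>\<epsilon>. \<epsilon> > 0 \<Longrightarrow> \<exists>N. \<forall>j\<ge>N. \<forall>k\<ge>N. L2.nrm (F j - F k) < \<epsilon>"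
  have [measurable]: "F k \<in> borel_measurable circle" for k using F by measurable
  have "\<forall>i. \<exists>N. \<forall>j\<ge>N. \<forall>k\<ge>N. L2.nrm (F j - F k) < (1/2) ^ i" using cauchy by simp
  from choice[OF this] obtain N where
    "\<forall>i. \<forall>j\<ge>N i. \<forall>k\<ge>N i. L2.nrm (F j - F k) < (1/2) ^ i" ..
  then have N: "L2.nrm (F j - F k) < (1/2) ^ i" if "j \<ge> N i" "k \<ge> N i" for i j k
    using that by blast
  \<comment> \<open>Summing the thresholds makes \<open>r\<close> monotone and at least
    \<open>N i\<close>; the extra \<open>i\<close> makes it unbounded, so that \<open>r i\<close>
    eventually exceeds any \<open>M\<close>.\<close>
  define r where "r i = (\<Sum>j\<le>i. N j) + i" for i
  have rN: "N i \<le> r i" "r i \<le> r (Suc i)" "i \<le> r i" for i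
    by (auto simp: r_def intro: trans_le_add1 member_le_sum)
  have "AE t in circle. convergent (\<lambda>i. F (r i) t)"
  proof (rule AE_convergent_of_summable_integral)
    have d: "(\<lambda>t. F (r (Suc i)) t - F (r i) t) \<in> L2" for i
      using L2.V_closed(3)[OF F F, of "r (Suc i)" "r i"] by (simp add: fun_diff_def)
    then show "integrable circle (\<lambda>t. F (r (Suc i)) t - F (r i) t)" for i by (rule L2_integrable)
    show "summable (\<lambda>i. LINT t|circle. cmod (F (r (Suc i)) t - F (r i) t))"
    proof (rule summable_comparison_test')
      show "summable (\<lambda>i. (1/2 :: real) ^ i)" by (rule summable_geometric) simp
      fix i :: nat
      have "(LINT t|circle. cmod (F (r (Suc i)) t - F (r i) t)) \<le> L2.nrm (F (r (Suc i)) - F (r i))"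
        using L1_le_L2[OF d] by (simp add: L2_nrm)
      also have "\<dots> \<le> (1/2) ^ i" using N[of i "r (Suc i)" "r i"] rN[of i] by simp
      finally show "norm (LINT t|circle. cmod (F (r (Suc i)) t - F (r i) t)) \<le> (1/2) ^ i"
        by (simp add: integral_nonneg)
    qed
  qed
  \<comment> \<open>Off the convergence set \<open>lim\<close> returns an unspecified value;
    measurability and the almost everywhere limit are all that is used.\<close>
  define f where "f t = lim (\<lambda>i. F (r i) t)" for t
  have [measurable]: "f \<in> borel_measurable circle"
    unfolding f_def by measurable
  have lim: "AE t in circle. (\<lambda>i. F (r i) t) \<longlonglongrightarrow> f t"
    using \<open>AE t in circle. convergent (\<lambda>i. F (r i) t)\<close>
    by eventually_elim (simp add: f_def convergent_LIMSEQ_iff)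
  have key: "(\<lambda>t. F j t - f t) \<in> L2 \<and> (LINT t|circle. (cmod (F j t - f t))\<^sup>2) \<le> \<epsilon>\<^sup>2"
    if \<epsilon>: "\<epsilon> > 0" and M: "\<And>j k. j \<ge> M \<Longrightarrow> k \<ge> M \<Longrightarrow> L2.nrm (F j - F k) < \<epsilon>" and j: "j \<ge> M" for \<epsilon> M j
  proof -
    have d: "(\<lambda>t. F j t - F (r i) t) \<in> L2" for i
      using L2.V_closed(3)[OF F F, of j "r i"] by (simp add: fun_diff_def)
    have l: "AE t in circle. (\<lambda>i. F j t - F (r i) t) \<longlonglongrightarrow> F j t - f t"
      using lim by eventually_elim (intro tendsto_intros)
    have b: "eventually (\<lambda>i. (LINT t|circle. (cmod (F j t - F (r i) t))\<^sup>2) \<le> \<epsilon>\<^sup>2) sequentially"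
      using eventually_ge_at_top[of M]
    proof eventually_elim
      case (elim i)
      then have "L2.nrm (F j - F (r i)) \<le> \<epsilon>" using M[OF j, of "r i"] rN(3)[of i] by simp
      then have "sqrt (LINT t|circle. (cmod (F j t - F (r i) t))\<^sup>2) \<le> \<epsilon>" by (simp add: L2_nrm)
      then show ?case by (rule sqrt_le_D)
    qed
    have "(\<lambda>t. F j t - f t) \<in> borel_measurable circle" by measurable
    then show ?thesis using L2_Fatou[OF d _ l b] by blast
  qed
  obtain M where "\<forall>j\<ge>M. \<forall>k\<ge>M. L2.nrm (F j - F k) < 1" using cauchy[OF zero_less_one] ..
  then have "(\<lambda>t. F M t - f t) \<in> L2" using key[of 1 M M] by simp
  then have f: "f \<in> L2"
    using L2.V_closed(3)[OF F[of M], of "F M - f"] by (simp add: fun_diff_def)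
  have "(\<lambda>k. L2.nrm (F k - f)) \<longlonglongrightarrow> 0"
  proof (rule LIMSEQ_I)
    fix \<epsilon> :: real assume \<epsilon>: "\<epsilon> > 0"
    obtain M where M': "\<forall>j\<ge>M. \<forall>k\<ge>M. L2.nrm (F j - F k) < \<epsilon> / 2"
      using cauchy[OF half_gt_zero[OF \<epsilon>]] ..
    then have M: "L2.nrm (F j - F k) < \<epsilon> / 2" if "j \<ge> M" "k \<ge> M" for j k
      using that by blast
    have "norm (L2.nrm (F j - f) - 0) < \<epsilon>" if "j \<ge> M" for j
    proof -
      have "L2.nrm (F j - f) \<le> sqrt ((\<epsilon> / 2)\<^sup>2)"
        using key[OF half_gt_zero[OF \<epsilon>] M that] by (simp only: L2_nrm fun_diff_def real_sqrt_le_iff)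
      then show ?thesis using \<epsilon> L2.nrm_ge_0[of "F j - f"] F f by simp
    qed
    then show "\<exists>M. \<forall>j\<ge>M. norm (L2.nrm (F j - f) - 0) < \<epsilon>" by blast
  qed
  with f show "\<exists>f\<in>L2. (\<lambda>k. L2.nrm (F k - f)) \<longlonglongrightarrow> 0" by blast
qed

section \<open>Density of trigonometric polynomials\<close>

text \<open>Real trigonometric polynomials, written as real parts of analytic polynomials. Each thus
  comes with an analytic \<open>q\<close>, and \<open>exp (- q)\<close> has modulus
  \<open>exp (- p)\<close> on the circle.\<close>

definition trig :: "(complex \<Rightarrow> real) set" where
  "trig = {p. \<exists>q::complex poly. \<forall>t\<in>sphere 0 1. p t = Re (poly q t)}"

text \<open>Peel off constant coefficients: with \<open>q = a + t q'\<close> and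
  \<open>r = b + t r'\<close>, the product of \<open>t q'\<close> and \<open>cnj (t r')\<close>
  equals \<open>q' cnj r'\<close> on the circle, and the antianalytic term
  \<open>a cnj (t r')\<close> has the same real part as the analytic term
  \<open>cnj a t r'\<close>.\<close>

lemma Re_poly_mult_cnj_poly:
  fixes q r :: "complex poly"
  shows "\<exists>s. \<forall>t\<in>sphere 0 1. Re (poly q t * cnj (poly r t)) = Re (poly s t)"
proof (induction q arbitrary: r)
  case 0
  then show ?case by (intro exI[of _ 0]) simp
next
  case (pCons a q)
  obtain b r' where r: "r = pCons b r'" by (rule pCons_cases)
  obtain s where s: "\<And>t. t \<in> sphere 0 1 \<Longrightarrow> Re (poly q t * cnj (poly r' t)) = Re (poly s t)"
    using pCons.IH by blast
  show ?case
  proof (intro exI ballI)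
    fix t :: complex assume t: "t \<in> sphere 0 1"
    then have "t * cnj t = 1" by (simp add: complex_norm_square[symmetric])
    then have "poly (pCons a q) t * cnj (poly r t) = a * cnj b + cnj (cnj a * (t * poly r' t))
        + cnj b * (t * poly q t) + poly q t * cnj (poly r' t)"
      by (simp add: r algebra_simps)
    then show "Re (poly (pCons a q) t * cnj (poly r t)) =
        Re (poly ([:a * cnj b:] + smult (cnj a) (pCons 0 r') + smult (cnj b) (pCons 0 q) + s) t)"
      using s[OF t] by (simp only: plus_complex.sel cnj.simps(1) poly_add poly_smult poly_pCons
          poly_0 mult_zero_right add_0_left add_0_right)
  qed
qed

lemma trig_add: "\<lbrakk>f \<in> trig; g \<in> trig\<rbrakk> \<Longrightarrow> (\<lambda>t. f t + g t) \<in> trig"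
proof -
  assume "f \<in> trig" "g \<in> trig"
  then obtain q r :: "complex poly" where "\<forall>t\<in>sphere 0 1. f t = Re (poly q t)"
    and "\<forall>t\<in>sphere 0 1. g t = Re (poly r t)"
    unfolding trig_def by blast
  then have "\<forall>t\<in>sphere 0 1. f t + g t = Re (poly (q + r) t)" by simp
  then show ?thesis unfolding trig_def by blast
qed

lemma trig_const: "(\<lambda>t. c) \<in> trig"
  unfolding trig_def by (auto intro!: exI[of _ "[:complex_of_real c:]"])

lemma trig_mult:
  assumes "f \<in> trig" "g \<in> trig" shows "(\<lambda>t. f t * g t) \<in> trig"
proof -
  obtain q r :: "complex poly" where q: "\<And>t. t \<in> sphere 0 1 \<Longrightarrow> f t = Re (poly q t)"
    and r: "\<And>t. t \<in> sphere 0 1 \<Longrightarrow> g t = Re (poly r t)"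
    using assms unfolding trig_def by blast
  obtain s where s: "\<And>t. t \<in> sphere 0 1 \<Longrightarrow> Re (poly q t * cnj (poly r t)) = Re (poly s t)"
    using Re_poly_mult_cnj_poly by blast
  have "f t * g t = Re (poly (smult (1/2) (q * r + s)) t)" if t: "t \<in> sphere 0 1" for t
  proof -
    have "Re (z * w) + Re (z * cnj w) = 2 * (Re z * Re w)" for z w by simp
    from this[of "poly q t" "poly r t"] have "f t * g t = (Re (poly q t * poly r t) + Re (poly s t)) / 2"
      using q[OF t] r[OF t] s[OF t] by simp
    moreover have "Re (poly (smult (1/2) (q * r + s)) t) = (Re (poly q t * poly r t) + Re (poly s t)) / 2"
      by simp
    ultimately show ?thesis by (simp only:)
  qed
  then show ?thesis unfolding trig_def by blast
qed

lemma real_polynomial_function_trig: "real_polynomial_function p \<Longrightarrow> p \<in> trig"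
proof (induction rule: real_polynomial_function.induct)
  case (linear f)
  have "f t = Re (poly [:0, of_real (f 1) - \<i> * of_real (f \<i>):] t)" for t
  proof -
    interpret bounded_linear f by fact
    have "t = Re t *\<^sub>R 1 + Im t *\<^sub>R \<i>" by (simp add: complex_eq_iff)
    then have "f t = f (Re t *\<^sub>R 1 + Im t *\<^sub>R \<i>)" by simp
    also have "\<dots> = Re t * f 1 + Im t * f \<i>" by (simp only: add scaleR real_scaleR_def)
    finally show ?thesis by simp
  qed
  then show ?case unfolding trig_def by blast
qed (auto intro: trig_add trig_mult trig_const)

lemma trig_continuous: "p \<in> trig \<Longrightarrow> continuous_on (sphere 0 1) p"
proof -
  assume "p \<in> trig"
  then obtain q where q: "\<And>t. t \<in> sphere 0 1 \<Longrightarrow> p t = Re (poly q t)" unfolding trig_def by blast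
  have "continuous_on (sphere 0 1) (\<lambda>t. Re (poly q t))" by (intro continuous_intros)
  then show ?thesis by (rule continuous_on_eq) (use q in auto)
qed

lemma continuous_approx_trig:
  assumes "continuous_on (sphere 0 1) f" "0 < e"
  obtains p where "p \<in> trig" "\<And>t. t \<in> sphere 0 1 \<Longrightarrow> \<bar>f t - p t\<bar> < e"
  using Stone_Weierstrass_real_polynomial_function[OF _ assms] real_polynomial_function_trig
  by (metis compact_sphere)

text \<open>Regularity and Urysohn: up to null sets, a closed set inside \<open>A\<close> and an
  open set around it differ by measure below \<open>e\<close>, and a continuous function is 1 on the
  first and 0 outside the second.\<close>

lemma indicator_approx_continuous:
  assumes A: "A \<in> sets circle" and e: "0 < e"
  shows "\<exists>c::complex \<Rightarrow> real. continuous_on UNIV c \<and> (LINT t|circle. \<bar>indicator A t - c t\<bar>) < e"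
proof -
  define M where "M = distr circle borel (\<lambda>t. t)"
  have sM: "sets M = sets borel" by (simp add: M_def)
  interpret M: finite_measure M unfolding M_def by (rule circle.finite_measure_distr) measurable
  have finM: "emeasure M (space M) \<noteq> \<infinity>" by (simp add: M.emeasure_finite)
  have outer: "\<exists>U. open U \<and> B \<subseteq> U \<and> measure M U < measure M B + e / 2" if B: "B \<in> sets borel" for B
  proof -
    have "emeasure M B < ennreal (measure M B + e / 2)"
      unfolding M.emeasure_eq_measure using e by (intro ennreal_lessI) (auto intro: add_nonneg_pos)
    then have "(INF U \<in> {U. B \<subseteq> U \<and> open U}. emeasure M U) < ennreal (measure M B + e / 2)"
      using outer_regular[OF sM finM B] by (simp only:)
    then obtain U where "B \<subseteq> U" "open U" "emeasure M U < ennreal (measure M B + e / 2)"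
      unfolding INF_less_iff by blast
    then show ?thesis
      using M.emeasure_eq_measure[of U] ennreal_less_iff[OF measure_nonneg, of M U "measure M B + e / 2"]
      by (intro exI[of _ U]) simp
  qed
  \<comment> \<open>Regularity is available for Borel sets; a set of the completion agrees almost
    everywhere with its main part.\<close>
  obtain A' where A': "A' \<in> sets borel" "AE t in circle. t \<in> A' \<longleftrightarrow> t \<in> A"
  proof -
    define N where "N = distr (uniform_measure lborel {0..<2 * pi}) (restrict_space borel (sphere 0 1)) cis"
    have c: "circle = completion N" by (simp add: circle_def N_def)
    have "main_part N A \<in> sets N" using A unfolding c by (rule main_part_sets)
    also have "sets N = sets (restrict_space borel (sphere 0 1))" by (simp add: N_def)
    finally have "main_part N A \<in> sets (restrict_space borel (sphere 0 1))" .
    then have "main_part N A \<in> sets borel" by (auto simp: sets_restrict_space)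
    moreover have "AE t in circle. t \<in> main_part N A \<longleftrightarrow> t \<in> A"
      using A unfolding c by (intro AE_completion AE_in_main_part)
    ultimately show ?thesis using that by blast
  qed
  obtain U where U: "open U" "A' \<subseteq> U" "measure M U < measure M A' + e / 2"
    using outer[OF A'(1)] by blast
  \<comment> \<open>Outer regularity of the complement yields the closed set \<open>- U'\<close>
    inside \<open>A'\<close>.\<close>
  obtain U' where U': "open U'" "- A' \<subseteq> U'" "measure M U' < measure M (- A') + e / 2"
    using outer[of "- A'"] A'(1) by auto
  have spM: "space M = UNIV" by (simp add: M_def)
  have K: "- U' \<subseteq> A'" "closed (- U')" using U' by auto
  have "measure M (- U') = measure M UNIV - measure M U'"
    using M.finite_measure_compl[of U'] U'(1) by (simp add: spM sM Compl_eq_Diff_UNIV)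
  moreover have "measure M (- A') = measure M UNIV - measure M A'"
    using M.finite_measure_compl[of A'] A'(1) by (simp add: spM sM Compl_eq_Diff_UNIV)
  ultimately have mK: "measure M (- U') > measure M A' - e / 2" using U' by linarith
  have disj: "- U \<inter> - U' = {}" using U K by blast
  obtain c :: "complex \<Rightarrow> real" where c: "continuous_on UNIV c" "\<And>x. c x \<in> closed_segment 0 1"
    "\<And>x. x \<in> - U \<Longrightarrow> c x = 0" "\<And>x. x \<in> - U' \<Longrightarrow> c x = 1"
    using Urysohn[of "- U" "- U'" 0 1] U(1) K(2) disj by (metis closed_Compl)
  have c01: "0 \<le> c x" "c x \<le> 1" for x using c(2)[of x] by (auto simp: closed_segment_eq_real_ivl)
  have [measurable]: "c \<in> borel_measurable circle"
    using c(1) by (intro continuous_on_circle_measurable) (rule continuous_on_subset, auto)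
  have [measurable]: "A \<in> sets circle" by fact
  have UU: "U \<inter> U' \<inter> sphere 0 1 \<in> sets circle"
    using measurable_sets[OF ident_measurable_circle, of "U \<inter> U'"] U U' by auto
  have "(LINT t|circle. \<bar>indicator A t - c t\<bar>) \<le> (LINT t|circle. indicator (U \<inter> U' \<inter> sphere 0 1) t)"
  proof (rule integral_mono_AE)
    show "integrable circle (\<lambda>t. \<bar>indicator A t - c t\<bar>)"
    proof (rule circle.integrable_const_bound[where B = 2])
      show "AE t in circle. norm \<bar>indicator A t - c t\<bar> \<le> 2"
      proof (rule AE_I2)
        fix t show "norm \<bar>indicator A t - c t\<bar> \<le> 2"
          using c01[of t] by (auto simp: indicator_def)
      qed
    qed measurable
    show "integrable circle (indicator (U \<inter> U' \<inter> sphere 0 1) :: complex \<Rightarrow> real)"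
      using UU by (simp add: circle.emeasure_finite less_top[symmetric])
    show "AE t in circle. \<bar>indicator A t - c t\<bar> \<le> indicator (U \<inter> U' \<inter> sphere 0 1) t"
      using A'(2) AE_space
    proof eventually_elim
      case (elim t)
      then show ?case using c(3)[of t] c(4)[of t] c01[of t] U(2) K(1)
        by (auto simp: indicator_def)
    qed
  qed
  also have "\<dots> = measure circle (U \<inter> U' \<inter> sphere 0 1)"
    using UU by simp
  also have "\<dots> = measure M (U - (- U'))"
    unfolding M_def using U U' by (subst measure_distr) (auto simp: Diff_eq)
  also have "\<dots> = measure M U - measure M (- U')"
    using U(1,2) K sM by (intro M.finite_measure_Diff) auto
  also have "\<dots> < e" using mK U(3) by linarith
  finally show ?thesis using c(1) by blast
qed

lemma integrable_approx_continuous: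
  fixes f :: "complex \<Rightarrow> real"
  assumes "integrable circle f"
  shows "0 < e \<Longrightarrow> \<exists>c. continuous_on UNIV c \<and> (LINT t|circle. \<bar>f t - c t\<bar>) < e"
  using assms
proof (induction f arbitrary: e rule: integrable_induct)
  case (base A b)
  obtain c where c: "continuous_on UNIV c" "(LINT t|circle. \<bar>indicator A t - c t\<bar>) < e / (\<bar>b\<bar> + 1)"
    using indicator_approx_continuous[OF base(1), of "e / (\<bar>b\<bar> + 1)"] base(3) by auto
  have "(LINT t|circle. \<bar>indicator A t *\<^sub>R b - c t * b\<bar>) = (LINT t|circle. \<bar>indicator A t - c t\<bar> * \<bar>b\<bar>)"
    by (simp add: abs_mult[symmetric] left_diff_distrib)
  also have "\<dots> = (LINT t|circle. \<bar>indicator A t - c t\<bar>) * \<bar>b\<bar>" by simp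
  also have "\<dots> \<le> e / (\<bar>b\<bar> + 1) * \<bar>b\<bar>" using c by (intro mult_right_mono) auto
  also have "\<dots> < e" using base(3) by (simp add: field_simps)
  finally show ?case using c(1) by (intro exI[of _ "\<lambda>t. c t * b"]) (auto intro!: continuous_intros)
next
  case (add f g)
  obtain c d where c: "continuous_on UNIV c" "(LINT t|circle. \<bar>f t - c t\<bar>) < e / 2"
    and d: "continuous_on UNIV d" "(LINT t|circle. \<bar>g t - d t\<bar>) < e / 2"
    using add(3)[of "e / 2"] add(4)[of "e / 2"] add(5) by (metis half_gt_zero)
  have i: "integrable circle c" "integrable circle d"
    using c d by (auto intro!: continuous_on_circle_integrable intro: continuous_on_subset)
  have "(LINT t|circle. \<bar>(f t + g t) - (c t + d t)\<bar>) \<le> (LINT t|circle. \<bar>f t - c t\<bar> + \<bar>g t - d t\<bar>)"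
    using add i by (intro integral_mono) auto
  also have "\<dots> = (LINT t|circle. \<bar>f t - c t\<bar>) + (LINT t|circle. \<bar>g t - d t\<bar>)"
    using add i by (intro Bochner_Integration.integral_add) auto
  also have "\<dots> < e" using c d by linarith
  finally show ?case using c(1) d(1) by (intro exI[of _ "\<lambda>t. c t + d t"]) (auto intro!: continuous_intros)
next
  case (lim f s)
  have [measurable]: "f \<in> borel_measurable circle" "\<And>i. s i \<in> borel_measurable circle" using lim by auto
  have "(\<lambda>i. LINT t|circle. \<bar>f t - s i t\<bar>) \<longlonglongrightarrow> (LINT t|circle. 0)"
  \<comment> \<open>The approximants satisfy \<open>|s i t| <= 2 |f t|\<close>, whence the factor
    3.\<close>
  proof (rule integral_dominated_convergence[where w = "\<lambda>t. 3 * \<bar>f t\<bar>"])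
    show "AE t in circle. (\<lambda>i. \<bar>f t - s i t\<bar>) \<longlonglongrightarrow> 0"
    proof (rule AE_I2)
      fix t assume "t \<in> space circle"
      from tendsto_rabs[OF tendsto_diff[OF tendsto_const lim(2)[OF this]], of "f t"]
      show "(\<lambda>i. \<bar>f t - s i t\<bar>) \<longlonglongrightarrow> 0" by simp
    qed
    show "AE t in circle. norm \<bar>f t - s i t\<bar> \<le> 3 * \<bar>f t\<bar>" for i
    proof (rule AE_I2)
      fix t assume "t \<in> space circle"
      from lim(3)[OF this, of i] show "norm \<bar>f t - s i t\<bar> \<le> 3 * \<bar>f t\<bar>" by simp
    qed
  qed (use lim in auto)
  then have "eventually (\<lambda>i. (LINT t|circle. \<bar>f t - s i t\<bar>) < e / 2) sequentially"
    using lim(6) by (intro order_tendstoD(2)) auto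
  then obtain i where i: "(LINT t|circle. \<bar>f t - s i t\<bar>) < e / 2" by (auto simp: eventually_sequentially)
  obtain c where c: "continuous_on UNIV c" "(LINT t|circle. \<bar>s i t - c t\<bar>) < e / 2"
    using lim(5)[of "e / 2" i] lim(6) by auto
  have ic: "integrable circle c"
    using c by (auto intro!: continuous_on_circle_integrable intro: continuous_on_subset)
  have "(LINT t|circle. \<bar>f t - c t\<bar>) \<le> (LINT t|circle. \<bar>f t - s i t\<bar> + \<bar>s i t - c t\<bar>)"
    using lim ic by (intro integral_mono) auto
  also have "\<dots> = (LINT t|circle. \<bar>f t - s i t\<bar>) + (LINT t|circle. \<bar>s i t - c t\<bar>)"
    using lim ic by (intro Bochner_Integration.integral_add) auto
  also have "\<dots> < e" using c i by linarith
  finally show ?case using c(1) by blast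
qed

text \<open>Clipping the continuous approximant at 0 costs nothing because \<open>f\<close> is
  nonnegative, and the shift by \<open>e / 4\<close> absorbs the uniform error that could make
  \<open>p\<close> negative.\<close>

lemma nonneg_approx_trig:
  fixes f :: "complex \<Rightarrow> real"
  assumes f: "integrable circle f" "\<And>t. 0 \<le> f t" and e: "0 < e"
  shows "\<exists>p\<in>trig. (\<forall>t\<in>sphere 0 1. 0 \<le> p t) \<and> (LINT t|circle. \<bar>f t - p t\<bar>) < e"
proof -
  obtain c where c: "continuous_on UNIV c" "(LINT t|circle. \<bar>f t - c t\<bar>) < e / 2"
    using integrable_approx_continuous[OF f(1), of "e / 2"] e by auto
  have "continuous_on (sphere 0 1) (\<lambda>t. max 0 (c t))"
    using c(1) by (intro continuous_intros) (auto intro: continuous_on_subset)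
  then obtain p where p: "p \<in> trig" "\<And>t. t \<in> sphere 0 1 \<Longrightarrow> \<bar>max 0 (c t) - p t\<bar> < e / 4"
    using e continuous_approx_trig[of "\<lambda>t. max 0 (c t)" "e / 4"] by auto
  have ic: "integrable circle c"
    using c by (auto intro!: continuous_on_circle_integrable intro: continuous_on_subset)
  have ip: "integrable circle p"
    using p(1) by (intro continuous_on_circle_integrable trig_continuous)
  have "(LINT t|circle. \<bar>f t - (p t + e / 4)\<bar>) \<le> (LINT t|circle. \<bar>f t - c t\<bar> + e / 2)"
  proof (rule integral_mono)
    fix t assume "t \<in> space circle"
    then have "\<bar>max 0 (c t) - p t\<bar> < e / 4" using p(2) by simp
    then show "\<bar>f t - (p t + e / 4)\<bar> \<le> \<bar>f t - c t\<bar> + e / 2" using f(2)[of t] by linarith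
  qed (use f ic ip in auto)
  also have "\<dots> = (LINT t|circle. \<bar>f t - c t\<bar>) + e / 2"
    using f ic by (subst Bochner_Integration.integral_add) auto
  also have "\<dots> < e" using c by linarith
  finally have "(LINT t|circle. \<bar>f t - (p t + e / 4)\<bar>) < e" .
  moreover have "0 \<le> p t + e / 4" if "t \<in> sphere 0 1" for t using p(2)[OF that] by linarith
  ultimately show ?thesis
    using trig_add[OF p(1) trig_const[of "e / 4"]] by (intro bexI[of _ "\<lambda>t. p t + e / 4"]) auto
qed

text \<open>Passes from L1 to L2 approximation: once the continuous approximant is clipped to
  \<open>[-1, 1]\<close>, its difference to \<open>f\<close> is at most 2 in modulus, so the square
  is at most twice the modulus.\<close>

lemma bounded_approx_trig:
  fixes f :: "complex \<Rightarrow> real"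
  assumes f: "f \<in> borel_measurable circle" "\<And>t. \<bar>f t\<bar> \<le> 1" and e: "0 < e"
  shows "\<exists>p\<in>trig. (LINT t|circle. (f t - p t)\<^sup>2) < e"
proof -
  have i_f: "integrable circle f" using f by (intro circle.integrable_const_bound[where B = 1]) auto
  obtain c where c: "continuous_on UNIV c" "(LINT t|circle. \<bar>f t - c t\<bar>) < e / 8"
    using integrable_approx_continuous[OF i_f, of "e / 8"] e by auto
  define d where "d t = max (-1) (min 1 (c t))" for t
  have "continuous_on (sphere 0 1) d"
    unfolding d_def using c(1) by (intro continuous_intros) (auto intro: continuous_on_subset)
  then obtain p where p: "p \<in> trig" "\<And>t. t \<in> sphere 0 1 \<Longrightarrow> \<bar>d t - p t\<bar> < sqrt (e / 8)"
    using e continuous_approx_trig[of d "sqrt (e / 8)"] by auto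
  have ic: "integrable circle c"
    using c by (auto intro!: continuous_on_circle_integrable intro: continuous_on_subset)
  have pm: "p \<in> borel_measurable circle" "continuous_on (sphere 0 1) p"
    using p(1) by (auto intro: continuous_on_circle_measurable trig_continuous)
  have pt: "(f t - p t)\<^sup>2 \<le> 4 * \<bar>f t - c t\<bar> + e / 4" if t: "t \<in> sphere 0 1" for t
  proof -
    have 1: "\<bar>f t - d t\<bar> \<le> \<bar>f t - c t\<bar>" "\<bar>f t - d t\<bar> \<le> 2"
      using f(2)[of t] by (auto simp: d_def)
    have "(f t - d t)\<^sup>2 = \<bar>f t - d t\<bar> * \<bar>f t - d t\<bar>" by (simp add: power2_eq_square)
    also have "\<dots> \<le> 2 * \<bar>f t - c t\<bar>" using 1 by (intro mult_mono) auto
    finally have 2: "(f t - d t)\<^sup>2 \<le> 2 * \<bar>f t - c t\<bar>" .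
    have "(d t - p t)\<^sup>2 = \<bar>d t - p t\<bar>\<^sup>2" by simp
    also have "\<dots> \<le> (sqrt (e / 8))\<^sup>2" using p(2)[OF t] by (intro power_mono) auto
    finally have 3: "(d t - p t)\<^sup>2 \<le> e / 8" using e by simp
    have "(x + y)\<^sup>2 \<le> 2 * x\<^sup>2 + 2 * y\<^sup>2" for x y :: real
      using sum_squares_bound[of x y] by (simp add: power2_sum)
    from this[of "f t - d t" "d t - p t"] 2 3 show ?thesis by simp
  qed
  have "(LINT t|circle. (f t - p t)\<^sup>2) \<le> (LINT t|circle. 4 * \<bar>f t - c t\<bar> + e / 4)"
  proof (rule integral_mono_AE)
    show i2: "integrable circle (\<lambda>t. 4 * \<bar>f t - c t\<bar> + e / 4)" using i_f ic by auto
    show "AE t in circle. (f t - p t)\<^sup>2 \<le> 4 * \<bar>f t - c t\<bar> + e / 4"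
      using pt by (intro AE_I2) simp
    show "integrable circle (\<lambda>t. (f t - p t)\<^sup>2)"
    proof (rule Bochner_Integration.integrable_bound[OF i2])
      show "(\<lambda>t. (f t - p t)\<^sup>2) \<in> borel_measurable circle" using f(1) pm by measurable
      show "AE t in circle. norm ((f t - p t)\<^sup>2) \<le> norm (4 * \<bar>f t - c t\<bar> + e / 4)"
      proof (rule AE_I2)
        fix t assume "t \<in> space circle"
        then show "norm ((f t - p t)\<^sup>2) \<le> norm (4 * \<bar>f t - c t\<bar> + e / 4)" using pt[of t] by auto
      qed
    qed
  qed
  also have "\<dots> = 4 * (LINT t|circle. \<bar>f t - c t\<bar>) + e / 4"
    using i_f ic by (subst Bochner_Integration.integral_add) auto
  also have "\<dots> < e" using c e by linarith
  finally show ?thesis using p(1) by blast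
qed

section \<open>Bounded analytic functions with small modulus\<close>

lemma integral_poly_mult:
  fixes g :: "complex \<Rightarrow> complex"
  assumes g: "integrable circle g" and z: "\<And>i. i > 0 \<Longrightarrow> (LINT t|circle. t ^ i * g t) = 0"
  shows "(LINT t|circle. poly r t * g t) = poly r 0 * (LINT t|circle. g t)"
proof -
  have i: "integrable circle (\<lambda>t. t ^ i * g t)" for i
  proof (rule Bochner_Integration.integrable_bound[OF g])
    show "AE t in circle. cmod (t ^ i * g t) \<le> cmod (g t)"
      using AE_circle_norm by eventually_elim (simp add: norm_mult norm_power)
  qed (use g in measurable)
  have "(LINT t|circle. poly r t * g t) = (LINT t|circle. (\<Sum>i\<le>degree r. coeff r i * (t ^ i * g t)))"
    by (simp add: poly_altdef sum_distrib_right mult.assoc)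
  also have "\<dots> = (\<Sum>i\<le>degree r. coeff r i * (LINT t|circle. t ^ i * g t))"
    using i by (subst Bochner_Integration.integral_sum) auto
  also have "\<dots> = (\<Sum>i\<le>degree r. if i = 0 then coeff r 0 * (LINT t|circle. g t) else 0)"
    using z by (intro sum.cong) auto
  also have "\<dots> = poly r 0 * (LINT t|circle. g t)"
    by (simp add: poly_0_coeff_0)
  finally show ?thesis .
qed

lemma norm_exp_partial_sum_le:
  fixes z :: complex
  shows "cmod (\<Sum>i<n. z ^ i / fact i) \<le> exp (cmod z)"
proof -
  have "cmod (\<Sum>i<n. z ^ i / fact i) \<le> (\<Sum>i<n. cmod z ^ i /\<^sub>R fact i)"
    by (rule order_trans[OF norm_sum]) (simp add: norm_mult norm_inverse norm_power divide_inverse mult.commute)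
  also have "\<dots> \<le> exp (cmod z)"
    using sum_le_suminf[OF sums_summable[OF exp_converges[of "cmod z"]], of "{..<n}"]
      sums_unique[OF exp_converges[of "cmod z"]] by simp
  finally show ?thesis .
qed

text \<open>The exponential series turns \<open>exp (poly q t)\<close> into a limit of polynomials,
  dominated on the circle. It is used with \<open>g = 1\<close>, giving the mean value property, and
  with \<open>g t = t * h t\<close> for \<open>h\<close> in \<open>H2_plus\<close>, whose own mean
  vanishes too.\<close>

lemma integral_exp_poly_mult:
  fixes g :: "complex \<Rightarrow> complex"
  assumes g: "integrable circle g" and z: "\<And>i. i > 0 \<Longrightarrow> (LINT t|circle. t ^ i * g t) = 0"
  shows "(LINT t|circle. exp (poly q t) * g t) = exp (poly q 0) * (LINT t|circle. g t)"
proof -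
  define S :: "nat \<Rightarrow> complex poly" where "S n = (\<Sum>i<n. smult (1 / fact i) (q ^ i))" for n
  have S: "poly (S n) t = (\<Sum>i<n. poly q t ^ i / fact i)" for n t
    by (simp add: S_def poly_sum)
  have lim: "(\<lambda>n. poly (S n) t) \<longlonglongrightarrow> exp (poly q t)" for t
  proof -
    have "poly q t ^ i /\<^sub>R fact i = poly q t ^ i / fact i" for i
      by (simp add: scaleR_conv_of_real divide_inverse mult.commute)
    then show ?thesis
      using exp_converges[of "poly q t"] by (simp add: S sums_def)
  qed
  have "continuous_on (sphere 0 1) (poly q)" by (intro continuous_intros)
  then have "bounded (poly q ` sphere 0 1)"
    by (intro compact_imp_bounded compact_continuous_image) auto
  then obtain B where B: "\<And>t. t \<in> sphere 0 1 \<Longrightarrow> cmod (poly q t) \<le> B"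
    unfolding bounded_iff by blast
  have [measurable]: "g \<in> borel_measurable circle" using g by simp
  have [measurable]: "poly r \<in> borel_measurable circle" for r :: "complex poly"
    by (intro continuous_on_circle_measurable continuous_intros)
  have [measurable]: "(\<lambda>t. exp (poly r t)) \<in> borel_measurable circle" for r :: "complex poly"
    by (intro continuous_on_circle_measurable continuous_intros)
  have "(\<lambda>n. LINT t|circle. poly (S n) t * g t) \<longlonglongrightarrow> (LINT t|circle. exp (poly q t) * g t)"
  proof (rule integral_dominated_convergence[where w = "\<lambda>t. exp B * cmod (g t)"])
    show "AE t in circle. (\<lambda>n. poly (S n) t * g t) \<longlonglongrightarrow> exp (poly q t) * g t"
      by (intro AE_I2 tendsto_mult lim tendsto_const)
    show "AE t in circle. cmod (poly (S n) t * g t) \<le> exp B * cmod (g t)" for n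
    proof (rule AE_I2)
      fix t assume "t \<in> space circle"
      then have "cmod (poly q t) \<le> B" using B by simp
      then have "cmod (poly (S n) t) \<le> exp B"
        unfolding S using norm_exp_partial_sum_le[of "poly q t" n] by (meson exp_le_cancel_iff order_trans)
      then show "cmod (poly (S n) t * g t) \<le> exp B * cmod (g t)"
        by (simp add: norm_mult mult_right_mono)
    qed
  qed (use g in auto)
  moreover have "(\<lambda>n. LINT t|circle. poly (S n) t * g t) \<longlonglongrightarrow> exp (poly q 0) * (LINT t|circle. g t)"
  proof -
    have "(LINT t|circle. poly (S n) t * g t) = poly (S n) 0 * (LINT t|circle. g t)" for n
      using g z by (rule integral_poly_mult)
    then show ?thesis by (simp only: tendsto_mult lim tendsto_const)
  qed
  ultimately show ?thesis by (rule LIMSEQ_unique)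
qed

lemma integral_exp_poly: "(LINT t|circle. exp (poly q t)) = exp (poly q 0)"
  using integral_exp_poly_mult[of "\<lambda>t. 1" q] integral_circle_power by simp

lemma integral_poly: "(LINT t|circle. poly q t) = poly q 0"
  using integral_poly_mult[of "\<lambda>t. 1" q] integral_circle_power by simp

section \<open>Hardy functions and the construction of multipliers\<close>

lemma H2_plus_L2: "h \<in> H2_plus \<Longrightarrow> h \<in> L2"
  by (simp add: H2_plus_def)

lemma cnj_powi_on_circle: "cmod t = 1 \<Longrightarrow> cnj t powi (- int k) = t ^ k"
proof -
  assume "cmod t = 1"
  then have "t * cnj t = 1" by (simp add: complex_norm_square[symmetric])
  then have "inverse t = cnj t" by (rule inverse_unique)
  then show ?thesis by (simp add: power_int_minus power_inverse flip: \<open>inverse t = cnj t\<close>)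
qed

lemma integral_power_H2_plus:
  assumes h: "h \<in> H2_plus" and i: "i > 0"
  shows "(LINT t|circle. t ^ i * h t) = 0"
proof -
  have "(LINT t|circle. t ^ i * h t) = fourier_coeff h (- int i)"
    unfolding fourier_coeff_def
    by (intro Bochner_Integration.integral_cong refl) (simp add: cnj_powi_on_circle mult.commute)
  then show ?thesis using h i by (simp add: H2_plus_def)
qed

text \<open>The unit ball of bounded analytic functions, described by duality: annihilating
  \<open>t H2_plus\<close> is the property through which a multiplier removes \<open>t u\<close>,
  and it passes to bounded almost everywhere limits. Vanishing of the negative Fourier coefficients
  is recovered in \<open>Schur_power_mult_H2_plus\<close>.\<close>

definition Schur :: "(complex \<Rightarrow> complex) set" where
  "Schur = {a \<in> borel_measurable circle. (AE t in circle. cmod (a t) \<le> 1) \<and>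
     (\<forall>h\<in>H2_plus. (LINT t|circle. a t * (t * h t)) = 0)}"

lemma id_mult_L2: "h \<in> L2 \<Longrightarrow> (\<lambda>t. t * h t) \<in> L2"
  by (rule L2_mult_bounded[where B = 1]) (use AE_circle_norm in \<open>auto elim: eventually_mono\<close>)

text \<open>A single trigonometric polynomial cannot majorize an unbounded \<open>G\<close>, so a
  majorant is approached greedily: a nonnegative approximation of the deficit
  \<open>max 0 (G - P n)\<close> is added, the new deficit is at most the error of that
  approximation, and the integral grows by at most the old deficit plus the error. The geometric
  rate keeps even the square roots of the increments summable, as \<open>Schur_minorant\<close>
  requires.\<close>

lemma trig_majorant:
  fixes G :: "complex \<Rightarrow> real"
  assumes G: "integrable circle G" "\<And>t. 0 \<le> G t" and e: "0 < e"
  shows "\<exists>P :: nat \<Rightarrow> complex \<Rightarrow> real. (\<forall>n. P n \<in> trig) \<and>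
    (\<forall>n. \<forall>t\<in>sphere 0 1. 0 \<le> P n t \<and> P n t \<le> P (Suc n) t) \<and>
    (\<forall>n. (LINT t|circle. max 0 (G t - P n t)) \<le> e / 4 ^ n) \<and>
    (\<forall>n. (LINT t|circle. P n t) \<le> (LINT t|circle. G t) + e) \<and>
    (\<forall>n. (LINT t|circle. P (Suc n) t) \<le> (LINT t|circle. P n t) + 2 * e / 4 ^ n)"
proof -
  define D where "D p = (LINT t|circle. max 0 (G t - p t))" for p
  have int: "integrable circle p" if "p \<in> trig" for p
    using that by (intro continuous_on_circle_integrable trig_continuous)
  have ex: "\<exists>p'\<in>trig. (\<forall>t\<in>sphere 0 1. p t \<le> p' t) \<and> D p' \<le> d \<and>
      (LINT t|circle. p' t) \<le> (LINT t|circle. p t) + D p + d" if p: "p \<in> trig" and d: "d > 0" for p d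
  proof -
    have iH: "integrable circle (\<lambda>t. max 0 (G t - p t))"
      using G int[OF p] by (intro Bochner_Integration.integrable_max) auto
    obtain f where f: "f \<in> trig" "\<And>t. t \<in> sphere 0 1 \<Longrightarrow> 0 \<le> f t"
      "(LINT t|circle. \<bar>max 0 (G t - p t) - f t\<bar>) < d"
      using nonneg_approx_trig[OF iH _ d] by auto
    have iabs: "integrable circle (\<lambda>t. \<bar>max 0 (G t - p t) - f t\<bar>)"
      using iH int[OF f(1)] by auto
    have "D (\<lambda>t. p t + f t) \<le> (LINT t|circle. \<bar>max 0 (G t - p t) - f t\<bar>)"
      unfolding D_def
    proof (rule integral_mono[OF _ iabs])
      show "integrable circle (\<lambda>t. max 0 (G t - (p t + f t)))"
        using G int[OF p] int[OF f(1)] by (intro Bochner_Integration.integrable_max) auto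
      fix t assume "t \<in> space circle"
      then have "0 \<le> f t" using f(2) by simp
      then show "max 0 (G t - (p t + f t)) \<le> \<bar>max 0 (G t - p t) - f t\<bar>" by linarith
    qed
    then have 1: "D (\<lambda>t. p t + f t) \<le> d" using f(3) by linarith
    have "(LINT t|circle. f t) \<le> (LINT t|circle. max 0 (G t - p t) + \<bar>max 0 (G t - p t) - f t\<bar>)"
      using int[OF f(1)] iH iabs by (intro integral_mono) auto
    also have "\<dots> = D p + (LINT t|circle. \<bar>max 0 (G t - p t) - f t\<bar>)"
      unfolding D_def using iH iabs by (rule Bochner_Integration.integral_add)
    finally have "(LINT t|circle. p t + f t) \<le> (LINT t|circle. p t) + D p + d"
      using f(3) int[OF p] int[OF f(1)] by (subst Bochner_Integration.integral_add) auto
    with 1 f show ?thesis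
      using trig_add[OF p f(1)] by (intro bexI[of _ "\<lambda>t. p t + f t"]) auto
  qed
  have D0: "D (\<lambda>t. 0) = (LINT t|circle. G t)" using G by (simp add: D_def max_def)
  \<comment> \<open>The sequence starts after one correction of the zero polynomial, whose deficit,
    the integral of \<open>G\<close>, need not be small.\<close>
  obtain f1 where f1: "f1 \<in> trig" "\<And>t. t \<in> sphere 0 1 \<Longrightarrow> 0 \<le> f1 t" "D f1 \<le> e / 4"
    "(LINT t|circle. f1 t) \<le> (LINT t|circle. G t) + e / 4"
    using ex[OF trig_const[of 0], of "e / 4"] e by (auto simp: D0)
  have "\<exists>P. \<forall>n. (P n \<in> trig \<and> (n = 0 \<longrightarrow> P n = f1) \<and> D (P n) \<le> e / 4 ^ Suc n) \<and>
      ((\<forall>t\<in>sphere 0 1. P n t \<le> P (Suc n) t) \<and>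
       (LINT t|circle. P (Suc n) t) \<le> (LINT t|circle. P n t) + D (P n) + e / 4 ^ Suc (Suc n))"
  proof (rule dependent_nat_choice)
    show "\<exists>p. p \<in> trig \<and> (0 = (0::nat) \<longrightarrow> p = f1) \<and> D p \<le> e / 4 ^ Suc 0"
      using f1 by auto
    fix p n assume "p \<in> trig \<and> (n = (0::nat) \<longrightarrow> p = f1) \<and> D p \<le> e / 4 ^ Suc n"
    then have p: "p \<in> trig" by blast
    have "0 < e / 4 ^ Suc (Suc n)" using e by simp
    from ex[OF p this] show "\<exists>y. (y \<in> trig \<and> (Suc n = 0 \<longrightarrow> y = f1) \<and> D y \<le> e / 4 ^ Suc (Suc n)) \<and>
        (\<forall>t\<in>sphere 0 1. p t \<le> y t) \<and> (LINT t|circle. y t) \<le> (LINT t|circle. p t) + D p + e / 4 ^ Suc (Suc n)"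
      by auto
  qed
  then obtain P where P: "P n \<in> trig" "n = 0 \<longrightarrow> P n = f1" "D (P n) \<le> e / 4 ^ Suc n"
    "\<forall>t\<in>sphere 0 1. P n t \<le> P (Suc n) t"
    "(LINT t|circle. P (Suc n) t) \<le> (LINT t|circle. P n t) + D (P n) + e / 4 ^ Suc (Suc n)" for n
    by blast
  \<comment> \<open>\<open>5 / 16 = 1 / 4 + 1 / 16\<close>: the deficit of \<open>P n\<close> plus
    the error of the next approximation.\<close>
  have step: "(LINT t|circle. P (Suc n) t) \<le> (LINT t|circle. P n t) + (5 / 16) * (e / 4 ^ n)" for n
    using P(3)[of n] P(5)[of n] by simp
  have e4: "0 < e / 4 ^ n" for n using e by simp
  have mono: "P n t \<le> P (Suc n) t" if "t \<in> sphere 0 1" for n t using P(4) that by blast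
  have nonneg: "0 \<le> P n t" if t: "t \<in> sphere 0 1" for n t
  proof (induction n)
    case 0 then show ?case using P(2)[of 0] f1(2)[OF t] by simp
  next
    case (Suc n) then show ?case using mono[OF t, of n] by linarith
  qed
  \<comment> \<open>The subtracted reserve makes the induction close: from \<open>n\<close> to
    \<open>Suc n\<close> it shrinks by \<open>(9 / 16) * (e / 4 ^ n)\<close>, more than the integral
    can grow.\<close>
  have le: "(LINT t|circle. P n t) \<le> (LINT t|circle. G t) + e - (3 / 4) * (e / 4 ^ n)" for n
  proof (induction n)
    case 0 then show ?case using P(2)[of 0] f1(4) by simp
  next
    case (Suc n)
    define x where "x = e / 4 ^ n"
    have "e / 4 ^ Suc n = x / 4" by (simp add: x_def)
    then show ?case using Suc step[of n] e4[of n] unfolding x_def[symmetric] by linarith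
  qed
  show ?thesis
  proof (intro exI[of _ P] conjI allI ballI)
    fix n
    show "P n \<in> trig" by (rule P)
    show "(LINT t|circle. max 0 (G t - P n t)) \<le> e / 4 ^ n"
      using P(3)[of n] e4[of n] by (simp add: D_def)
    show "(LINT t|circle. P (Suc n) t) \<le> (LINT t|circle. P n t) + 2 * e / 4 ^ n"
      using step[of n] e4[of n] by simp
    show "(LINT t|circle. P n t) \<le> (LINT t|circle. G t) + e"
      using le[of n] e4[of n] by linarith
  qed (use mono nonneg in auto)
qed

text \<open>With \<open>w = exp (- q)\<close>, integrate \<open>|1 - w|^2 <= 2 - 2 Re w\<close>. The
  mean value property evaluates the right side as \<open>2 - 2 exp (- d) <= 2 d\<close>, where
  \<open>d\<close> is also the mean of \<open>Re q\<close> on the circle.\<close>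

lemma integral_norm_one_minus_exp_poly:
  assumes q: "\<And>t. t \<in> sphere 0 1 \<Longrightarrow> 0 \<le> Re (poly q t)" and q0: "poly q 0 = complex_of_real d"
  shows "(LINT t|circle. cmod (1 - exp (- poly q t))) \<le> sqrt (2 * d)"
proof -
  have c: "continuous_on (sphere 0 1) (\<lambda>t. exp (- poly q t))" by (intro continuous_intros)
  have L: "(\<lambda>t. 1 - exp (- poly q t)) \<in> L2" by (intro L2_continuous continuous_intros)
  have ie: "integrable circle (\<lambda>t. exp (- poly q t))" using c by (rule continuous_on_circle_integrable)
  have "(LINT t|circle. (cmod (1 - exp (- poly q t)))\<^sup>2) \<le> (LINT t|circle. 2 - 2 * Re (exp (- poly q t)))"
  proof (rule integral_mono[OF L2_square_integrable[OF L]])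
    show "integrable circle (\<lambda>t. 2 - 2 * Re (exp (- poly q t)))"
      using ie by (intro Bochner_Integration.integrable_diff integrable_mult_right integrable_Re) auto
    fix t assume "t \<in> space circle"
    then have w: "cmod (exp (- poly q t)) \<le> 1" using q[of t] by simp
    have "(cmod (1 - w))\<^sup>2 = 1 - 2 * Re w + (cmod w)\<^sup>2" for w
      by (simp only: cmod_power2) (simp add: power2_diff)
    moreover have "(cmod (exp (- poly q t)))\<^sup>2 \<le> 1" using w by (simp only: power_le_one norm_ge_zero)
    ultimately show "(cmod (1 - exp (- poly q t)))\<^sup>2 \<le> 2 - 2 * Re (exp (- poly q t))"
      by (smt (verit))
  qed
  also have "\<dots> = 2 - 2 * Re (LINT t|circle. exp (- poly q t))"
    using ie by (subst Bochner_Integration.integral_diff) auto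
  also have "(LINT t|circle. exp (- poly q t)) = exp (- complex_of_real d)"
    using integral_exp_poly[of "- q"] by (simp add: q0)
  also have "2 - 2 * Re (exp (- complex_of_real d)) \<le> 2 * d"
    using exp_ge_add_one_self[of "- d"] by (simp add: Re_exp)
  finally show ?thesis
    using L1_le_L2[OF L] real_sqrt_le_mono order_trans by blast
qed

text \<open>A substitute for an outer function with prescribed modulus: \<open>a\<close> is the
  limit of \<open>A n = exp (- q n)\<close> with \<open>Re (q n) = P n\<close> on the circle. The
  mean of \<open>A n\<close> is exactly the exponential of minus the integral of \<open>P n\<close>,
  which gives the lower bound in the limit.\<close>

lemma Schur_minorant:
  fixes G :: "complex \<Rightarrow> real"
  assumes G: "integrable circle G" "\<And>t. 0 \<le> G t" and e: "0 < e"
  obtains a where "a \<in> Schur" "AE t in circle. cmod (a t) \<le> exp (- G t)"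
    "exp (- (LINT t|circle. G t) - e) \<le> cmod (LINT t|circle. a t)"
proof -
  obtain P :: "nat \<Rightarrow> complex \<Rightarrow> real" where P': "\<forall>n. P n \<in> trig"
    "\<forall>n. \<forall>t\<in>sphere 0 1. 0 \<le> P n t \<and> P n t \<le> P (Suc n) t"
    "\<forall>n. (LINT t|circle. max 0 (G t - P n t)) \<le> e / 4 ^ n"
    "\<forall>n. (LINT t|circle. P n t) \<le> (LINT t|circle. G t) + e"
    "\<forall>n. (LINT t|circle. P (Suc n) t) \<le> (LINT t|circle. P n t) + 2 * e / 4 ^ n"
    using trig_majorant[OF G e] by blast
  have P: "P n \<in> trig" for n using P'(1) ..
  have P0: "0 \<le> P n t" and Pmono: "P n t \<le> P (Suc n) t" if "t \<in> sphere 0 1" for n t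
    using P'(2) that by blast+
  have PG: "(LINT t|circle. max 0 (G t - P n t)) \<le> e / 4 ^ n" for n using P'(3) ..
  have Ple: "(LINT t|circle. P n t) \<le> (LINT t|circle. G t) + e" for n using P'(4) ..
  have Pstep: "(LINT t|circle. P (Suc n) t) \<le> (LINT t|circle. P n t) + 2 * e / 4 ^ n" for n using P'(5) ..
  have iP: "integrable circle (P n)" for n
    by (intro continuous_on_circle_integrable trig_continuous P)
  have "\<exists>q::complex poly. (\<forall>t\<in>sphere 0 1. P n t = Re (poly q t)) \<and> Im (poly q 0) = 0" for n
  proof -
    obtain q :: "complex poly" where "\<forall>t\<in>sphere 0 1. P n t = Re (poly q t)"
      using P[of n] unfolding trig_def by blast
    \<comment> \<open>Subtracting an imaginary constant leaves the real part alone; the value of the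
      polynomial at 0 then equals the mean of \<open>P n\<close>.\<close>
    then show ?thesis
      by (intro exI[of _ "q - [:\<i> * of_real (Im (poly q 0)):]"]) simp
  qed
  then have "\<forall>n. \<exists>q::complex poly. (\<forall>t\<in>sphere 0 1. P n t = Re (poly q t)) \<and> Im (poly q 0) = 0" by blast
  from choice[OF this] obtain q :: "nat \<Rightarrow> complex poly" where
    "\<forall>n. (\<forall>t\<in>sphere 0 1. P n t = Re (poly (q n) t)) \<and> Im (poly (q n) 0) = 0" ..
  then have q: "\<And>n t. t \<in> sphere 0 1 \<Longrightarrow> Re (poly (q n) t) = P n t"
    and q0': "\<And>n. Im (poly (q n) 0) = 0"
    by auto
  have iq: "integrable circle (poly (q n))" for n
    by (intro continuous_on_circle_integrable continuous_intros)
  have q0: "poly (q n) 0 = complex_of_real (LINT t|circle. P n t)" for n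
  proof -
    have "(LINT t|circle. P n t) = (LINT t|circle. Re (poly (q n) t))"
      by (intro Bochner_Integration.integral_cong refl) (simp add: q)
    also have "\<dots> = Re (poly (q n) 0)" using iq by (simp add: integral_poly)
    finally show ?thesis using q0'[of n] by (simp add: complex_eq_iff)
  qed
  define A where "A n t = exp (- poly (q n) t)" for n t
  have Ac: "continuous_on (sphere 0 1) (A n)" for n
    unfolding A_def by (intro continuous_intros)
  have [measurable]: "A n \<in> borel_measurable circle" for n
    by (rule continuous_on_circle_measurable[OF Ac])
  have nA: "cmod (A n t) = exp (- P n t)" if "t \<in> sphere 0 1" for n t
    using q[OF that] by (simp add: A_def)
  have nA1: "cmod (A n t) \<le> 1" if "t \<in> sphere 0 1" for n t
    using nA[OF that] P0[OF that] by simp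
  have "AE t in circle. convergent (\<lambda>n. A n t)"
  proof (rule AE_convergent_of_summable_integral)
    have cd: "continuous_on (sphere 0 1) (\<lambda>t. A (Suc n) t - A n t)" for n
      by (intro continuous_intros Ac)
    then show "integrable circle (\<lambda>t. A (Suc n) t - A n t)" for n
      by (rule continuous_on_circle_integrable)
    show "summable (\<lambda>n. LINT t|circle. cmod (A (Suc n) t - A n t))"
    proof (rule summable_comparison_test')
      show "summable (\<lambda>n. 2 * sqrt e * (1 / 2) ^ n)" by (intro summable_mult summable_geometric) simp
      fix n :: nat
      define d where "d = (LINT t|circle. P (Suc n) t) - (LINT t|circle. P n t)"
      have "(LINT t|circle. cmod (A (Suc n) t - A n t)) \<le>
          (LINT t|circle. cmod (1 - exp (- poly (q (Suc n) - q n) t)))"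
      proof (rule integral_mono)
        show "integrable circle (\<lambda>t. cmod (A (Suc n) t - A n t))"
          using cd by (intro integrable_norm continuous_on_circle_integrable)
        show "integrable circle (\<lambda>t. cmod (1 - exp (- poly (q (Suc n) - q n) t)))"
          by (intro continuous_on_circle_integrable continuous_intros)
        fix t assume "t \<in> space circle"
        then have t: "t \<in> sphere 0 1" by simp
        \<comment> \<open>The factor \<open>A n t\<close> has modulus at most 1, which reduces the
          increment to the polynomial \<open>q (Suc n) - q n\<close>; its real part on the circle is
          nonnegative by monotonicity of \<open>P\<close>.\<close>
        have "A (Suc n) t - A n t = - A n t * (1 - exp (- poly (q (Suc n) - q n) t))"
          by (simp add: A_def algebra_simps exp_add[symmetric])
        then show "cmod (A (Suc n) t - A n t) \<le> cmod (1 - exp (- poly (q (Suc n) - q n) t))"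
          using nA1[OF t, of n] by (simp only: norm_mult norm_minus_cancel) (simp add: mult_left_le_one_le)
      qed
      also have "\<dots> \<le> sqrt (2 * d)"
        using Pmono by (intro integral_norm_one_minus_exp_poly) (auto simp: q q0 d_def)
      also have "\<dots> \<le> sqrt (4 * e / 4 ^ n)"
        using Pstep[of n] by (intro real_sqrt_le_mono) (simp add: d_def)
      also have "\<dots> = 2 * sqrt e * (1 / 2) ^ n"
      proof -
        have "(4::real) ^ n = (2 ^ n)\<^sup>2" by (simp add: power2_eq_square power_mult_distrib[symmetric])
        then show ?thesis by (simp add: real_sqrt_mult real_sqrt_divide power_divide)
      qed
      finally show "norm (LINT t|circle. cmod (A (Suc n) t - A n t)) \<le> 2 * sqrt e * (1 / 2) ^ n"
        by (simp add: integral_nonneg)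
    qed
  qed
  define a where "a t = lim (\<lambda>n. A n t)" for t
  have [measurable]: "a \<in> borel_measurable circle"
    unfolding a_def by measurable
  have lim: "AE t in circle. (\<lambda>n. A n t) \<longlonglongrightarrow> a t"
    using \<open>AE t in circle. convergent (\<lambda>n. A n t)\<close>
    by eventually_elim (simp add: a_def convergent_LIMSEQ_iff)
  have iH: "integrable circle (\<lambda>t. max 0 (G t - P n t))" for n
    using G iP by (intro Bochner_Integration.integrable_max) auto
  have "AE t in circle. (\<lambda>n. max 0 (G t - P n t)) \<longlonglongrightarrow> 0"
  proof (rule AE_tendsto_0_of_summable_integral[OF iH])
    show "summable (\<lambda>n. LINT t|circle. max 0 (G t - P n t))"
    proof (rule summable_comparison_test')
      show "summable (\<lambda>n. e * (1 / 4) ^ n)" by (intro summable_mult summable_geometric) simp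
      show "norm (LINT t|circle. max 0 (G t - P n t)) \<le> e * (1 / 4) ^ n" for n
        using PG[of n] by (simp add: integral_nonneg power_divide)
    qed
  qed simp
  then have aG: "AE t in circle. cmod (a t) \<le> exp (- G t)"
    using lim AE_space
  proof eventually_elim
    case (elim t)
    have "(\<lambda>n. exp (- G t) * exp (max 0 (G t - P n t))) \<longlonglongrightarrow> exp (- G t) * exp 0"
      by (intro tendsto_intros elim)
    then have "(\<lambda>n. exp (- G t) * exp (max 0 (G t - P n t))) \<longlonglongrightarrow> exp (- G t)" by simp
    \<comment> \<open>\<open>|A n| = exp (- P n)\<close> and
      \<open>P n >= G - max 0 (G - P n)\<close>.\<close>
    moreover have "cmod (A n t) \<le> exp (- G t) * exp (max 0 (G t - P n t))" for n
      using elim(3) by (simp add: nA exp_add[symmetric])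
    ultimately show ?case
      by (intro LIMSEQ_le[OF tendsto_norm[OF elim(2)]]) auto
  qed
  have a1: "AE t in circle. cmod (a t) \<le> 1"
    using aG
  proof eventually_elim
    case (elim t)
    have "exp (- G t) \<le> 1" using G(2)[of t] by simp
    with elim show ?case by linarith
  qed
  have conv: "(\<lambda>n. LINT t|circle. A n t * f t) \<longlonglongrightarrow> (LINT t|circle. a t * f t)"
    if f: "integrable circle f" for f
  proof (rule integral_dominated_convergence[where w = "\<lambda>t. cmod (f t)"])
    show "AE t in circle. (\<lambda>n. A n t * f t) \<longlonglongrightarrow> a t * f t"
      using lim by eventually_elim (intro tendsto_intros)
    show "AE t in circle. cmod (A n t * f t) \<le> cmod (f t)" for n
    proof (rule AE_I2)
      fix t assume "t \<in> space circle"
      then show "cmod (A n t * f t) \<le> cmod (f t)"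
        using nA1[of t n] by (simp add: norm_mult mult_left_le_one_le)
    qed
  qed (use f in auto)
  show ?thesis
  proof (rule that)
    show "AE t in circle. cmod (a t) \<le> exp (- G t)" by (rule aG)
    have "(LINT t|circle. a t * (t * h t)) = 0" if h: "h \<in> H2_plus" for h
    proof -
      have i: "integrable circle (\<lambda>t. t * h t)"
        using h by (intro L2_integrable id_mult_L2 H2_plus_L2)
      have "(LINT t|circle. A n t * (t * h t)) = 0" for n
      proof -
        have "(LINT t|circle. t ^ i * (t * h t)) = 0" for i
          using integral_power_H2_plus[OF h, of "Suc i"] by (simp add: mult_ac)
        with integral_exp_poly_mult[OF i, of "- q n"] this[of 0] show ?thesis
          by (simp add: A_def)
      qed
      then show ?thesis using conv[OF i] by (simp add: LIMSEQ_const_iff)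
    qed
    then show "a \<in> Schur" using a1 by (simp add: Schur_def)
    have "(\<lambda>n. LINT t|circle. A n t) \<longlonglongrightarrow> (LINT t|circle. a t)"
      using conv[of "\<lambda>t. 1"] by simp
    moreover have "exp (- (LINT t|circle. G t) - e) \<le> cmod (LINT t|circle. A n t)" for n
      using Ple[of n] integral_exp_poly[of "- q n"] by (simp add: A_def q0)
    ultimately show "exp (- (LINT t|circle. G t) - e) \<le> cmod (LINT t|circle. a t)"
      by (intro LIMSEQ_le_const[OF tendsto_norm]) auto
  qed
qed

section \<open>The lower bound for the distance\<close>

lemma borel_measurable_cnj [measurable (raw)]:
  "f \<in> borel_measurable M \<Longrightarrow> (\<lambda>x. cnj (f x)) \<in> borel_measurable M"
  by (rule borel_measurable_continuous_on[OF continuous_on_cnj[OF continuous_on_id]])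

lemma power_mult_H2_plus:
  assumes h: "h \<in> H2_plus" shows "(\<lambda>t. t ^ k * h t) \<in> H2_plus"
  unfolding H2_plus_def
proof (intro CollectI conjI allI impI)
  show "(\<lambda>t. t ^ k * h t) \<in> L2"
    using AE_circle_norm
    by (intro L2_mult_bounded[where B = 1] H2_plus_L2 h) (auto elim!: eventually_mono simp: norm_power)
  fix j :: int assume j: "j < 0"
  have "fourier_coeff (\<lambda>t. t ^ k * h t) j = (LINT t|circle. t ^ (k + nat (- j)) * h t)"
    unfolding fourier_coeff_def
  proof (intro Bochner_Integration.integral_cong refl)
    fix t assume "t \<in> space circle"
    then have "cnj t powi j = t ^ nat (- j)"
      using cnj_powi_on_circle[of t "nat (- j)"] j by simp
    then show "t ^ k * h t * cnj t powi j = t ^ (k + nat (- j)) * h t"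
      by (simp add: power_add mult_ac)
  qed
  also have "\<dots> = 0" using j by (intro integral_power_H2_plus h) simp
  finally show "fourier_coeff (\<lambda>t. t ^ k * h t) j = 0" .
qed

lemma const_H2_plus: "(\<lambda>t. c) \<in> H2_plus"
proof -
  have "fourier_coeff (\<lambda>t. c) j = 0" if j: "j < 0" for j
  proof -
    have "fourier_coeff (\<lambda>t. c) j = (LINT t|circle. c * t ^ nat (- j))"
      unfolding fourier_coeff_def using cnj_powi_on_circle[of _ "nat (- j)"] j
      by (intro Bochner_Integration.integral_cong refl) simp
    also have "\<dots> = 0" using j by (simp add: integral_circle_power)
    finally show ?thesis .
  qed
  then show ?thesis by (simp add: H2_plus_def L2_continuous)
qed

lemma Schur_L2: "a \<in> Schur \<Longrightarrow> a \<in> L2"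
  by (auto simp: Schur_def intro: L2_bounded)

text \<open>Testing the duality in \<open>Schur\<close> on powers of \<open>t\<close> recovers the
  vanishing of the negative Fourier coefficients of \<open>a\<close>.\<close>

lemma Schur_power_mult_H2_plus:
  assumes a: "a \<in> Schur" shows "(\<lambda>t. a t * t ^ k) \<in> H2_plus"
proof -
  have "fourier_coeff a j = 0" if j: "j < 0" for j
  proof -
    have "fourier_coeff a j = (LINT t|circle. a t * (t * t ^ (nat (- j) - 1)))"
      unfolding fourier_coeff_def
    proof (intro Bochner_Integration.integral_cong refl)
      fix t assume "t \<in> space circle"
      then have "cnj t powi j = t ^ nat (- j)"
        using cnj_powi_on_circle[of t "nat (- j)"] j by simp
      also have "\<dots> = t * t ^ (nat (- j) - 1)" using j by (simp add: power_eq_if)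
      finally show "a t * cnj t powi j = a t * (t * t ^ (nat (- j) - 1))" by simp
    qed
    also have "\<dots> = 0"
      using a power_mult_H2_plus[OF const_H2_plus[of 1], of "nat (- j) - 1"] by (simp add: Schur_def)
    finally show ?thesis .
  qed
  then have "a \<in> H2_plus" using Schur_L2[OF a] by (simp add: H2_plus_def)
  from power_mult_H2_plus[OF this] show ?thesis by (simp add: mult.commute)
qed

text \<open>Relaxations of \<open>H2_plus\<close> and \<open>H2_minus\<close>: they also contain the reflections of \<open>H2_minus\<close>
  and \<open>H2_plus\<close>, which serves to treat the two families of unit vectors at once.\<close>

definition weak_plus :: "(complex \<Rightarrow> complex) set" where
  "weak_plus = {u \<in> L2. \<forall>a\<in>Schur. (LINT t|circle. a t * (t * u t)) = 0}"

definition weak_minus :: "(complex \<Rightarrow> complex) set" where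
  "weak_minus = {v \<in> L2. \<forall>a\<in>Schur. \<forall>k. (LINT t|circle. cnj t ^ k * (cnj (a t) * v t)) = 0}"

lemma H2_plus_weak_plus: "H2_plus \<subseteq> weak_plus"
  by (auto simp: weak_plus_def Schur_def H2_plus_L2)

lemma H2_minus_weak_minus: "H2_minus \<subseteq> weak_minus"
proof
  fix g assume g: "g \<in> H2_minus"
  then have g': "(LINT t|circle. g t * cnj (h t)) = 0" if "h \<in> H2_plus" for h
    using that by (simp add: H2_minus_def)
  have "(LINT t|circle. cnj t ^ k * (cnj (a t) * g t)) = 0" if a: "a \<in> Schur" for a k
  proof -
    have "(LINT t|circle. cnj t ^ k * (cnj (a t) * g t)) = (LINT t|circle. g t * cnj (a t * t ^ k))"
      by (simp add: mult_ac)
    also have "\<dots> = 0"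
      by (rule g'[OF Schur_power_mult_H2_plus[OF a, of k]])
    finally show ?thesis .
  qed
  then show "g \<in> weak_minus" using g by (simp add: weak_minus_def H2_minus_def)
qed

lemma cnj_mult_cnj_L2: "f \<in> L2 \<Longrightarrow> (\<lambda>t. cnj t * cnj (f t)) \<in> L2"
  using L2_cnj[OF id_mult_L2[of f]] by simp

text \<open>The map from \<open>f\<close> to \<open>cnj t * cnj f\<close> interchanges the two Hardy
  spaces. Here the factor \<open>t\<close> cancels \<open>cnj t\<close>, so that the integral is the
  conjugate of the pairing of \<open>g\<close> with \<open>a\<close>, an element of
  \<open>H2_plus\<close>.\<close>

lemma reflect_H2_minus: "g \<in> H2_minus \<Longrightarrow> (\<lambda>t. cnj t * cnj (g t)) \<in> weak_plus"
  unfolding weak_plus_def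
proof (intro CollectI conjI ballI)
  assume g: "g \<in> H2_minus"
  show "(\<lambda>t. cnj t * cnj (g t)) \<in> L2" using g by (intro cnj_mult_cnj_L2) (simp add: H2_minus_def)
  fix a assume a: "a \<in> Schur"
  have "(LINT t|circle. a t * (t * (cnj t * cnj (g t)))) = (LINT t|circle. cnj (g t * cnj (a t * t ^ 0)))"
    by (intro Bochner_Integration.integral_cong refl)
      (simp add: complex_norm_square[symmetric] mult.assoc[symmetric] mult.commute)
  also have "\<dots> = cnj (LINT t|circle. g t * cnj (a t * t ^ 0))"
    by (rule Bochner_Integration.integral_cnj)
  also have "\<dots> = 0" using g Schur_power_mult_H2_plus[OF a, of 0] by (simp add: H2_minus_def)
  finally show "(LINT t|circle. a t * (t * (cnj t * cnj (g t)))) = 0" .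
qed

lemma reflect_H2_plus: "h \<in> H2_plus \<Longrightarrow> (\<lambda>t. cnj t * cnj (h t)) \<in> weak_minus"
  unfolding weak_minus_def
proof (intro CollectI conjI ballI allI)
  assume h: "h \<in> H2_plus"
  show "(\<lambda>t. cnj t * cnj (h t)) \<in> L2" using h by (intro cnj_mult_cnj_L2 H2_plus_L2)
  fix a k assume a: "a \<in> Schur"
  have "(LINT t|circle. cnj t ^ k * (cnj (a t) * (cnj t * cnj (h t)))) =
      (LINT t|circle. cnj (a t * (t * (t ^ k * h t))))"
    by (simp add: mult_ac)
  also have "\<dots> = cnj (LINT t|circle. a t * (t * (t ^ k * h t)))"
    by (rule Bochner_Integration.integral_cnj)
  also have "\<dots> = 0" using a power_mult_H2_plus[OF h, of k] by (simp add: Schur_def)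
  finally show "(LINT t|circle. cnj t ^ k * (cnj (a t) * (cnj t * cnj (h t)))) = 0" .
qed

lemma uminus_weak_minus: "v \<in> weak_minus \<Longrightarrow> (\<lambda>t. - v t) \<in> weak_minus"
  using L2_cmult[of v "-1"] by (auto simp: weak_minus_def)

text \<open>A high power of \<open>cnj t\<close> makes every frequency of a trigonometric polynomial
  a power of \<open>cnj t\<close>; \<open>N - i\<close> is a true difference because
  \<open>i <= degree q <= N\<close>.\<close>

lemma cnj_power_mult_poly:
  fixes q :: "complex poly"
  assumes N: "degree q \<le> N" and t: "cmod t = 1"
  shows "cnj t ^ N * poly q t = (\<Sum>i\<le>degree q. coeff q i * cnj t ^ (N - i))"
    and "cnj t ^ N * cnj (poly q t) = (\<Sum>i\<le>degree q. cnj (coeff q i) * cnj t ^ (N + i))"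
proof -
  have 1: "cnj t * t = 1" using t by (simp add: complex_norm_square[symmetric] mult.commute)
  have "cnj t ^ N * t ^ i = cnj t ^ (N - i)" if "i \<le> N" for i
  proof -
    have "cnj t ^ N = cnj t ^ (N - i) * cnj t ^ i" using that by (simp flip: power_add)
    moreover have "cnj t ^ i * t ^ i = 1" using 1 by (simp flip: power_mult_distrib)
    ultimately show ?thesis by (simp add: mult.assoc)
  qed
  then show "cnj t ^ N * poly q t = (\<Sum>i\<le>degree q. coeff q i * cnj t ^ (N - i))"
    unfolding poly_altdef sum_distrib_left using N by (intro sum.cong) auto
  show "cnj t ^ N * cnj (poly q t) = (\<Sum>i\<le>degree q. cnj (coeff q i) * cnj t ^ (N + i))"
    by (simp add: poly_altdef sum_distrib_left power_add mult_ac)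
qed

text \<open>The threshold is the degree of the polynomial behind \<open>p\<close>, independent of
  \<open>a\<close> and \<open>v\<close>; this is the source of the uniformity in the lower
  bound.\<close>

lemma integral_trig_weak_minus:
  assumes p: "p \<in> trig"
  shows "\<exists>N0. \<forall>N\<ge>N0. \<forall>a\<in>Schur. \<forall>v\<in>weak_minus.
    (LINT t|circle. complex_of_real (p t) * (cnj (a t) * (cnj t ^ N * v t))) = 0"
proof -
  obtain q :: "complex poly" where q: "\<And>t. t \<in> sphere 0 1 \<Longrightarrow> p t = Re (poly q t)"
    using p unfolding trig_def by blast
  show ?thesis
  proof (intro exI[of _ "degree q"] allI impI ballI)
    fix N a v assume N: "degree q \<le> N" and a: "a \<in> Schur" and v: "v \<in> weak_minus"
    define w where "w t = cnj (a t) * v t" for t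
    have i0: "integrable circle w"
      unfolding w_def using v
      by (intro L2_mult_integrable[OF L2_cnj[OF Schur_L2[OF a]]]) (simp add: weak_minus_def)
    have i: "integrable circle (\<lambda>t. cnj t ^ k * w t)" for k
    proof (rule Bochner_Integration.integrable_bound[OF i0])
      show "AE t in circle. cmod (cnj t ^ k * w t) \<le> cmod (w t)"
        using AE_circle_norm by eventually_elim (simp add: norm_mult norm_power)
      show "(\<lambda>t. cnj t ^ k * w t) \<in> borel_measurable circle"
        by (intro borel_measurable_times borel_measurable_integrable[OF i0] continuous_on_circle_measurable continuous_intros)
    qed
    have z: "(LINT t|circle. cnj t ^ k * w t) = 0" for k
      using a v by (simp add: weak_minus_def w_def)
    have s: "(LINT t|circle. (\<Sum>i\<le>degree q. c i * (cnj t ^ e i * w t))) = 0" for c :: "nat \<Rightarrow> complex" and e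
      using i z by (subst Bochner_Integration.integral_sum) auto
    have "(LINT t|circle. complex_of_real (p t) * (cnj (a t) * (cnj t ^ N * v t))) =
        (LINT t|circle. (\<Sum>i\<le>degree q. (coeff q i / 2) * (cnj t ^ (N - i) * w t)) +
          (\<Sum>i\<le>degree q. (cnj (coeff q i) / 2) * (cnj t ^ (N + i) * w t)))"
    proof (intro Bochner_Integration.integral_cong refl)
      fix t assume "t \<in> space circle"
      then have t: "cmod t = 1" "p t = Re (poly q t)" using q by auto
      have "complex_of_real (p t) = (poly q t + cnj (poly q t)) / 2"
        unfolding t(2) by (simp add: complex_add_cnj)
      then have "complex_of_real (p t) * (cnj (a t) * (cnj t ^ N * v t)) =
          (cnj t ^ N * poly q t) * (w t / 2) + (cnj t ^ N * cnj (poly q t)) * (w t / 2)"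
        by (simp only: w_def) (simp add: field_simps)
      then show "complex_of_real (p t) * (cnj (a t) * (cnj t ^ N * v t)) =
          (\<Sum>i\<le>degree q. (coeff q i / 2) * (cnj t ^ (N - i) * w t)) +
          (\<Sum>i\<le>degree q. (cnj (coeff q i) / 2) * (cnj t ^ (N + i) * w t))"
        unfolding cnj_power_mult_poly[OF N t(1)] by (simp add: sum_distrib_right sum_distrib_left sum_divide_distrib mult_ac)
    qed
    also have "\<dots> = 0"
      using i by (subst Bochner_Integration.integral_add) (auto simp only: s add_0_left intro!: Bochner_Integration.integrable_sum integrable_mult_right)
    finally show "(LINT t|circle. complex_of_real (p t) * (cnj (a t) * (cnj t ^ N * v t))) = 0" .
  qed
qed

lemma complex_approx_trig:
  fixes f :: "complex \<Rightarrow> complex"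
  assumes f: "f \<in> borel_measurable circle" "\<And>t. cmod (f t) \<le> 1" and e: "0 < e"
  obtains p1 p2 where "p1 \<in> trig" "p2 \<in> trig"
    "(LINT t|circle. (cmod (f t - (of_real (p1 t) + \<i> * of_real (p2 t))))\<^sup>2) < e"
proof -
  have b: "\<bar>Re (f t)\<bar> \<le> 1" "\<bar>Im (f t)\<bar> \<le> 1" for t
    using f(2)[of t] abs_Re_le_cmod[of "f t"] abs_Im_le_cmod[of "f t"] by linarith+
  have m: "(\<lambda>t. Re (f t)) \<in> borel_measurable circle" "(\<lambda>t. Im (f t)) \<in> borel_measurable circle"
    using f(1) by measurable
  obtain p1 where p1: "p1 \<in> trig" "(LINT t|circle. (Re (f t) - p1 t)\<^sup>2) < e / 2"
    using bounded_approx_trig[OF m(1) b(1)] e half_gt_zero by blast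
  obtain p2 where p2: "p2 \<in> trig" "(LINT t|circle. (Im (f t) - p2 t)\<^sup>2) < e / 2"
    using bounded_approx_trig[OF m(2) b(2)] e half_gt_zero by blast
  have L: "(\<lambda>t. complex_of_real (g t - p t)) \<in> L2"
    if "g \<in> borel_measurable circle" "\<And>t. \<bar>g t\<bar> \<le> 1" "p \<in> trig" for g p
  proof -
    have 1: "(\<lambda>t. complex_of_real (g t)) \<in> L2" using that by (intro L2_bounded[where B = 1]) auto
    have 2: "(\<lambda>t. (-1) * complex_of_real (p t)) \<in> L2"
      using that by (intro L2_cmult L2_continuous continuous_intros trig_continuous)
    show ?thesis using L2_add[OF 1 2] by simp
  qed
  have i: "integrable circle (\<lambda>t. (Re (f t) - p1 t)\<^sup>2)" "integrable circle (\<lambda>t. (Im (f t) - p2 t)\<^sup>2)"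
    using L2_square_integrable[OF L[OF m(1) b(1) p1(1)]] L2_square_integrable[OF L[OF m(2) b(2) p2(1)]]
    by (simp_all only: norm_of_real power2_abs)
  have "(LINT t|circle. (cmod (f t - (of_real (p1 t) + \<i> * of_real (p2 t))))\<^sup>2) =
      (LINT t|circle. (Re (f t) - p1 t)\<^sup>2 + (Im (f t) - p2 t)\<^sup>2)"
    by (simp add: cmod_power2)
  also have "\<dots> < e" using i p1(2) p2(2) by simp
  finally show ?thesis using that p1(1) p2(1) by blast
qed

text \<open>The quadratic form \<open>|x|^2 + |y|^2 + 2 Re (r x cnj y)\<close> of the matrix
  \<open>W\<close> at \<open>(x, y)\<close>, with the square completed so that both summands are
  nonnegative for \<open>|r| <= 1\<close>.\<close>

definition W_form :: "complex \<Rightarrow> complex \<Rightarrow> complex \<Rightarrow> real" where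
  "W_form r x y = (cmod (x + cnj r * y))\<^sup>2 + (1 - (cmod r)\<^sup>2) * (cmod y)\<^sup>2"

section \<open>Multipliers adapted to the weight and the lower bound\<close>

locale reflection =
  fixes R :: "complex \<Rightarrow> complex"
  assumes R_measurable [measurable]: "R \<in> borel_measurable circle"
    and R_log: "log_integrable circle (\<lambda>t. 1 - cmod (R t))"
begin

lemma R_less_1: "AE t in circle. cmod (R t) < 1"
  using R_log by (simp add: log_integrable_def)

lemma R_L2_mult: "f \<in> L2 \<Longrightarrow> (\<lambda>t. R t * f t) \<in> L2"
  using R_less_1 by (intro L2_mult_bounded[where B = 1]) (auto elim: eventually_mono)

lemma cnj_R_L2_mult: "f \<in> L2 \<Longrightarrow> (\<lambda>t. cnj (R t) * f t) \<in> L2"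
  using L2_cnj[OF R_L2_mult[OF L2_cnj]] by simp

text \<open>Apply \<open>Schur_minorant\<close> to \<open>G k\<close>, the part of
  \<open>- L\<close> above \<open>k\<close>. Then \<open>exp (- G k) <= exp k * (1 - |R|)\<close>,
  so \<open>C = exp k\<close>, and integrability of \<open>L\<close> makes the integral of
  \<open>G k\<close> tend to 0, which sends the lower bound on the mean to
  \<open>exp (- e / 2)\<close>.\<close>

lemma multiplier_exists:
  assumes e: "0 < e"
  obtains a C where "a \<in> Schur" "0 < C" "AE t in circle. cmod (a t) \<le> C * (1 - cmod (R t))"
    "1 - e \<le> cmod (LINT t|circle. a t)"
proof -
  define L where "L t = ln (1 - cmod (R t))" for t
  have iL: "integrable circle L" using R_log unfolding log_integrable_def L_def by blast
  define G where "G k t = max 0 (- real k - L t)" for k t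
  have iG: "integrable circle (G k)" for k
    unfolding G_def using iL by (intro Bochner_Integration.integrable_max) auto
  have G0: "0 \<le> G k t" for k t by (simp add: G_def)
  have "(\<lambda>k. LINT t|circle. G k t) \<longlonglongrightarrow> (LINT t|circle. 0)"
  proof (rule integral_dominated_convergence[where w = "\<lambda>t. \<bar>L t\<bar>"])
    show "AE t in circle. (\<lambda>k. G k t) \<longlonglongrightarrow> 0"
    proof (rule AE_I2)
      fix t
      obtain K where K: "- L t \<le> real K" using real_arch_simple by blast
      have "eventually (\<lambda>k. G k t = 0) sequentially"
        using eventually_ge_at_top[of K] by eventually_elim (use K in \<open>auto simp: G_def\<close>)
      then show "(\<lambda>k. G k t) \<longlonglongrightarrow> 0" by (rule tendsto_eventually)
    qed
    show "AE t in circle. norm (G k t) \<le> \<bar>L t\<bar>" for k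
      by (intro AE_I2) (auto simp: G_def)
  qed (use iG iL in auto)
  then have "(\<lambda>k. exp (- (LINT t|circle. G k t) - e / 2)) \<longlonglongrightarrow> exp (- 0 - e / 2)"
    by (intro tendsto_intros) simp
  moreover have "1 - e < exp (- 0 - e / 2)" using exp_ge_add_one_self[of "- e / 2"] e by simp
  ultimately have "eventually (\<lambda>k. 1 - e < exp (- (LINT t|circle. G k t) - e / 2)) sequentially"
    by (rule order_tendstoD(1))
  then obtain k where k: "1 - e < exp (- (LINT t|circle. G k t) - e / 2)"
    by (auto simp: eventually_sequentially)
  have e2: "0 < e / 2" using e by simp
  obtain a where a: "a \<in> Schur" "AE t in circle. cmod (a t) \<le> exp (- G k t)"
    "exp (- (LINT t|circle. G k t) - e / 2) \<le> cmod (LINT t|circle. a t)"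
    using Schur_minorant[OF iG G0 e2] by blast
  have "AE t in circle. cmod (a t) \<le> exp (real k) * (1 - cmod (R t))"
    using a(2) R_less_1
  proof eventually_elim
    case (elim t)
    have "exp (- G k t) \<le> exp (real k + L t)" by (simp add: G_def)
    also have "\<dots> = exp (real k) * (1 - cmod (R t))" using elim by (simp add: exp_add L_def)
    finally show ?case using elim by linarith
  qed
  with a k show ?thesis by (intro that[of a "exp (real k)"]) auto
qed

lemma W_form_integral:
  assumes x: "x \<in> L2" and y: "y \<in> L2"
  shows "(LINT t|circle. W_form (R t) (x t) (y t)) =
      (LINT t|circle. (cmod (x t + cnj (R t) * y t))\<^sup>2) + (LINT t|circle. (1 - (cmod (R t))\<^sup>2) * (cmod (y t))\<^sup>2)"
    and "integrable circle (\<lambda>t. (1 - (cmod (R t))\<^sup>2) * (cmod (y t))\<^sup>2)"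
    and "(\<lambda>t. x t + cnj (R t) * y t) \<in> L2"
proof -
  show 1: "(\<lambda>t. x t + cnj (R t) * y t) \<in> L2" by (intro L2_add x cnj_R_L2_mult y)
  have "integrable circle (\<lambda>t. (cmod (y t))\<^sup>2 - (cmod (R t * y t))\<^sup>2)"
    by (intro Bochner_Integration.integrable_diff L2_square_integrable R_L2_mult y)
  then show 2: "integrable circle (\<lambda>t. (1 - (cmod (R t))\<^sup>2) * (cmod (y t))\<^sup>2)"
    by (simp add: left_diff_distrib norm_mult power_mult_distrib)
  show "(LINT t|circle. W_form (R t) (x t) (y t)) =
      (LINT t|circle. (cmod (x t + cnj (R t) * y t))\<^sup>2) + (LINT t|circle. (1 - (cmod (R t))\<^sup>2) * (cmod (y t))\<^sup>2)"
    unfolding W_form_def by (intro Bochner_Integration.integral_add L2_square_integrable 1 2)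
qed

text \<open>Testing \<open>f = 1 - t u + cnj R cnj t\<^sup>N v\<close> against a multiplier \<open>a\<close> removes \<open>u\<close>. Since
  \<open>a cnj R = \<phi> cnj a\<close> with \<open>\<phi>\<close> bounded, and \<open>\<phi>\<close> is close in \<open>L2\<close> to a trigonometric polynomial,
  the contribution of \<open>v\<close> becomes negligible as \<open>N\<close> grows, which leaves the mean of \<open>a\<close>.\<close>

lemma W_form_lower_bound:
  assumes e: "0 < e"
  shows "\<exists>N0. \<forall>N\<ge>N0. \<forall>u\<in>weak_plus. \<forall>v\<in>weak_minus.
    1 - e \<le> sqrt (LINT t|circle. W_form (R t) (1 - t * u t) (cnj t ^ N * v t))"
proof -
  have e2: "0 < e / 2" using e by simp
  obtain a C where a: "a \<in> Schur" and C: "0 < C"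
    and aC: "AE t in circle. cmod (a t) \<le> C * (1 - cmod (R t))"
    and mean: "1 - e / 2 \<le> cmod (LINT t|circle. a t)"
    using multiplier_exists[OF e2] by blast
  have [measurable]: "a \<in> borel_measurable circle" and a1: "AE t in circle. cmod (a t) \<le> 1"
    using a by (auto simp: Schur_def)
  \<comment> \<open>Where \<open>|R| <= 1\<close>, \<open>cnj R * a = \<phi> * cnj a\<close>.
    Division by zero gives 0, which is consistent at zeros of \<open>a\<close>, and the case
    distinction bounds \<open>\<phi>\<close> by 1 at every point, not just almost
    everywhere.\<close>
  define \<phi> where "\<phi> t = (if cmod (R t) \<le> 1 then cnj (R t) * (a t / cnj (a t)) else 0)" for t
  have "\<phi> \<in> borel_measurable circle"
    unfolding \<phi>_def by measurable
  moreover have "cmod (\<phi> t) \<le> 1" for t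
    by (auto simp: \<phi>_def norm_mult norm_divide)
  \<comment> \<open>The squared L2 error is chosen against the bound \<open>C\<close> for the
    squared norm of \<open>cnj a * y\<close>, so that Cauchy-Schwarz leaves
    \<open>e / 2\<close>.\<close>
  moreover have "0 < (e / 2)\<^sup>2 / C" using e C by simp
  ultimately obtain p1 p2 where p: "p1 \<in> trig" "p2 \<in> trig"
    and p_close: "(LINT t|circle. (cmod (\<phi> t - (of_real (p1 t) + \<i> * of_real (p2 t))))\<^sup>2) < (e / 2)\<^sup>2 / C"
    using complex_approx_trig[of \<phi> "(e / 2)\<^sup>2 / C"] by blast
  define P where "P t = of_real (p1 t) + \<i> * complex_of_real (p2 t)" for t
  obtain N1 where N1: "\<And>N v. N \<ge> N1 \<Longrightarrow> v \<in> weak_minus \<Longrightarrow>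
      (LINT t|circle. complex_of_real (p1 t) * (cnj (a t) * (cnj t ^ N * v t))) = 0"
    using integral_trig_weak_minus[OF p(1)] a by blast
  obtain N2 where N2: "\<And>N v. N \<ge> N2 \<Longrightarrow> v \<in> weak_minus \<Longrightarrow>
      (LINT t|circle. complex_of_real (p2 t) * (cnj (a t) * (cnj t ^ N * v t))) = 0"
    using integral_trig_weak_minus[OF p(2)] a by blast
  show ?thesis
  proof (intro exI[of _ "max N1 N2"] allI impI ballI)
    fix N u v assume N: "max N1 N2 \<le> N" and u: "u \<in> weak_plus" and v: "v \<in> weak_minus"
    have uL: "u \<in> L2" and vL: "v \<in> L2" using u v by (auto simp: weak_plus_def weak_minus_def)
    define x where "x t = 1 - t * u t" for t
    define y where "y t = cnj t ^ N * v t" for t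
    have tu: "(\<lambda>t. t * u t) \<in> L2" by (rule id_mult_L2[OF uL])
    have xL: "x \<in> L2"
      unfolding x_def using L2_add[OF L2_continuous[of "\<lambda>t. 1"] L2_cmult[OF tu, of "-1"]] by simp
    have yL: "y \<in> L2"
      unfolding y_def
    proof (rule L2_mult_bounded[OF vL, where B = 1])
      show "(\<lambda>t. cnj t ^ N) \<in> borel_measurable circle"
        by (intro continuous_on_circle_measurable continuous_intros)
      show "AE t in circle. cmod (cnj t ^ N) \<le> 1"
        using AE_circle_norm by eventually_elim (simp add: norm_power)
    qed
    define f where "f t = x t + cnj (R t) * y t" for t
    define Q where "Q = (LINT t|circle. W_form (R t) (x t) (y t))"
    note Wf = W_form_integral[OF xL yL, folded f_def]
    have Ry: "AE t in circle. 0 \<le> (1 - (cmod (R t))\<^sup>2) * (cmod (y t))\<^sup>2"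
      using R_less_1 by eventually_elim (simp add: power_le_one)
    then have nn: "0 \<le> (LINT t|circle. (1 - (cmod (R t))\<^sup>2) * (cmod (y t))\<^sup>2)"
      by (rule integral_nonneg_AE)
    have nf: "0 \<le> (LINT t|circle. (cmod (f t))\<^sup>2)" by (simp add: integral_nonneg)
    have "1 - e \<le> sqrt Q"
    \<comment> \<open>For \<open>Q > 1\<close> the claim is trivial; otherwise \<open>Q <= 1\<close>
      bounds the weighted norm of \<open>y\<close>, which the multiplier converts into a bound for
      \<open>cnj a * y\<close>.\<close>
    proof (cases "Q \<le> 1")
      case False then show ?thesis using e real_sqrt_ge_1_iff[of Q] by linarith
    next
      case True
      have aL: "a \<in> L2" by (rule Schur_L2[OF a])
      have ay: "(\<lambda>t. cnj (a t) * y t) \<in> L2"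
        using a1 by (intro L2_mult_bounded[OF yL, where B = 1]) auto
      have "(LINT t|circle. (cmod (cnj (a t) * y t))\<^sup>2) \<le>
          (LINT t|circle. C * ((1 - (cmod (R t))\<^sup>2) * (cmod (y t))\<^sup>2))"
      proof (rule integral_mono_AE)
        show "AE t in circle. (cmod (cnj (a t) * y t))\<^sup>2 \<le> C * ((1 - (cmod (R t))\<^sup>2) * (cmod (y t))\<^sup>2)"
          using aC a1 R_less_1
        proof eventually_elim
          case (elim t)
          \<comment> \<open>One factor \<open>|a|\<close> is bounded by 1, the other by
            \<open>C * (1 - |R|)\<close>; afterwards \<open>1 - |R| <= 1 - |R|^2\<close>.\<close>
          have "(cmod (a t))\<^sup>2 \<le> 1 * (C * (1 - cmod (R t)))"
            unfolding power2_eq_square using elim by (intro mult_mono) auto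
          also have "\<dots> \<le> C * (1 - (cmod (R t))\<^sup>2)"
            using C elim by (simp add: power2_eq_square mult_left_le_one_le)
          finally have "(cmod (a t))\<^sup>2 * (cmod (y t))\<^sup>2 \<le> C * (1 - (cmod (R t))\<^sup>2) * (cmod (y t))\<^sup>2"
            by (rule mult_right_mono) simp
          then show ?case by (simp add: norm_mult power_mult_distrib mult.assoc)
        qed
      qed (use L2_square_integrable[OF ay] Wf(2) in auto)
      also have "\<dots> = C * (LINT t|circle. (1 - (cmod (R t))\<^sup>2) * (cmod (y t))\<^sup>2)" by simp
      also have "\<dots> \<le> C * 1"
      proof (rule mult_left_mono)
        show "(LINT t|circle. (1 - (cmod (R t))\<^sup>2) * (cmod (y t))\<^sup>2) \<le> 1"
          using True Wf(1) nf unfolding Q_def by linarith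
      qed (use C in simp)
      finally have ayC: "(LINT t|circle. (cmod (cnj (a t) * y t))\<^sup>2) \<le> C" by simp
      have PL: "(\<lambda>t. (-1) * P t) \<in> L2"
        unfolding P_def using p by (intro L2_cmult L2_continuous continuous_intros trig_continuous)
      have \<phi>L: "\<phi> \<in> L2"
        using \<open>\<phi> \<in> borel_measurable circle\<close> \<open>\<And>t. cmod (\<phi> t) \<le> 1\<close> by (intro L2_bounded[where B = 1]) auto
      have \<phi>PL: "(\<lambda>t. \<phi> t - P t) \<in> L2" using L2_add[OF \<phi>L PL] by simp
      have "cmod (LINT t|circle. (\<phi> t - P t) * (cnj (a t) * y t)) \<le>
          sqrt (LINT t|circle. (cmod (\<phi> t - P t))\<^sup>2) * sqrt (LINT t|circle. (cmod (cnj (a t) * y t))\<^sup>2)"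
        by (rule L2_Cauchy_Schwarz[OF \<phi>PL ay])
      also have "\<dots> \<le> sqrt ((e / 2)\<^sup>2 / C) * sqrt C"
        using p_close ayC C by (intro mult_mono real_sqrt_le_mono) (auto simp: P_def intro: integral_nonneg)
      also have "\<dots> = e / 2" using C e by (simp add: real_sqrt_divide)
      finally have small: "cmod (LINT t|circle. (\<phi> t - P t) * (cnj (a t) * y t)) \<le> e / 2" .
      have iP: "integrable circle (\<lambda>t. complex_of_real (p' t) * (cnj (a t) * y t))" if "p' \<in> trig" for p'
        using that by (intro L2_mult_integrable ay L2_continuous continuous_intros trig_continuous)
      have "(LINT t|circle. P t * (cnj (a t) * y t)) =
          (LINT t|circle. complex_of_real (p1 t) * (cnj (a t) * y t) + \<i> * (complex_of_real (p2 t) * (cnj (a t) * y t)))"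
        by (simp add: P_def algebra_simps)
      also have "\<dots> = 0"
        using iP[OF p(1)] iP[OF p(2)] N1[OF _ v] N2[OF _ v] N
        by (subst Bochner_Integration.integral_add) (auto simp: y_def)
      finally have P0: "(LINT t|circle. P t * (cnj (a t) * y t)) = 0" .
      have i\<phi>: "integrable circle (\<lambda>t. \<phi> t * (cnj (a t) * y t))" "integrable circle (\<lambda>t. P t * (cnj (a t) * y t))"
        using L2_mult_integrable[OF \<phi>L ay] L2_mult_integrable[OF PL ay] by auto
      have "(LINT t|circle. \<phi> t * (cnj (a t) * y t)) = (LINT t|circle. (\<phi> t - P t) * (cnj (a t) * y t))"
        unfolding left_diff_distrib using i\<phi> P0 by (subst Bochner_Integration.integral_diff) auto
      moreover have "(LINT t|circle. a t * f t) =
          (LINT t|circle. (a t - a t * (t * u t)) + \<phi> t * (cnj (a t) * y t))"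
      proof (rule integral_cong_AE)
        show "AE t in circle. a t * f t = (a t - a t * (t * u t)) + \<phi> t * (cnj (a t) * y t)"
          using R_less_1 by eventually_elim (auto simp: f_def x_def \<phi>_def algebra_simps)
        show "(\<lambda>t. a t * f t) \<in> borel_measurable circle"
          using L2_mult_integrable[OF aL Wf(3)] by (rule borel_measurable_integrable)
        show "(\<lambda>t. (a t - a t * (t * u t)) + \<phi> t * (cnj (a t) * y t)) \<in> borel_measurable circle"
          using L2_mult_integrable[OF aL tu] i\<phi>(1) by measurable
      qed
      moreover have "\<dots> = (LINT t|circle. a t) + (LINT t|circle. \<phi> t * (cnj (a t) * y t))"
        using L2_integrable[OF aL] L2_mult_integrable[OF aL tu] i\<phi>(1) u a
        by (simp add: weak_plus_def)
      ultimately have "cmod ((LINT t|circle. a t * f t) - (LINT t|circle. a t)) \<le> e / 2"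
        using small by simp
      then have "1 - e \<le> cmod (LINT t|circle. a t * f t)"
        using mean norm_triangle_sub[of "LINT t|circle. a t" "LINT t|circle. a t * f t"]
        by (simp add: norm_minus_commute)
      also have "\<dots> \<le> sqrt (LINT t|circle. (cmod (a t))\<^sup>2) * sqrt (LINT t|circle. (cmod (f t))\<^sup>2)"
        by (rule L2_Cauchy_Schwarz[OF aL Wf(3)])
      also have "\<dots> \<le> 1 * sqrt Q"
      proof (intro mult_mono real_sqrt_le_mono)
        have "(LINT t|circle. (cmod (a t))\<^sup>2) \<le> (LINT t|circle. 1)"
          using a1 by (intro integral_mono_AE L2_square_integrable[OF aL]) (auto elim!: eventually_mono simp: power_le_one)
        then show "sqrt (LINT t|circle. (cmod (a t))\<^sup>2) \<le> 1" by simp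
        show "(LINT t|circle. (cmod (f t))\<^sup>2) \<le> Q" using Wf(1) nn by (simp add: Q_def)
      qed (auto simp: integral_nonneg)
      finally show ?thesis by simp
    qed
    then show "1 - e \<le> sqrt (LINT t|circle. W_form (R t) (1 - t * u t) (cnj t ^ N * v t))"
      by (simp add: Q_def x_def y_def)
  qed
qed

end

section \<open>The Hilbert space LR\<close>

lemma matrix_inv_eqI:
  fixes A B :: "complex^'n^'n"
  assumes AB: "A ** B = mat 1" and BA: "B ** A = mat 1"
  shows "matrix_inv A = B"
proof -
  have "A ** matrix_inv A = mat 1 \<and> matrix_inv A ** A = mat 1"
    unfolding matrix_inv_def
    by (rule someI[of "\<lambda>X. A ** X = mat 1 \<and> X ** A = mat 1" B]) (simp add: AB BA)
  then have "B ** (A ** matrix_inv A) = B" by simp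
  moreover have "B ** (A ** matrix_inv A) = matrix_inv A" by (simp add: matrix_mul_assoc BA)
  ultimately show ?thesis by simp
qed

lemma W_mult_vec: "W R t *v vector [x, y] = vector [x + cnj (R t) * y, R t * x + y]"
  by (simp add: W_def vec_eq_iff forall_2 matrix_vector_mult_def sum_2)

lemma W_inv_mult_vec:
  assumes "cmod (R t) < 1"
  shows "matrix_inv (W R t) *v v = vector [(v $ 1 - cnj (R t) * v $ 2) / of_real (1 - (cmod (R t))\<^sup>2),
    (v $ 2 - R t * v $ 1) / of_real (1 - (cmod (R t))\<^sup>2)]"
proof -
  define d where "d = complex_of_real (1 - (cmod (R t))\<^sup>2)"
  have "(cmod (R t))\<^sup>2 < 1" using assms by (simp add: power_less_one_iff abs_square_less_1)
  then have d0: "d \<noteq> 0" unfolding d_def by (metis diff_gt_0_iff_gt less_irrefl of_real_eq_0_iff)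
  have d: "d = 1 - R t * cnj (R t)" unfolding d_def of_real_diff complex_norm_square by simp
  define B :: "complex^2^2" where "B = vector [vector [1 / d, - cnj (R t) / d], vector [- R t / d, 1 / d]]"
  have "W R t ** B = mat 1" "B ** W R t = mat 1"
    using d0 by (simp_all add: W_def B_def vec_eq_iff forall_2 matrix_matrix_mult_def sum_2 mat_def
        divide_simps) (simp_all add: d algebra_simps)
  then have "matrix_inv (W R t) = B" by (rule matrix_inv_eqI)
  then show ?thesis
    unfolding d_def[symmetric]
    by (simp add: B_def vec_eq_iff forall_2 matrix_vector_mult_def sum_2 diff_divide_distrib)
qed

lemma borel_measurable_component:
  fixes f :: "'a \<Rightarrow> complex^2"
  shows "f \<in> borel_measurable M \<Longrightarrow> (\<lambda>t. f t $ i) \<in> borel_measurable M"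
  by (rule borel_measurable_continuous_on[OF continuous_on_component[OF continuous_on_id]])

lemma borel_measurable_vector_2:
  fixes f g :: "'a \<Rightarrow> complex"
  assumes "f \<in> borel_measurable M" "g \<in> borel_measurable M"
  shows "(\<lambda>t. vector [f t, g t] :: complex^2) \<in> borel_measurable M"
proof (rule borel_measurable_continuous_Pair[OF assms])
  have "(vector [x, y] :: complex^2) = (\<chi> i. if i = 1 then x else y)" for x y :: complex
    by (simp add: vec_eq_iff forall_2)
  moreover have "continuous_on UNIV (\<lambda>x. (\<chi> i. if i = (1::2) then fst x else snd x) :: complex^2)"
  proof (intro continuous_on_vec_lambda)
    fix i :: 2 show "continuous_on UNIV (\<lambda>x. if i = 1 then fst x else snd x :: complex)"
      by (cases "i = 1") (auto intro!: continuous_intros)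
  qed
  ultimately show "continuous_on UNIV (\<lambda>x. vector [fst x, snd x] :: complex^2)" by simp
qed

lemma complex_integrable_norm_square:
  assumes m: "x \<in> borel_measurable circle" "y \<in> borel_measurable circle"
    and i: "integrable circle (\<lambda>t. x t * cnj (x t) + y t * cnj (y t))"
  shows "x \<in> L2" "y \<in> L2"
proof -
  have eq: "x t * cnj (x t) + y t * cnj (y t) = complex_of_real ((cmod (x t))\<^sup>2 + (cmod (y t))\<^sup>2)" for t
    by (simp only: complex_norm_square of_real_add)
  have "integrable circle (\<lambda>t. Re (x t * cnj (x t) + y t * cnj (y t)))" using i by (rule integrable_Re)
  then have i': "integrable circle (\<lambda>t. (cmod (x t))\<^sup>2 + (cmod (y t))\<^sup>2)" unfolding eq by simp
  have "integrable circle (\<lambda>t. (cmod (x t))\<^sup>2)" "integrable circle (\<lambda>t. (cmod (y t))\<^sup>2)"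
    using m by (auto intro!: Bochner_Integration.integrable_bound[OF i'])
  then show "x \<in> L2" "y \<in> L2" using m by (simp_all add: L2_def)
qed

lemma L2_nrm_power2: "(L2.nrm f)\<^sup>2 = (LINT t|circle. (cmod (f t))\<^sup>2)"
  unfolding L2_nrm by (rule real_sqrt_pow2) (simp add: integral_nonneg)

context reflection
begin

definition T1 :: "(complex \<Rightarrow> complex^2) \<Rightarrow> complex \<Rightarrow> complex" where
  "T1 f t = f t $ 1"

text \<open>Completing the square in the form of the inverse of \<open>W\<close> leaves
  \<open>|f1|^2 + |f2 - R f1|^2 / (1 - |R|^2)\<close>, where \<open>1 - |R|^2\<close> is the Schur
  complement.\<close>

definition T2 :: "(complex \<Rightarrow> complex^2) \<Rightarrow> complex \<Rightarrow> complex" where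
  "T2 f t = (f t $ 2 - R t * f t $ 1) / of_real (sqrt (1 - (cmod (R t))\<^sup>2))"

text \<open>\<open>f \<mapsto> (T1 f, T2 f)\<close> is a unitary map from \<open>LR R\<close> onto \<open>L2 \<times> L2\<close>.\<close>

lemma LR_form_T: "AE t in circle. LR_form R f g t = T1 f t * cnj (T1 g t) + T2 f t * cnj (T2 g t)"
  using R_less_1
proof eventually_elim
  case (elim t)
  define s where "s = sqrt (1 - (cmod (R t))\<^sup>2)"
  have "(cmod (R t))\<^sup>2 < 1" using elim by (simp add: power_less_one_iff abs_square_less_1)
  then have s: "s > 0" "s\<^sup>2 = 1 - (cmod (R t))\<^sup>2" by (simp_all add: s_def)
  have s2: "complex_of_real (1 - (cmod (R t))\<^sup>2) = of_real s * of_real s"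
    unfolding s(2)[symmetric] by (simp add: power2_eq_square)
  have R2: "R t * cnj (R t) = 1 - of_real s * of_real s"
    unfolding s2[symmetric] of_real_diff complex_norm_square by simp
  define r where "r = R t"
  define S where "S = complex_of_real s"
  have S: "S \<noteq> 0" "cnj S = S" "r * cnj r = 1 - S * S" using s R2 by (simp_all add: S_def r_def)
  have key: "cnj g1 * ((f1 - cnj r * f2) / (S * S)) + cnj g2 * ((f2 - r * f1) / (S * S)) =
      f1 * cnj g1 + ((f2 - r * f1) / S) * cnj ((g2 - r * g1) / S)" for f1 f2 g1 g2
  proof -
    have "cnj g1 * (f1 - cnj r * f2) + cnj g2 * (f2 - r * f1) =
        f1 * cnj g1 * (S * S) + (f2 - r * f1) * (cnj g2 - cnj r * cnj g1)"
    proof -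
      have "f1 * cnj g1 * (S * S) = f1 * cnj g1 * (1 - r * cnj r)" using S(3) by simp
      then show ?thesis by (simp add: algebra_simps)
    qed
    then have "(cnj g1 * (f1 - cnj r * f2) + cnj g2 * (f2 - r * f1)) / (S * S) =
        (f1 * cnj g1 * (S * S) + (f2 - r * f1) * (cnj g2 - cnj r * cnj g1)) / (S * S)" by simp
    then show ?thesis using S(1,2) by (simp add: add_divide_distrib)
  qed
  show ?case
    unfolding LR_form_def W_inv_mult_vec[of R t, OF elim] s2 T1_def T2_def s_def[symmetric]
    using key[of "g t $ 1" "f t $ 1" "f t $ 2" "g t $ 2"] by (simp add: sum_2 r_def S_def)
qed

lemma T_measurable:
  assumes "f \<in> borel_measurable circle"
  shows "T1 f \<in> borel_measurable circle" "T2 f \<in> borel_measurable circle"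
proof -
  note [measurable] = borel_measurable_component[OF assms]
  show "T1 f \<in> borel_measurable circle" unfolding T1_def by measurable
  show "T2 f \<in> borel_measurable circle" unfolding T2_def by measurable
qed

text \<open>The integrand for \<open>f\<close> is almost everywhere a sum of two squares, so its
  integrability forces each square to be integrable; the weighted space thereby reduces to two
  copies of \<open>L2\<close>.\<close>

lemma LR_iff: "f \<in> LR R \<longleftrightarrow> f \<in> borel_measurable circle \<and> T1 f \<in> L2 \<and> T2 f \<in> L2"
proof -
  have "integrable circle (LR_form R f f) \<longleftrightarrow> T1 f \<in> L2 \<and> T2 f \<in> L2"
    if f: "f \<in> borel_measurable circle"
  proof -
    note m [measurable] = T_measurable[OF f]
    have 1: "(\<lambda>t. T1 f t * cnj (T1 f t) + T2 f t * cnj (T2 f t)) \<in> borel_measurable circle" by measurable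
    have 2: "LR_form R f f \<in> borel_measurable circle"
      using LR_form_T[of f f] by (intro measurable_circle_AE_cong[OF 1]) (auto elim!: eventually_mono)
    have "integrable circle (LR_form R f f) \<longleftrightarrow>
        integrable circle (\<lambda>t. T1 f t * cnj (T1 f t) + T2 f t * cnj (T2 f t))"
      by (rule integrable_cong_AE[OF 2 1 LR_form_T])
    also have "\<dots> \<longleftrightarrow> T1 f \<in> L2 \<and> T2 f \<in> L2"
      using complex_integrable_norm_square[OF m]
      by (auto intro: Bochner_Integration.integrable_add L2_mult_cnj_integrable)
    finally show ?thesis .
  qed
  then show ?thesis unfolding LR_def by blast
qed

lemma LR_inner_T:
  assumes f: "f \<in> LR R" and g: "g \<in> LR R"
  shows "LR_inner R f g = (LINT t|circle. T1 f t * cnj (T1 g t)) + (LINT t|circle. T2 f t * cnj (T2 g t))"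
proof -
  have i: "integrable circle (\<lambda>t. T1 f t * cnj (T1 g t))" "integrable circle (\<lambda>t. T2 f t * cnj (T2 g t))"
    using f g by (auto intro!: L2_mult_cnj_integrable simp: LR_iff)
  then have 1: "(\<lambda>t. T1 f t * cnj (T1 g t) + T2 f t * cnj (T2 g t)) \<in> borel_measurable circle"
    by measurable
  have 2: "LR_form R f g \<in> borel_measurable circle"
    using LR_form_T[of f g] by (intro measurable_circle_AE_cong[OF 1]) (auto elim!: eventually_mono)
  have "LR_inner R f g = (LINT t|circle. T1 f t * cnj (T1 g t) + T2 f t * cnj (T2 g t))"
    unfolding LR_inner_def by (rule integral_cong_AE[OF 2 1 LR_form_T])
  also have "\<dots> = (LINT t|circle. T1 f t * cnj (T1 g t)) + (LINT t|circle. T2 f t * cnj (T2 g t))"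
    using i by (rule Bochner_Integration.integral_add)
  finally show ?thesis .
qed

lemma T_add: "T1 (f + g) = T1 f + T1 g" "T2 (f + g) = T2 f + T2 g"
  by (auto simp: T1_def T2_def fun_eq_iff add_divide_distrib[symmetric] algebra_simps)

lemma T_diff: "T1 (f - g) = T1 f - T1 g" "T2 (f - g) = T2 f - T2 g"
  by (auto simp: T1_def T2_def fun_eq_iff diff_divide_distrib[symmetric] algebra_simps)

lemma T_scale: "T1 (\<lambda>t. c *s f t) = (\<lambda>t. c * T1 f t)" "T2 (\<lambda>t. c *s f t) = (\<lambda>t. c * T2 f t)"
  by (auto simp: T1_def T2_def fun_eq_iff algebra_simps)

lemma borel_measurable_scale:
  fixes f :: "complex \<Rightarrow> complex^2"
  assumes "f \<in> borel_measurable M" shows "(\<lambda>t. c *s f t) \<in> borel_measurable M"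
proof -
  have "c *s v = vector [c * v $ 1, c * v $ 2]" for v :: "complex^2"
    by (simp add: vec_eq_iff forall_2)
  then show ?thesis
    using borel_measurable_component[OF assms] by (simp add: borel_measurable_vector_2)
qed

sublocale semi_inner "\<lambda>c f t. c *s f t" "LR R" "LR_inner R"
proof -
  interpret vector_space "\<lambda>c f t. c *s f t :: complex^2"
    by unfold_locales (auto simp: fun_eq_iff vec_eq_iff algebra_simps)
  show "semi_inner (\<lambda>c f t. c *s f t) (LR R) (LR_inner R)"
  proof unfold_locales
    have "0 \<in> LR R"
      using L2.V_closed(1) by (simp add: LR_iff T1_def[abs_def] T2_def[abs_def] zero_fun_def)
    moreover have "f + g \<in> LR R" if "f \<in> LR R" "g \<in> LR R" for f g
    proof -
      have "f + g \<in> borel_measurable circle" using that by (auto simp: LR_iff plus_fun_def)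
      then show ?thesis using that by (simp add: LR_iff T_add L2.V_closed(2))
    qed
    moreover have "(\<lambda>t. c *s f t) \<in> LR R" if "f \<in> LR R" for c f
      using that by (simp add: LR_iff T_scale L2_cmult borel_measurable_scale)
    ultimately show sub: "subspace (LR R)"
      unfolding subspace_def by blast
    fix f g h :: "complex \<Rightarrow> complex^2" and c
    show "LR_inner R (f + g) h = LR_inner R f h + LR_inner R g h"
      if "f \<in> LR R" "g \<in> LR R" "h \<in> LR R"
    proof -
      have "f + g \<in> LR R" using sub that by (auto simp: subspace_def)
      moreover have "T1 f \<in> L2" "T2 f \<in> L2" "T1 g \<in> L2" "T2 g \<in> L2" "T1 h \<in> L2" "T2 h \<in> L2"
        using that by (simp_all add: LR_iff)
      ultimately show ?thesis using that by (simp add: LR_inner_T T_add L2.ip_add_left del: plus_fun_apply)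
    qed
    show "LR_inner R (\<lambda>t. c *s f t) g = c * LR_inner R f g" if "f \<in> LR R" "g \<in> LR R"
    proof -
      have "(\<lambda>t. c *s f t) \<in> LR R" using sub that by (auto simp: subspace_def)
      then show ?thesis using that by (simp add: LR_inner_T T_scale mult.assoc distrib_left)
    qed
    show "LR_inner R g f = cnj (LR_inner R f g)" if "f \<in> LR R" "g \<in> LR R"
    proof -
      have "T1 f \<in> L2" "T2 f \<in> L2" "T1 g \<in> L2" "T2 g \<in> L2" using that by (simp_all add: LR_iff)
      then show ?thesis
        using that L2.ip_commute[of "T1 f" "T1 g"] L2.ip_commute[of "T2 f" "T2 g"]
        by (simp only: LR_inner_T complex_cnj_add)
    qed
    show "0 \<le> Re (LR_inner R f f)" if "f \<in> LR R"
    proof -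
      have f: "T1 f \<in> L2" "T2 f \<in> L2" using that by (simp_all add: LR_iff)
      show ?thesis
        unfolding LR_inner_T[OF that that] plus_complex.sel
        using L2.ip_ge_0[OF f(1)] L2.ip_ge_0[OF f(2)] by (rule add_nonneg_nonneg)
    qed
  qed
qed

lemma LR_norm_nrm: "LR_norm R f = nrm f"
  by (simp add: LR_norm_def nrm_def)

lemma nrm_T:
  assumes "f \<in> LR R"
  shows "nrm f = sqrt ((L2.nrm (T1 f))\<^sup>2 + (L2.nrm (T2 f))\<^sup>2)"
proof -
  have "T1 f \<in> L2" "T2 f \<in> L2" using assms by (simp_all add: LR_iff)
  then show ?thesis using assms by (simp add: nrm_def LR_inner_T L2.nrm_power2)
qed

sublocale semi_hilbert "\<lambda>c f t. c *s f t" "LR R" "LR_inner R"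
proof unfold_locales
  fix F :: "nat \<Rightarrow> complex \<Rightarrow> complex^2"
  assume F: "\<And>k. F k \<in> LR R"
    and cauchy: "\<And>\<epsilon>. \<epsilon> > 0 \<Longrightarrow> \<exists>N. \<forall>j\<ge>N. \<forall>k\<ge>N. nrm (F j - F k) < \<epsilon>"
  have TL: "T1 (F k) \<in> L2" "T2 (F k) \<in> L2" for k using F[of k] by (simp_all add: LR_iff)
  have le: "L2.nrm (T1 f) \<le> nrm f" "L2.nrm (T2 f) \<le> nrm f" if "f \<in> LR R" for f
    unfolding nrm_T[OF that] by (rule real_le_rsqrt, simp)+
  have "\<exists>N. \<forall>j\<ge>N. \<forall>k\<ge>N. L2.nrm (T1 (F j) - T1 (F k)) < \<epsilon>" if "\<epsilon> > 0" for \<epsilon>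
    using cauchy[OF that] le(1)[OF V_closed(3)[OF F F]] unfolding T_diff by (meson le_less_trans)
  then obtain g1 where g1: "g1 \<in> L2" "(\<lambda>k. L2.nrm (T1 (F k) - g1)) \<longlonglongrightarrow> 0"
    using L2.complete[of "\<lambda>k. T1 (F k)"] TL by blast
  have "\<exists>N. \<forall>j\<ge>N. \<forall>k\<ge>N. L2.nrm (T2 (F j) - T2 (F k)) < \<epsilon>" if "\<epsilon> > 0" for \<epsilon>
    using cauchy[OF that] le(2)[OF V_closed(3)[OF F F]] unfolding T_diff by (meson le_less_trans)
  then obtain g2 where g2: "g2 \<in> L2" "(\<lambda>k. L2.nrm (T2 (F k) - g2)) \<longlonglongrightarrow> 0"
    using L2.complete[of "\<lambda>k. T2 (F k)"] TL by blast
  \<comment> \<open>The inverse of the map \<open>f \<mapsto> (T1 f, T2 f)\<close>, applied to the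
    two limits in \<open>L2\<close>. It recovers \<open>g2\<close> where \<open>|R| < 1\<close>,
    hence almost everywhere.\<close>
  define f :: "complex \<Rightarrow> complex^2" where
    "f t = vector [g1 t, of_real (sqrt (1 - (cmod (R t))\<^sup>2)) * g2 t + R t * g1 t]" for t
  have [measurable]: "g1 \<in> borel_measurable circle" "g2 \<in> borel_measurable circle"
    using g1 g2 by (auto simp: L2_def)
  have fm: "f \<in> borel_measurable circle"
    unfolding f_def by (intro borel_measurable_vector_2) measurable
  have T1f: "T1 f = g1" by (simp add: T1_def f_def fun_eq_iff)
  have T2f: "AE t in circle. g2 t = T2 f t"
    using R_less_1
  proof eventually_elim
    case (elim t)
    then have "(cmod (R t))\<^sup>2 < 1" by (simp add: power_less_one_iff abs_square_less_1)
    then show ?case by (simp add: T2_def f_def)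
  qed
  have "T2 f \<in> L2"
  proof -
    have "AE t in circle. (cmod (g2 t))\<^sup>2 = (cmod (T2 f t))\<^sup>2" using T2f by eventually_elim simp
    then have "integrable circle (\<lambda>t. (cmod (T2 f t))\<^sup>2)"
      using L2_square_integrable[OF g2(1)] T_measurable(2)[OF fm]
      by (subst integrable_cong_AE[where g = "\<lambda>t. (cmod (g2 t))\<^sup>2"]) (auto elim!: eventually_mono)
    then show ?thesis using T_measurable(2)[OF fm] by (simp add: L2_def)
  qed
  then have f: "f \<in> LR R" using fm g1 by (simp add: LR_iff T1f)
  have eq: "L2.nrm (T2 (F k) - T2 f) = L2.nrm (T2 (F k) - g2)" for k
  proof -
    have "(LINT t|circle. (cmod ((T2 (F k) - T2 f) t))\<^sup>2) = (LINT t|circle. (cmod ((T2 (F k) - g2) t))\<^sup>2)"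
      using L2_measurable[OF TL(2)[of k]] T_measurable(2)[OF fm] T2f
      by (intro integral_cong_AE) (auto elim!: eventually_mono)
    then show ?thesis by (simp only: L2_nrm)
  qed
  have "(\<lambda>k. nrm (F k - f)) \<longlonglongrightarrow> 0"
  proof (rule tendsto_sandwich[OF _ _ tendsto_const])
    show "eventually (\<lambda>k. 0 \<le> nrm (F k - f)) sequentially" using F f by simp
    have "nrm (F k - f) \<le> L2.nrm (T1 (F k) - g1) + L2.nrm (T2 (F k) - g2)" for k
    proof -
      have "nrm (F k - f) = sqrt ((L2.nrm (T1 (F k) - g1))\<^sup>2 + (L2.nrm (T2 (F k) - g2))\<^sup>2)"
        using nrm_T[of "F k - f"] F f by (simp only: T_diff eq T1f V_closed)
      also have "\<dots> \<le> L2.nrm (T1 (F k) - g1) + L2.nrm (T2 (F k) - g2)"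
        using TL g1 g2 by (intro sqrt_sum_squares_le_sum L2.nrm_ge_0 L2.V_closed)
      finally show ?thesis .
    qed
    then show "eventually (\<lambda>k. nrm (F k - f) \<le> L2.nrm (T1 (F k) - g1) + L2.nrm (T2 (F k) - g2)) sequentially"
      by simp
    show "(\<lambda>k. L2.nrm (T1 (F k) - g1) + L2.nrm (T2 (F k) - g2)) \<longlonglongrightarrow> 0"
      using tendsto_add[OF g1(2) g2(2)] by simp
  qed
  with f show "\<exists>f\<in>LR R. (\<lambda>k. nrm (F k - f)) \<longlonglongrightarrow> 0" by blast
qed

definition lift :: "(complex \<Rightarrow> complex) \<Rightarrow> (complex \<Rightarrow> complex) \<Rightarrow> complex \<Rightarrow> complex^2" where
  "lift x y = (\<lambda>t. W R t *v vector [x t, y t])"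

lemma lift_add: "lift x y + lift x' y' = lift (\<lambda>t. x t + x' t) (\<lambda>t. y t + y' t)"
  by (auto simp: lift_def W_mult_vec fun_eq_iff vec_eq_iff forall_2 algebra_simps)

lemma lift_diff: "lift x y - lift x' y' = lift (\<lambda>t. x t - x' t) (\<lambda>t. y t - y' t)"
  by (auto simp: lift_def W_mult_vec fun_eq_iff vec_eq_iff forall_2 algebra_simps)

lemma lift_scale: "(\<lambda>t. c *s lift x y t) = lift (\<lambda>t. c * x t) (\<lambda>t. c * y t)"
  by (auto simp: lift_def W_mult_vec fun_eq_iff vec_eq_iff forall_2 algebra_simps)

lemma T1_lift: "T1 (lift x y) = (\<lambda>t. x t + cnj (R t) * y t)"
  by (simp add: T1_def lift_def W_mult_vec fun_eq_iff)

lemma T2_lift: "AE t in circle. T2 (lift x y) t = of_real (sqrt (1 - (cmod (R t))\<^sup>2)) * y t"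
  using R_less_1
proof eventually_elim
  case (elim t)
  define s where "s = sqrt (1 - (cmod (R t))\<^sup>2)"
  have "(cmod (R t))\<^sup>2 < 1" using elim by (simp add: power_less_one_iff abs_square_less_1)
  then have s: "s > 0" "s\<^sup>2 = 1 - (cmod (R t))\<^sup>2" by (simp_all add: s_def)
  have "lift x y t $ 2 - R t * lift x y t $ 1 = (1 - R t * cnj (R t)) * y t"
    by (simp add: lift_def W_mult_vec algebra_simps)
  also have "1 - R t * cnj (R t) = complex_of_real (s\<^sup>2)"
    unfolding s(2) of_real_diff complex_norm_square by simp
  finally show ?case
    using s(1) unfolding T2_def s_def[symmetric] by (simp add: power2_eq_square)
qed

text \<open>\<open>T1\<close> and \<open>T2\<close> send \<open>W (x, y)\<close> to
  \<open>x + cnj R y\<close> and, almost everywhere, \<open>sqrt (1 - |R|^2) y\<close>; their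
  squared moduli are the two summands of \<open>W_form\<close>.\<close>

lemma lift_LR:
  assumes x: "x \<in> L2" and y: "y \<in> L2"
  shows "lift x y \<in> LR R" and "nrm (lift x y) = sqrt (LINT t|circle. W_form (R t) (x t) (y t))"
proof -
  have [measurable]: "x \<in> borel_measurable circle" "y \<in> borel_measurable circle"
    using x y by (auto simp: L2_def)
  have m: "lift x y \<in> borel_measurable circle"
    unfolding lift_def W_mult_vec by (intro borel_measurable_vector_2) measurable
  note Wf = W_form_integral[OF x y]
  have ae: "AE t in circle. (cmod (T2 (lift x y) t))\<^sup>2 = (1 - (cmod (R t))\<^sup>2) * (cmod (y t))\<^sup>2"
    using T2_lift[of x y] R_less_1
  proof eventually_elim
    case (elim t)
    then have "(cmod (R t))\<^sup>2 < 1" by (simp add: power_less_one_iff abs_square_less_1)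
    then show ?case using elim(1) by (simp add: norm_mult power_mult_distrib)
  qed
  have Tm: "(\<lambda>t. (cmod (T2 (lift x y) t))\<^sup>2) \<in> borel_measurable circle"
    using T_measurable(2)[OF m] by measurable
  have Wm: "(\<lambda>t. (1 - (cmod (R t))\<^sup>2) * (cmod (y t))\<^sup>2) \<in> borel_measurable circle" by measurable
  have "integrable circle (\<lambda>t. (cmod (T2 (lift x y) t))\<^sup>2)"
    using integrable_cong_AE[OF Tm Wm ae] Wf(2) by blast
  then have "T2 (lift x y) \<in> L2" using T_measurable(2)[OF m] by (simp add: L2_def)
  then show LR: "lift x y \<in> LR R" using m Wf(3) by (simp add: LR_iff T1_lift)
  have "(L2.nrm (T1 (lift x y)))\<^sup>2 + (L2.nrm (T2 (lift x y)))\<^sup>2 = (LINT t|circle. W_form (R t) (x t) (y t))"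
    using Wf(1) integral_cong_AE[OF Tm Wm ae]
    by (simp add: L2_nrm_power2 T1_lift)
  then show "nrm (lift x y) = sqrt (LINT t|circle. W_form (R t) (x t) (y t))"
    using nrm_T[OF LR] by simp
qed

end

section \<open>Unit vectors and their limits\<close>

lemma H2_plus_add: "\<lbrakk>f \<in> H2_plus; g \<in> H2_plus\<rbrakk> \<Longrightarrow> (\<lambda>t. f t + g t) \<in> H2_plus"
proof -
  assume f: "f \<in> H2_plus" and g: "g \<in> H2_plus"
  have i: "integrable circle (\<lambda>t. h t * cnj t powi j)" if "h \<in> L2" for h j
  proof (rule Bochner_Integration.integrable_bound[OF L2_integrable[OF that]])
    show "(\<lambda>t. h t * cnj t powi j) \<in> borel_measurable circle"
      using that by (intro borel_measurable_times L2_measurable continuous_on_circle_measurable continuous_intros) auto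
    show "AE t in circle. cmod (h t * cnj t powi j) \<le> cmod (h t)"
      using AE_circle_norm by eventually_elim (simp add: norm_mult norm_power_int)
  qed
  have "fourier_coeff (\<lambda>t. f t + g t) j = fourier_coeff f j + fourier_coeff g j" for j
    unfolding fourier_coeff_def distrib_right
    by (intro Bochner_Integration.integral_add i H2_plus_L2 f g)
  then show ?thesis using f g by (simp add: H2_plus_def L2_add)
qed

lemma H2_plus_scale: "f \<in> H2_plus \<Longrightarrow> (\<lambda>t. c * f t) \<in> H2_plus"
  by (simp add: H2_plus_def L2_cmult fourier_coeff_def mult.assoc)

lemma H2_minus_L2: "g \<in> H2_minus \<Longrightarrow> g \<in> L2"
  by (simp add: H2_minus_def)

lemma H2_minus_orthogonal:
  "\<lbrakk>g \<in> H2_minus; h \<in> H2_plus\<rbrakk> \<Longrightarrow> (LINT t|circle. g t * cnj (h t)) = 0"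
  by (simp add: H2_minus_def)

lemma H2_minus_add: "\<lbrakk>f \<in> H2_minus; g \<in> H2_minus\<rbrakk> \<Longrightarrow> (\<lambda>t. f t + g t) \<in> H2_minus"
  by (simp add: H2_minus_def L2_add distrib_right L2_mult_cnj_integrable H2_plus_L2)

lemma H2_minus_scale: "f \<in> H2_minus \<Longrightarrow> (\<lambda>t. c * f t) \<in> H2_minus"
  by (simp add: H2_minus_def L2_cmult mult.assoc)

lemma shift_H2_plus: "f \<in> H2_plus \<Longrightarrow> (\<lambda>t. c + t * f t) \<in> H2_plus"
  using H2_plus_add[OF const_H2_plus[of c] power_mult_H2_plus[of f 1]] by simp

lemma mult_cnj_on_circle:
  assumes "cmod t = 1" shows "t * cnj t = 1" "cnj t * t = 1"
  using assms by (simp_all add: complex_norm_square[symmetric] mult.commute)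

text \<open>Subtracting the mean clears the one coefficient that multiplication by
  \<open>cnj t\<close> would move to index -1.\<close>

lemma backward_shift_H2_plus:
  assumes h: "h \<in> H2_plus"
  shows "(\<lambda>t. cnj t * (h t - (LINT s|circle. h s))) \<in> H2_plus"
proof -
  define c where "c = (LINT s|circle. h s)"
  define k where "k t = h t - c" for t
  have k: "k \<in> H2_plus"
    using H2_plus_add[OF h const_H2_plus[of "- c"]] by (simp add: k_def[abs_def])
  have k0: "(LINT t|circle. k t) = 0"
    using L2_integrable[OF H2_plus_L2[OF h]] by (simp add: k_def c_def)
  have kL: "(\<lambda>t. cnj t * k t) \<in> L2"
    using L2_cnj[OF id_mult_L2[OF L2_cnj[OF H2_plus_L2[OF k]]]] by simp
  have "fourier_coeff (\<lambda>t. cnj t * k t) j = 0" if j: "j < 0" for j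
  proof -
    have "fourier_coeff (\<lambda>t. cnj t * k t) j = fourier_coeff k (j + 1)"
      unfolding fourier_coeff_def
    proof (intro Bochner_Integration.integral_cong refl)
      fix t assume "t \<in> space circle"
      then have "cnj t \<noteq> 0" by auto
      then show "cnj t * k t * cnj t powi j = k t * cnj t powi (j + 1)"
        by (simp add: power_int_add_1)
    qed
    also have "\<dots> = 0"
    proof (cases "j = -1")
      case True then show ?thesis using k0 by (simp add: fourier_coeff_def)
    next
      case False then show ?thesis using k j by (simp add: H2_plus_def)
    qed
    finally show ?thesis .
  qed
  then show ?thesis using kL by (simp add: H2_plus_def k_def c_def)
qed

text \<open>\<open>c\<close> is the coefficient of \<open>cnj t\<close> in \<open>g\<close>, which
  multiplication by \<open>t\<close> would move to the constants. As \<open>H2_minus\<close> is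
  given by orthogonality, the shift is transferred to the test function: on the circle
  \<open>h = d + t k\<close> with \<open>k\<close> the backward shift of \<open>h\<close>, so
  \<open>g\<close> is paired with \<open>k\<close> in \<open>H2_plus\<close>, and the two products
  of \<open>c\<close> and \<open>cnj d\<close> cancel.\<close>

lemma forward_shift_H2_minus:
  assumes g: "g \<in> H2_minus"
  shows "(\<lambda>t. t * g t - (LINT s|circle. s * g s)) \<in> H2_minus"
proof -
  define c where "c = (LINT s|circle. s * g s)"
  have gL: "g \<in> L2" "(\<lambda>t. t * g t) \<in> L2" using g by (auto intro: id_mult_L2 H2_minus_L2)
  have L: "(\<lambda>t. t * g t - c) \<in> L2"
    using L2_add[OF gL(2) L2_continuous[of "\<lambda>t. - c"]] by simp
  have "(LINT t|circle. (t * g t - c) * cnj (h t)) = 0" if h: "h \<in> H2_plus" for h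
  proof -
    define d where "d = (LINT s|circle. h s)"
    define k where "k t = cnj t * (h t - d)" for t
    have k: "k \<in> H2_plus" unfolding k_def d_def by (rule backward_shift_H2_plus[OF h])
    have i1: "integrable circle (\<lambda>t. cnj d * (t * g t))" using L2_integrable[OF gL(2)] by simp
    have i2: "integrable circle (\<lambda>t. g t * cnj (k t))"
      by (intro L2_mult_cnj_integrable gL H2_plus_L2 k)
    have i3: "integrable circle (\<lambda>t. c * cnj (h t))"
      using L2_integrable[OF L2_cnj[OF H2_plus_L2[OF h]]] by simp
    have "(LINT t|circle. (t * g t - c) * cnj (h t)) =
        (LINT t|circle. cnj d * (t * g t) + g t * cnj (k t) - c * cnj (h t))"
    proof (intro Bochner_Integration.integral_cong refl)
      fix t assume "t \<in> space circle"
      then have "cmod t = 1" by simp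
      then have "cnj d * (t * g t) + g t * cnj (k t) = t * g t * cnj (h t)"
        by (simp add: k_def algebra_simps)
      then show "(t * g t - c) * cnj (h t) = cnj d * (t * g t) + g t * cnj (k t) - c * cnj (h t)"
        by (simp add: left_diff_distrib)
    qed
    also have "\<dots> = cnj d * c + (LINT t|circle. g t * cnj (k t)) - c * cnj d"
      using i1 i2 i3 by (simp add: c_def d_def)
    also have "\<dots> = 0" using g k by (simp add: H2_minus_def)
    finally show ?thesis .
  qed
  then show ?thesis using L by (simp add: H2_minus_def c_def)
qed

text \<open>The factor \<open>cnj t\<close> moves to the test function as \<open>t h\<close>, which
  lies in \<open>H2_plus\<close> and has mean 0; the first fact removes \<open>g\<close>, the second
  the constant \<open>c\<close>.\<close>

lemma backward_shift_H2_minus: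
  assumes g: "g \<in> H2_minus"
  shows "(\<lambda>t. cnj t * (c + g t)) \<in> H2_minus"
proof -
  have gL: "g \<in> L2" using g by (rule H2_minus_L2)
  have cg: "(\<lambda>t. c + g t) \<in> L2" using L2_add[OF L2_continuous[of "\<lambda>t. c"] gL] by simp
  then have L: "(\<lambda>t. cnj t * (c + g t)) \<in> L2"
    using L2_cnj[OF id_mult_L2[OF L2_cnj]] by fastforce
  have "(LINT t|circle. cnj t * (c + g t) * cnj (h t)) = 0" if h: "h \<in> H2_plus" for h
  proof -
    have k: "(\<lambda>t. t * h t) \<in> H2_plus" using shift_H2_plus[OF h, of 0] by simp
    have "(LINT t|circle. cnj t * (c + g t) * cnj (h t)) =
        (LINT t|circle. c * cnj (t * h t) + g t * cnj (t * h t))"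
      by (simp add: algebra_simps)
    also have "\<dots> = c * cnj (LINT t|circle. t * h t) + (LINT t|circle. g t * cnj (t * h t))"
      using L2_integrable[OF L2_cnj[OF H2_plus_L2[OF k]]] L2_mult_cnj_integrable[OF gL H2_plus_L2[OF k]]
      by (subst Bochner_Integration.integral_add)
        (auto simp only: integrable_mult_right integral_mult_right_zero Bochner_Integration.integral_cnj)
    also have "\<dots> = 0"
    proof -
      have "(LINT t|circle. g t * cnj (t * h t)) = 0" by (rule H2_minus_orthogonal[OF g k])
      then show ?thesis using integral_power_H2_plus[OF h, of 1] by simp
    qed
    finally show ?thesis .
  qed
  then show ?thesis using L by (simp add: H2_minus_def)
qed

lemma W_form_unimodular:
  assumes "cmod z = 1" shows "W_form r (z * x) (z * y) = W_form r x y"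
proof -
  have "z * x + cnj r * (z * y) = z * (x + cnj r * y)" by (simp add: algebra_simps)
  then show ?thesis using assms by (simp add: W_form_def norm_mult)
qed

text \<open>The mixed term \<open>2 Re (r x cnj y)\<close> is invariant under exchanging
  \<open>x\<close> and \<open>y\<close> with conjugation. This symmetry carries the distance problem
  of the second family of unit vectors to that of the first.\<close>

lemma W_form_reflect: "W_form r (cnj y) (cnj x) = W_form r x y"
proof -
  have eq: "W_form r x y = (cmod x)\<^sup>2 + (cmod y)\<^sup>2 + 2 * Re (r * x * cnj y)" for x y
    unfolding W_form_def cmod_power2 by (simp add: power2_eq_square algebra_simps)
  show ?thesis unfolding eq by (simp only: complex_mod_cnj complex_cnj_cnj mult_ac add_ac)
qed

section \<open>The generating subspaces and their unit vectors\<close>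

context reflection
begin

definition pre_H :: "int \<Rightarrow> int \<Rightarrow> (complex \<Rightarrow> complex^2) set" where
  "pre_H n m = {lift (\<lambda>t. t powi n * hp t) (\<lambda>t. cnj t powi m * hm t) | hp hm. hp \<in> H2_plus \<and> hm \<in> H2_minus}"

lemma pre_HI:
  "\<lbrakk>hp \<in> H2_plus; hm \<in> H2_minus\<rbrakk> \<Longrightarrow> lift (\<lambda>t. t powi n * hp t) (\<lambda>t. cnj t powi m * hm t) \<in> pre_H n m"
  unfolding pre_H_def by blast

lemma H_check_pre_H: "H_check R n m = LR_closure R (pre_H n m)"
  by (simp add: H_check_def pre_H_def lift_def)

lemma lift_combine:
  assumes "x t = c * x0 t + x1 t" "y t = c * y0 t + y1 t"
  shows "lift x y t = c *s lift x0 y0 t + lift x1 y1 t"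
  using assms by (simp add: lift_def W_mult_vec vec_eq_iff forall_2 algebra_simps)

lemma powi_L2:
  assumes "f \<in> L2" shows "(\<lambda>t. t powi n * f t) \<in> L2" "(\<lambda>t. cnj t powi n * f t) \<in> L2"
proof -
  have "AE t in circle. cmod (t powi n) \<le> 1" "AE t in circle. cmod (cnj t powi n) \<le> 1"
    using AE_circle_norm by (auto elim!: eventually_mono simp: norm_power_int)
  then show "(\<lambda>t. t powi n * f t) \<in> L2" "(\<lambda>t. cnj t powi n * f t) \<in> L2"
    by (auto intro!: L2_mult_bounded[OF assms, where B = 1] continuous_on_circle_measurable continuous_intros)
qed

lemma pre_H_subspace: "subspace (pre_H n m)" "pre_H n m \<subseteq> LR R"
proof -
  show "pre_H n m \<subseteq> LR R"
    by (auto simp: pre_H_def intro!: lift_LR(1)[OF powi_L2(1)[OF H2_plus_L2] powi_L2(2)[OF H2_minus_L2]])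
  show "subspace (pre_H n m)"
    unfolding subspace_def
  proof (intro conjI ballI allI)
    have "0 = lift (\<lambda>t. t powi n * 0) (\<lambda>t. cnj t powi m * 0)"
      by (auto simp: lift_def W_mult_vec fun_eq_iff vec_eq_iff forall_2)
    then show "0 \<in> pre_H n m"
      using const_H2_plus[of 0] H2_minus_scale[of _ 0]
      by (auto simp: pre_H_def H2_minus_def intro!: exI[of _ "\<lambda>t. 0"] L2_continuous)
    fix f c assume f: "f \<in> pre_H n m"
    then obtain hp hm where 1: "f = lift (\<lambda>t. t powi n * hp t) (\<lambda>t. cnj t powi m * hm t)"
      "hp \<in> H2_plus" "hm \<in> H2_minus" by (auto simp: pre_H_def)
    have "(\<lambda>t. c *s f t) = lift (\<lambda>t. t powi n * (c * hp t)) (\<lambda>t. cnj t powi m * (c * hm t))"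
      unfolding 1 lift_scale by (simp add: mult_ac)
    then show "(\<lambda>t. c *s f t) \<in> pre_H n m"
      using pre_HI[OF H2_plus_scale[OF 1(2)] H2_minus_scale[OF 1(3)]] by (simp only:)
    fix g assume "g \<in> pre_H n m"
    then obtain hp' hm' where 2: "g = lift (\<lambda>t. t powi n * hp' t) (\<lambda>t. cnj t powi m * hm' t)"
      "hp' \<in> H2_plus" "hm' \<in> H2_minus" by (auto simp: pre_H_def)
    have "f + g = lift (\<lambda>t. t powi n * (hp t + hp' t)) (\<lambda>t. cnj t powi m * (hm t + hm' t))"
      unfolding 1 2 lift_add by (simp add: distrib_left)
    then show "f + g \<in> pre_H n m"
      using pre_HI[OF H2_plus_add[OF 1(2) 2(2)] H2_minus_add[OF 1(3) 2(3)]] by (simp only:)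
  qed
qed

lemma e_plus_lift: "e_plus R n = lift (\<lambda>t. t powi n) (\<lambda>t. 0)"
  by (simp add: e_plus_def lift_def W_mult_vec fun_eq_iff)

lemma e_minus_lift: "e_minus R m = lift (\<lambda>t. 0) (\<lambda>t. cnj t powi (m + 1))"
  by (simp add: e_minus_def lift_def W_mult_vec fun_eq_iff)

lemma powi_const_L2: "(\<lambda>t. t powi n) \<in> L2" "(\<lambda>t. cnj t powi n) \<in> L2"
  using powi_L2[OF L2_continuous[of "\<lambda>t. 1"], of n] by auto

lemma zero_L2: "(\<lambda>t. 0) \<in> L2" by (rule L2_continuous) simp

lemma e_plus_LR: "e_plus R n \<in> LR R" and nrm_e_plus: "nrm (e_plus R n) = 1"
proof -
  show "e_plus R n \<in> LR R" unfolding e_plus_lift by (intro lift_LR powi_const_L2 zero_L2)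
  have "(LINT t|circle. W_form (R t) (t powi n) 0) = (LINT t|circle. 1)"
    by (intro Bochner_Integration.integral_cong refl) (simp add: W_form_def norm_power_int)
  then show "nrm (e_plus R n) = 1" unfolding e_plus_lift by (subst lift_LR) (auto intro: powi_const_L2 zero_L2)
qed

lemma e_minus_LR: "e_minus R m \<in> LR R" and nrm_e_minus: "nrm (e_minus R m) = 1"
proof -
  show "e_minus R m \<in> LR R" unfolding e_minus_lift by (intro lift_LR powi_const_L2 zero_L2)
  have "(LINT t|circle. W_form (R t) 0 (cnj t powi (m + 1))) = (LINT t|circle. 1)"
    by (intro Bochner_Integration.integral_cong refl) (simp add: W_form_def norm_power_int norm_mult power_mult_distrib)
  then show "nrm (e_minus R m) = 1" unfolding e_minus_lift by (subst lift_LR) (auto intro: powi_const_L2 zero_L2)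
qed

text \<open>Shift identities such as \<open>t * cnj t = 1\<close> hold on the circle only, so
  equality there must suffice for norms.\<close>

lemma nrm_cong:
  assumes "\<And>t. t \<in> sphere 0 1 \<Longrightarrow> f t = g t" shows "nrm f = nrm g"
proof -
  have "LR_inner R f f = LR_inner R g g"
    unfolding LR_inner_def LR_form_def using assms
    by (intro Bochner_Integration.integral_cong refl) simp
  then show ?thesis by (simp add: nrm_def)
qed

lemma LR_closure_iff: "f \<in> LR_closure R S \<longleftrightarrow> f \<in> LR R \<and> (\<forall>\<epsilon>>0. \<exists>s\<in>S. nrm (f - s) < \<epsilon>)"
  by (simp add: LR_closure_def LR_norm_nrm fun_diff_def)

text \<open>Orthogonality passes to the closure by continuity of the form, so \<open>S\<close>
  itself can replace \<open>LR_closure R S\<close> in the orthogonality conditions of the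
  definitions.\<close>

lemma closure_orthogonal:
  assumes K: "K \<in> LR R" and S: "S \<subseteq> LR R"
  shows "(\<forall>g\<in>LR_closure R S. LR_inner R K g = 0) \<longleftrightarrow> (\<forall>s\<in>S. LR_inner R K s = 0)"
proof safe
  fix s assume orth: "\<forall>g\<in>LR_closure R S. LR_inner R K g = 0" and s: "s \<in> S"
  have sL: "s \<in> LR R" using s S by blast
  have "nrm (s - s) = 0"
    using ip_diff_left[OF sL sL V_closed(1)] by (simp add: nrm_def)
  then have "s \<in> LR_closure R S"
    unfolding LR_closure_iff using s sL by (intro conjI allI impI bexI[of _ s]) simp_all
  then show "LR_inner R K s = 0" using orth by blast
next
  fix g assume orth: "\<forall>s\<in>S. LR_inner R K s = 0" and g: "g \<in> LR_closure R S"
  have gL: "g \<in> LR R" using g by (simp add: LR_closure_iff)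
  have "cmod (LR_inner R K g) \<le> \<epsilon>" if \<epsilon>: "\<epsilon> > 0" for \<epsilon>
  proof -
    have p: "0 < \<epsilon> / (nrm K + 1)" using \<epsilon> nrm_ge_0[OF K] by simp
    then obtain s where s: "s \<in> S" "nrm (g - s) < \<epsilon> / (nrm K + 1)"
      using g unfolding LR_closure_iff by blast
    have sL: "s \<in> LR R" using s S by blast
    have "LR_inner R K g = LR_inner R K (g - s)"
      using orth s(1) ip_diff_right[OF gL sL K] by simp
    then have "cmod (LR_inner R K g) \<le> nrm K * nrm (g - s)"
      using Cauchy_Schwarz[OF K, of "g - s"] gL sL by simp
    also have "\<dots> \<le> nrm K * (\<epsilon> / (nrm K + 1))"
      using s(2) nrm_ge_0[OF K] by (intro mult_left_mono) auto
    also have "\<dots> \<le> \<epsilon>" using \<epsilon> nrm_ge_0[OF K] by (simp add: field_simps)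
    finally show ?thesis .
  qed
  then have "cmod (LR_inner R K g) \<le> 0" by (rule field_le_epsilon[of _ 0, simplified])
  then show "LR_inner R K g = 0" by simp
qed

text \<open>The two sides of the decomposition below agree on the circle only, not as functions.\<close>

lemma innovation_iff:
  assumes S: "S \<subseteq> LR R" and e: "e \<in> LR R"
    and split: "\<And>w. w \<in> S0 \<Longrightarrow> \<exists>c. \<exists>s\<in>S. \<forall>t\<in>sphere 0 1. w t = c *s e t + s t"
    and join: "\<And>c s. s \<in> S \<Longrightarrow> \<exists>w\<in>S0. \<forall>t\<in>sphere 0 1. w t = c *s e t + s t"
  shows "K \<in> LR_closure R S0 \<and> (\<forall>g\<in>LR_closure R S. LR_inner R K g = 0) \<and> LR_norm R K = 1 \<and>
      (\<exists>r>0. LR_inner R e K = complex_of_real r) \<longleftrightarrow> is_innovation S e K"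
proof -
  have eq: "nrm (K - w) = nrm (K - ((\<lambda>t. c *s e t) + s))"
    if "\<forall>t\<in>sphere 0 1. w t = c *s e t + s t" for w c s
    using that by (intro nrm_cong) simp
  have "K \<in> LR_closure R S0 \<longleftrightarrow>
      K \<in> LR R \<and> (\<forall>\<epsilon>>0. \<exists>c. \<exists>s\<in>S. nrm (K - ((\<lambda>t. c *s e t) + s)) < \<epsilon>)"
    unfolding LR_closure_iff
  proof safe
    fix \<epsilon> :: real assume "0 < \<epsilon>" "\<forall>\<epsilon>>0. \<exists>w\<in>S0. nrm (K - w) < \<epsilon>"
    then obtain w where w: "w \<in> S0" "nrm (K - w) < \<epsilon>" by blast
    then show "\<exists>c. \<exists>s\<in>S. nrm (K - ((\<lambda>t. c *s e t) + s)) < \<epsilon>"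
      using split[OF w(1)] eq by metis
  next
    fix \<epsilon> :: real assume "0 < \<epsilon>" "\<forall>\<epsilon>>0. \<exists>c. \<exists>s\<in>S. nrm (K - ((\<lambda>t. c *s e t) + s)) < \<epsilon>"
    then obtain c s where s: "s \<in> S" "nrm (K - ((\<lambda>t. c *s e t) + s)) < \<epsilon>" by blast
    then show "\<exists>w\<in>S0. nrm (K - w) < \<epsilon>"
      using join[OF s(1), of c] eq by metis
  qed
  then show ?thesis
    unfolding is_innovation_def using closure_orthogonal[OF _ S, of K] by (auto simp: LR_norm_nrm)
qed

text \<open>Splitting a function of \<open>H2_plus\<close> into its mean and \<open>t\<close> times
  its backward shift decomposes \<open>pre_H n m\<close> into multiples of \<open>e_plus R n\<close>
  plus elements of \<open>pre_H (n + 1) m\<close>; this is the codimension-one step.\<close>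

lemma is_K_check_iff: "is_K_check R n m K \<longleftrightarrow> is_innovation (pre_H (n + 1) m) (e_plus R n) K"
  unfolding is_K_check_def H_check_pre_H
proof (rule innovation_iff[OF pre_H_subspace(2) e_plus_LR])
  fix w assume "w \<in> pre_H n m"
  then obtain hp hm where w: "w = lift (\<lambda>t. t powi n * hp t) (\<lambda>t. cnj t powi m * hm t)"
    "hp \<in> H2_plus" "hm \<in> H2_minus" by (auto simp: pre_H_def)
  define c where "c = (LINT s|circle. hp s)"
  let ?s = "lift (\<lambda>t. t powi (n + 1) * (cnj t * (hp t - c))) (\<lambda>t. cnj t powi m * hm t)"
  have "?s \<in> pre_H (n + 1) m"
    unfolding c_def by (rule pre_HI[OF backward_shift_H2_plus[OF w(2)] w(3)])
  moreover have "w t = c *s e_plus R n t + ?s t" if "t \<in> sphere 0 1" for t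
  proof -
    have t: "cmod t = 1" "t \<noteq> 0" using that by auto
    have "t powi (n + 1) * (cnj t * (hp t - c)) = t powi n * (t * cnj t) * (hp t - c)"
      using t(2) by (simp add: power_int_add_1)
    then have "t powi (n + 1) * (cnj t * (hp t - c)) = t powi n * hp t - c * t powi n"
      using mult_cnj_on_circle(1)[OF t(1)] by (simp add: algebra_simps)
    then show ?thesis
      unfolding w e_plus_lift by (intro lift_combine) simp_all
  qed
  ultimately show "\<exists>c. \<exists>s\<in>pre_H (n + 1) m. \<forall>t\<in>sphere 0 1. w t = c *s e_plus R n t + s t" by blast
next
  fix c s assume "s \<in> pre_H (n + 1) m"
  then obtain hp hm where s: "s = lift (\<lambda>t. t powi (n + 1) * hp t) (\<lambda>t. cnj t powi m * hm t)"
    "hp \<in> H2_plus" "hm \<in> H2_minus" by (auto simp: pre_H_def)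
  let ?w = "lift (\<lambda>t. t powi n * (c + t * hp t)) (\<lambda>t. cnj t powi m * hm t)"
  have "?w \<in> pre_H n m"
    by (rule pre_HI[OF shift_H2_plus[OF s(2)] s(3)])
  moreover have "?w t = c *s e_plus R n t + s t" if "t \<in> sphere 0 1" for t
  proof -
    have "t \<noteq> 0" using that by auto
    then have "t powi (n + 1) = t powi n * t" by (simp add: power_int_add_1)
    then have "t powi n * (c + t * hp t) = c * t powi n + t powi (n + 1) * hp t"
      by (simp only:) (simp add: algebra_simps)
    then show ?thesis
      unfolding s e_plus_lift by (intro lift_combine) simp_all
  qed
  ultimately show "\<exists>w\<in>pre_H n m. \<forall>t\<in>sphere 0 1. w t = c *s e_plus R n t + s t" by blast
qed

text \<open>The same decomposition on the other side: the constant split off is now the coefficient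
  of \<open>cnj t\<close> in the \<open>H2_minus\<close> function, which explains the exponent
  \<open>m + 1\<close> in \<open>e_minus\<close>.\<close>

lemma is_K_check_tilde_iff: "is_K_check_tilde R n m K \<longleftrightarrow> is_innovation (pre_H n (m + 1)) (e_minus R m) K"
proof -
  have "is_K_check_tilde R n m K \<longleftrightarrow> K \<in> LR_closure R (pre_H n m) \<and>
      (\<forall>g\<in>LR_closure R (pre_H n (m + 1)). LR_inner R K g = 0) \<and> LR_norm R K = 1 \<and>
      (\<exists>r>0. LR_inner R (e_minus R m) K = complex_of_real r)"
  proof -
    \<comment> \<open>The definition normalizes the inner product with \<open>K\<close> in the first
      place, an innovation has it in the second; for a real value the order is immaterial.\<close>
    have "LR_inner R K (e_minus R m) = complex_of_real r \<longleftrightarrow> LR_inner R (e_minus R m) K = complex_of_real r"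
      if "K \<in> LR_closure R (pre_H n m)" for r
    proof -
      have "K \<in> LR R" using that by (simp add: LR_closure_iff)
      then have "LR_inner R K (e_minus R m) = cnj (LR_inner R (e_minus R m) K)"
        using ip_commute[OF e_minus_LR] by simp
      then show ?thesis by (metis complex_cnj_cnj complex_cnj_complex_of_real)
    qed
    then show ?thesis unfolding is_K_check_tilde_def H_check_pre_H by auto
  qed
  also have "\<dots> \<longleftrightarrow> is_innovation (pre_H n (m + 1)) (e_minus R m) K"
  proof (rule innovation_iff[OF pre_H_subspace(2) e_minus_LR])
    fix w assume "w \<in> pre_H n m"
    then obtain hp hm where w: "w = lift (\<lambda>t. t powi n * hp t) (\<lambda>t. cnj t powi m * hm t)"
      "hp \<in> H2_plus" "hm \<in> H2_minus" by (auto simp: pre_H_def)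
    define c where "c = (LINT s|circle. s * hm s)"
    let ?s = "lift (\<lambda>t. t powi n * hp t) (\<lambda>t. cnj t powi (m + 1) * (t * hm t - c))"
    have "?s \<in> pre_H n (m + 1)"
      unfolding c_def by (rule pre_HI[OF w(2) forward_shift_H2_minus[OF w(3)]])
    moreover have "w t = c *s e_minus R m t + ?s t" if "t \<in> sphere 0 1" for t
    proof -
      have t: "cmod t = 1" "cnj t \<noteq> 0" using that by auto
      have "cnj t powi (m + 1) * (t * hm t) = cnj t powi m * (cnj t * t) * hm t"
        using t(2) by (simp add: power_int_add_1)
      then have "cnj t powi (m + 1) * (t * hm t) = cnj t powi m * hm t"
        using mult_cnj_on_circle(2)[OF t(1)] by simp
      moreover have "c * p + p * (t * hm t - c) = p * (t * hm t)" for p by (simp add: algebra_simps)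
      ultimately have "cnj t powi m * hm t = c * cnj t powi (m + 1) + cnj t powi (m + 1) * (t * hm t - c)"
        by (simp only:)
      then show ?thesis
        unfolding w e_minus_lift by (intro lift_combine) simp_all
    qed
    ultimately show "\<exists>c. \<exists>s\<in>pre_H n (m + 1). \<forall>t\<in>sphere 0 1. w t = c *s e_minus R m t + s t" by blast
  next
    fix c s assume "s \<in> pre_H n (m + 1)"
    then obtain hp hm where s: "s = lift (\<lambda>t. t powi n * hp t) (\<lambda>t. cnj t powi (m + 1) * hm t)"
      "hp \<in> H2_plus" "hm \<in> H2_minus" by (auto simp: pre_H_def)
    let ?w = "lift (\<lambda>t. t powi n * hp t) (\<lambda>t. cnj t powi m * (cnj t * (c + hm t)))"
    have "?w \<in> pre_H n m"
      by (rule pre_HI[OF s(2) backward_shift_H2_minus[OF s(3)]])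
    moreover have "?w t = c *s e_minus R m t + s t" if "t \<in> sphere 0 1" for t
    proof -
      have "cnj t \<noteq> 0" using that by auto
      then have "cnj t powi (m + 1) = cnj t powi m * cnj t" by (simp add: power_int_add_1)
      then have "cnj t powi m * (cnj t * (c + hm t)) = c * cnj t powi (m + 1) + cnj t powi (m + 1) * hm t"
        by (simp only:) (simp add: algebra_simps)
      then show ?thesis
        unfolding s e_minus_lift by (intro lift_combine) simp_all
    qed
    ultimately show "\<exists>w\<in>pre_H n m. \<forall>t\<in>sphere 0 1. w t = c *s e_minus R m t + s t" by blast
  qed
  finally show ?thesis .
qed

section \<open>Translation and reflection of the distances\<close>

lemma powi_eq_mult:
  assumes "cmod t = 1"
  shows "cnj t powi m = t powi n * cnj t powi (n + m)"
proof -
  have t: "t \<noteq> 0" "cnj t = inverse t"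
    using assms inverse_unique[OF mult_cnj_on_circle(1)[OF assms]] by auto
  show "cnj t powi m = t powi n * cnj t powi (n + m)"
    using t(1) unfolding t(2) by (simp add: power_int_inverse power_int_add field_simps)
qed

text \<open>Dividing by the unimodular \<open>t powi n\<close> leaves an expression in which
  \<open>n\<close> and \<open>m\<close> enter through \<open>n + m\<close> alone.\<close>

lemma nrm_e_plus_diff:
  assumes "hp \<in> L2" "hm \<in> L2"
  shows "nrm (e_plus R n - lift (\<lambda>t. t powi (n + 1) * hp t) (\<lambda>t. cnj t powi m * hm t)) =
    sqrt (LINT t|circle. W_form (R t) (1 - t * hp t) (cnj t powi (n + m) * - hm t))"
proof -
  have 1: "(\<lambda>t. t powi n - t powi (n + 1) * hp t) \<in> L2"
    using L2.V_closed(3)[OF powi_const_L2(1) powi_L2(1)[OF assms(1)]] by (simp add: fun_diff_def)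
  have 2: "(\<lambda>t. 0 - cnj t powi m * hm t) \<in> L2"
    using L2.V_closed(3)[OF zero_L2 powi_L2(2)[OF assms(2)]] by (simp add: fun_diff_def)
  have "W_form (R t) (t powi n - t powi (n + 1) * hp t) (0 - cnj t powi m * hm t) =
      W_form (R t) (1 - t * hp t) (cnj t powi (n + m) * - hm t)" if "t \<in> space circle" for t
  proof -
    have t: "cmod t = 1" "t \<noteq> 0" using that by auto
    have "t powi (n + 1) = t powi n * t" using t(2) by (simp add: power_int_add_1)
    then have "t powi n - t powi (n + 1) * hp t = t powi n * (1 - t * hp t)"
      by (simp only:) (simp add: algebra_simps)
    moreover have "0 - cnj t powi m * hm t = t powi n * (cnj t powi (n + m) * - hm t)"
      using powi_eq_mult[OF t(1), of m n] by (simp add: mult.assoc)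
    ultimately show ?thesis using t(1) by (simp only: W_form_unimodular norm_power_int power_int_1_left)
  qed
  then show ?thesis
    unfolding e_plus_lift lift_diff lift_LR(2)[OF 1 2]
    by (intro arg_cong[where f = sqrt] Bochner_Integration.integral_cong refl)
qed

text \<open>\<open>W_form_reflect\<close> exchanges the two components, and the unimodular factor
  \<open>t powi (m + 1)\<close> is divided out. The outcome has the shape of the integral for
  \<open>e_plus\<close>, with the reflections of \<open>hm\<close> and \<open>hp\<close> in the
  roles of \<open>hp\<close> and \<open>hm\<close>.\<close>

lemma nrm_e_minus_diff:
  assumes "hp \<in> L2" "hm \<in> L2"
  shows "nrm (e_minus R m - lift (\<lambda>t. t powi n * hp t) (\<lambda>t. cnj t powi (m + 1) * hm t)) =
    sqrt (LINT t|circle. W_form (R t) (1 - t * (cnj t * cnj (hm t))) (cnj t powi (n + m) * - (cnj t * cnj (hp t))))"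
proof -
  have 1: "(\<lambda>t. 0 - t powi n * hp t) \<in> L2"
    using L2.V_closed(3)[OF zero_L2 powi_L2(1)[OF assms(1)]] by (simp add: fun_diff_def)
  have 2: "(\<lambda>t. cnj t powi (m + 1) - cnj t powi (m + 1) * hm t) \<in> L2"
    using L2.V_closed(3)[OF powi_const_L2(2) powi_L2(2)[OF assms(2)]] by (simp add: fun_diff_def)
  have "W_form (R t) (0 - t powi n * hp t) (cnj t powi (m + 1) - cnj t powi (m + 1) * hm t) =
      W_form (R t) (1 - t * (cnj t * cnj (hm t))) (cnj t powi (n + m) * - (cnj t * cnj (hp t)))"
    if "t \<in> space circle" for t
  proof -
    have t: "cmod t = 1" "cnj t \<noteq> 0" using that by auto
    let ?z = "t powi (m + 1)"
    have "cnj (cnj t powi (m + 1) - cnj t powi (m + 1) * hm t) = ?z * (1 - cnj (hm t))"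
      by (simp add: complex_cnj_power_int algebra_simps)
    also have "cnj (hm t) = t * (cnj t * cnj (hm t))"
      using mult_cnj_on_circle(1)[OF t(1)] by (simp add: mult.assoc[symmetric])
    finally have a: "cnj (cnj t powi (m + 1) - cnj t powi (m + 1) * hm t) = ?z * (1 - t * (cnj t * cnj (hm t)))" .
    \<comment> \<open>The exponent left over is \<open>n + m + 1\<close>; the surplus factor
      \<open>cnj t\<close> is the one in the reflection of \<open>hp\<close>.\<close>
    have "cnj t powi n = ?z * (cnj t powi (n + m) * cnj t)"
    proof -
      have "m + 1 + n = (n + m) + 1" by simp
      then have "cnj t powi n = ?z * cnj t powi ((n + m) + 1)"
        using powi_eq_mult[OF t(1), of n "m + 1"] by (simp only:)
      then show ?thesis using power_int_add_1[of "cnj t" "n + m"] t(2) by (simp only: simp_thms)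
    qed
    then have b: "cnj (0 - t powi n * hp t) = ?z * (cnj t powi (n + m) * - (cnj t * cnj (hp t)))"
      by (simp add: complex_cnj_power_int mult.assoc)
    have "W_form (R t) (0 - t powi n * hp t) (cnj t powi (m + 1) - cnj t powi (m + 1) * hm t) =
        W_form (R t) (cnj (cnj t powi (m + 1) - cnj t powi (m + 1) * hm t)) (cnj (0 - t powi n * hp t))"
      by (rule W_form_reflect[symmetric])
    also have "\<dots> = W_form (R t) (1 - t * (cnj t * cnj (hm t))) (cnj t powi (n + m) * - (cnj t * cnj (hp t)))"
      unfolding a b using t(1) by (simp only: W_form_unimodular norm_power_int power_int_1_left)
    finally show ?thesis .
  qed
  then show ?thesis
    unfolding e_minus_lift lift_diff lift_LR(2)[OF 1 2]
    by (intro arg_cong[where f = sqrt] Bochner_Integration.integral_cong refl)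
qed

text \<open>By \<open>nrm_e_plus_diff\<close> both infima range over the same set of numbers. This
  is what makes \<open>a_check_0\<close> independent of the pair \<open>n\<close>,
  \<open>m\<close>.\<close>

lemma defect_plus_eq:
  "defect (pre_H (n + 1) m) (e_plus R n) = defect (pre_H (0 + 1) (n + m)) (e_plus R 0)"
proof -
  define F where "F N p = sqrt (LINT t|circle. W_form (R t) (1 - t * fst p t) (cnj t powi N * - snd p t))"
    for N :: int and p :: "(complex \<Rightarrow> complex) \<times> (complex \<Rightarrow> complex)"
  have im: "(\<lambda>s. nrm (e_plus R n - s)) ` pre_H (n + 1) m = F (n + m) ` (H2_plus \<times> H2_minus)" for n m
  proof -
    have "{f x y | x y. x \<in> A \<and> y \<in> B} = (\<lambda>p. f (fst p) (snd p)) ` (A \<times> B)"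
      for f :: "(complex \<Rightarrow> complex) \<Rightarrow> (complex \<Rightarrow> complex) \<Rightarrow> complex \<Rightarrow> complex^2" and A B
      by force
    then show ?thesis
      unfolding pre_H_def image_image
      by (auto simp: F_def nrm_e_plus_diff H2_plus_L2 H2_minus_L2 image_image intro!: image_cong)
  qed
  show ?thesis unfolding defect_def im by simp
qed

lemma defect_le_1:
  "defect (pre_H n m) (e_plus R k) \<le> 1" "defect (pre_H n m) (e_minus R k) \<le> 1"
  using defect_le[OF pre_H_subspace(2) e_plus_LR subspace_0[OF pre_H_subspace(1)]]
    defect_le[OF pre_H_subspace(2) e_minus_LR subspace_0[OF pre_H_subspace(1)]]
  by (simp_all add: nrm_e_plus nrm_e_minus)

text \<open>Both families meet the bound of \<open>W_form_lower_bound\<close>: the vectors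
  \<open>e_plus\<close> through the inclusions of the Hardy spaces in the weak classes, the vectors
  \<open>e_minus\<close> through the reflections.\<close>

lemma defect_ge:
  assumes e: "0 < e"
  shows "\<exists>N0. \<forall>n m. N0 \<le> n + m \<longrightarrow> 1 - e \<le> defect (pre_H (n + 1) m) (e_plus R n) \<and>
    1 - e \<le> defect (pre_H n (m + 1)) (e_minus R m)"
proof -
  obtain N0 where N0: "\<And>N u v. N \<ge> N0 \<Longrightarrow> u \<in> weak_plus \<Longrightarrow> v \<in> weak_minus \<Longrightarrow>
      1 - e \<le> sqrt (LINT t|circle. W_form (R t) (1 - t * u t) (cnj t ^ N * v t))"
    using W_form_lower_bound[OF e] by blast
  have N0': "1 - e \<le> sqrt (LINT t|circle. W_form (R t) (1 - t * u t) (cnj t powi N * - v t))"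
    if "int N0 \<le> N" "u \<in> weak_plus" "v \<in> weak_minus" for N u v
    using N0[OF _ that(2) uminus_weak_minus[OF that(3)], of "nat N"] that(1)
    by (simp add: power_int_def nat_le_iff le_nat_iff)
  show ?thesis
  proof (intro exI[of _ "int N0"] allI impI conjI)
    fix n m assume nm: "int N0 \<le> n + m"
    have ne: "pre_H k l \<noteq> {}" for k l using subspace_0[OF pre_H_subspace(1)] by blast
    show "1 - e \<le> defect (pre_H (n + 1) m) (e_plus R n)"
      unfolding defect_def
    proof (rule cINF_greatest[OF ne])
      fix s assume "s \<in> pre_H (n + 1) m"
      then obtain hp hm where s: "s = lift (\<lambda>t. t powi (n + 1) * hp t) (\<lambda>t. cnj t powi m * hm t)"
        "hp \<in> H2_plus" "hm \<in> H2_minus" by (auto simp: pre_H_def)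
      show "1 - e \<le> nrm (e_plus R n - s)"
        unfolding s(1) nrm_e_plus_diff[OF H2_plus_L2[OF s(2)] H2_minus_L2[OF s(3)]]
        using s(2,3) H2_plus_weak_plus H2_minus_weak_minus by (intro N0' nm) auto
    qed
    show "1 - e \<le> defect (pre_H n (m + 1)) (e_minus R m)"
      unfolding defect_def
    proof (rule cINF_greatest[OF ne])
      fix s assume "s \<in> pre_H n (m + 1)"
      then obtain hp hm where s: "s = lift (\<lambda>t. t powi n * hp t) (\<lambda>t. cnj t powi (m + 1) * hm t)"
        "hp \<in> H2_plus" "hm \<in> H2_minus" by (auto simp: pre_H_def)
      show "1 - e \<le> nrm (e_minus R m - s)"
        unfolding s(1) nrm_e_minus_diff[OF H2_plus_L2[OF s(2)] H2_minus_L2[OF s(3)]]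
        by (rule N0'[OF nm reflect_H2_minus[OF s(3)] reflect_H2_plus[OF s(2)]])
    qed
  qed
qed

text \<open>Two integer functions of one parameter cover the limit with \<open>n\<close> fixed, the
  limit with \<open>m\<close> fixed, and the limit in \<open>j\<close> through \<open>n = 0\<close>,
  \<open>m = j\<close>.\<close>

lemma defect_tendsto:
  fixes n m :: "int \<Rightarrow> int"
  assumes "filterlim (\<lambda>k. n k + m k) at_top at_top"
  shows "((\<lambda>k. defect (pre_H (n k + 1) (m k)) (e_plus R (n k))) \<longlongrightarrow> 1) at_top"
    "((\<lambda>k. defect (pre_H (n k) (m k + 1)) (e_minus R (m k))) \<longlongrightarrow> 1) at_top"
proof -
  have ev: "eventually (\<lambda>k. 1 - e \<le> defect (pre_H (n k + 1) (m k)) (e_plus R (n k)) \<and>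
      1 - e \<le> defect (pre_H (n k) (m k + 1)) (e_minus R (m k))) at_top" if e: "0 < e" for e
  proof -
    obtain N0 where "\<forall>n m. N0 \<le> n + m \<longrightarrow> 1 - e \<le> defect (pre_H (n + 1) m) (e_plus R n) \<and>
        1 - e \<le> defect (pre_H n (m + 1)) (e_minus R m)" using defect_ge[OF e] by blast
    moreover have "eventually (\<lambda>k. N0 \<le> n k + m k) at_top"
      using assms by (simp add: filterlim_at_top)
    ultimately show ?thesis by (auto elim: eventually_mono)
  qed
  show "((\<lambda>k. defect (pre_H (n k + 1) (m k)) (e_plus R (n k))) \<longlongrightarrow> 1) at_top"
  proof (rule order_tendstoI)
    fix y :: real assume "y < 1"
    then have p: "0 < (1 - y) / 2" and y: "y < 1 - (1 - y) / 2" by (simp_all add: field_simps)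
    show "eventually (\<lambda>k. y < defect (pre_H (n k + 1) (m k)) (e_plus R (n k))) at_top"
      using ev[OF p]
    proof eventually_elim
      case (elim k)
      then show ?case using less_le_trans[OF y] by blast
    qed
  next
    fix y :: real assume "1 < y"
    then show "eventually (\<lambda>k. defect (pre_H (n k + 1) (m k)) (e_plus R (n k)) < y) at_top"
      using defect_le_1(1) le_less_trans by (intro always_eventually) blast
  qed
  show "((\<lambda>k. defect (pre_H (n k) (m k + 1)) (e_minus R (m k))) \<longlongrightarrow> 1) at_top"
  proof (rule order_tendstoI)
    fix y :: real assume "y < 1"
    then have p: "0 < (1 - y) / 2" and y: "y < 1 - (1 - y) / 2" by (simp_all add: field_simps)
    show "eventually (\<lambda>k. y < defect (pre_H (n k) (m k + 1)) (e_minus R (m k))) at_top"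
      using ev[OF p]
    proof eventually_elim
      case (elim k)
      then show ?case using less_le_trans[OF y] by blast
    qed
  next
    fix y :: real assume "1 < y"
    then show "eventually (\<lambda>k. defect (pre_H (n k) (m k + 1)) (e_minus R (m k)) < y) at_top"
      using defect_le_1(2) le_less_trans by (intro always_eventually) blast
  qed
qed

text \<open>The choice operator is certain to return a vector with the defining properties once one
  exists; positivity of the defect secures that through \<open>innovation_exists\<close>.\<close>

lemma K_check_innovation:
  assumes "0 < defect (pre_H (n + 1) m) (e_plus R n)"
  shows "is_innovation (pre_H (n + 1) m) (e_plus R n) (K_check R n m)"
  using someI_ex[OF innovation_exists[OF pre_H_subspace e_plus_LR assms, folded is_K_check_iff]]
  unfolding K_check_def is_K_check_iff .

lemma K_check_tilde_innovation:
  assumes "0 < defect (pre_H n (m + 1)) (e_minus R m)"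
  shows "is_innovation (pre_H n (m + 1)) (e_minus R m) (K_check_tilde R n m)"
  using someI_ex[OF innovation_exists[OF pre_H_subspace e_minus_LR assms, folded is_K_check_tilde_iff]]
  unfolding K_check_tilde_def is_K_check_tilde_iff .

lemma K_check_tendsto:
  "((\<lambda>m. LR_norm R (\<lambda>t. K_check R n m t - e_plus R n t)) \<longlongrightarrow> 0) at_top"
proof -
  have "filterlim (\<lambda>m. n + m) at_top (at_top :: int filter)"
    unfolding filterlim_at_top
  proof
    fix Z show "eventually (\<lambda>m. Z \<le> n + m) at_top"
      using eventually_ge_at_top[of "Z - n"] by eventually_elim simp
  qed
  then have lim: "((\<lambda>m. defect (pre_H (n + 1) m) (e_plus R n)) \<longlongrightarrow> 1) at_top"
    using defect_tendsto(1)[of "\<lambda>_. n" "\<lambda>m. m"] by simp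
  then have "((\<lambda>m. sqrt (2 - 2 * defect (pre_H (n + 1) m) (e_plus R n))) \<longlongrightarrow> sqrt (2 - 2 * 1)) at_top"
    by (intro tendsto_intros)
  \<comment> \<open>The limit 1 forces a positive defect for large \<open>m\<close>, so that
    \<open>K_check R n m\<close> is an actual innovation there and the distance formula
    applies.\<close>
  moreover have "eventually (\<lambda>m. sqrt (2 - 2 * defect (pre_H (n + 1) m) (e_plus R n)) =
      LR_norm R (\<lambda>t. K_check R n m t - e_plus R n t)) at_top"
    using order_tendstoD(1)[OF lim zero_less_one]
  proof eventually_elim
    case (elim m)
    then show ?case
      using innovation_dist[OF pre_H_subspace e_plus_LR nrm_e_plus K_check_innovation[OF elim]]
      by (simp add: LR_norm_nrm fun_diff_def)
  qed
  ultimately show ?thesis by (auto elim: Lim_transform_eventually)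
qed

lemma K_check_tilde_tendsto:
  "((\<lambda>n. LR_norm R (\<lambda>t. K_check_tilde R n m t - e_minus R m t)) \<longlongrightarrow> 0) at_top"
proof -
  have "filterlim (\<lambda>n. n + m) at_top (at_top :: int filter)"
    unfolding filterlim_at_top
  proof
    fix Z show "eventually (\<lambda>n. Z \<le> n + m) at_top"
      using eventually_ge_at_top[of "Z - m"] by eventually_elim simp
  qed
  then have lim: "((\<lambda>n. defect (pre_H n (m + 1)) (e_minus R m)) \<longlongrightarrow> 1) at_top"
    using defect_tendsto(2)[of "\<lambda>n. n" "\<lambda>_. m"] by simp
  then have "((\<lambda>n. sqrt (2 - 2 * defect (pre_H n (m + 1)) (e_minus R m))) \<longlongrightarrow> sqrt (2 - 2 * 1)) at_top"
    by (intro tendsto_intros)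
  moreover have "eventually (\<lambda>n. sqrt (2 - 2 * defect (pre_H n (m + 1)) (e_minus R m)) =
      LR_norm R (\<lambda>t. K_check_tilde R n m t - e_minus R m t)) at_top"
    using order_tendstoD(1)[OF lim zero_less_one]
  proof eventually_elim
    case (elim n)
    then show ?case
      using innovation_dist[OF pre_H_subspace e_minus_LR nrm_e_minus K_check_tilde_innovation[OF elim]]
      by (simp add: LR_norm_nrm fun_diff_def)
  qed
  ultimately show ?thesis by (auto elim: Lim_transform_eventually)
qed

text \<open>For large \<open>j\<close> all pairs with \<open>n + m = j\<close> have the same
  positive defect, so the definite description has exactly one candidate and returns that
  defect.\<close>

lemma a_check_0_tendsto: "((\<lambda>j. a_check_0 R j) \<longlongrightarrow> 1) at_top"
proof -
  let ?d = "\<lambda>j. defect (pre_H (0 + 1) j) (e_plus R 0)"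
  have lim: "(?d \<longlongrightarrow> 1) at_top"
    using defect_tendsto(1)[of "\<lambda>_. 0" "\<lambda>m. m"] by (simp add: filterlim_ident)
  then have "((\<lambda>j. complex_of_real (?d j)) \<longlongrightarrow> of_real 1) at_top"
    by (intro tendsto_intros)
  moreover have "eventually (\<lambda>j. complex_of_real (?d j) = a_check_0 R j) at_top"
    using order_tendstoD(1)[OF lim zero_less_one]
  proof eventually_elim
    case (elim j)
    have val: "LR_inner R (e_plus R n) (K_check R n m) = complex_of_real (?d j)" if "n + m = j" for n m
    proof -
      have eq: "defect (pre_H (n + 1) m) (e_plus R n) = ?d j" using defect_plus_eq[of n m] that by simp
      then show ?thesis
        using innovation_ip[OF pre_H_subspace e_plus_LR K_check_innovation[of n m]] elim by simp
    qed
    show ?case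
      unfolding a_check_0_def
    proof (intro the_equality[symmetric] allI impI val)
      fix c assume "\<forall>n m. n + m = j \<longrightarrow> LR_inner R (e_plus R n) (K_check R n m) = c"
      then show "c = complex_of_real (?d j)" using val[of 0 j] by simp
    qed
  qed
  ultimately show ?thesis by (auto elim: Lim_transform_eventually)
qed

end

theorem theorem5p3:
  fixes R :: "complex \<Rightarrow> complex"
  assumes "R \<in> borel_measurable circle"
    and "AE t in circle. cmod (R t) \<le> 1"
    and "log_integrable circle (\<lambda>t. 1 - cmod (R t))"
  shows "(\<forall>n::int. ((\<lambda>m::int. LR_norm R (\<lambda>t. K_check R n m t - e_plus R n t)) \<longlongrightarrow> 0) at_top)
    \<and> (\<forall>m::int. ((\<lambda>n::int. LR_norm R (\<lambda>t. K_check_tilde R n m t - e_minus R m t)) \<longlongrightarrow> 0) at_top)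
    \<and> ((\<lambda>j::int. a_check_0 R j) \<longlongrightarrow> 1) at_top"
proof -
  interpret reflection R using assms(1,3) by unfold_locales
  show ?thesis using K_check_tendsto K_check_tilde_tendsto a_check_0_tendsto by blast
qed

end
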